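(* Suppose $\Omega=(a,b)$ is compactly contained in $\mathcal{D}=(0,1)$ and $f\in C^{s_0}(\overline\Omega)$ with $s_0$ an integer. Let $s>\frac12$ be an integer, and let $$\Phi_N(x,\tilde x)=1+\sum_{k=1}^N(1+4\pi^2k^2)^{-s}\cos(2\pi kx)\cos(2\pi k\tilde x)+\sum_{k=1}^N(1+4\pi^2k^2)^{-s}\sin(2\pi kx)\sin(2\pi k\tilde x),\quad x,\tilde x\in\mathcal{D}.$$ Suppose $K_{\Phi_N}$ is invertible. Then there exists $h_0$ independent of $N$ and $n$ such that if $h_{n,\Omega}\le h_0$, we have, by setting $\sqrt\lambda\asymp h_{n,\Omega}^{s-1/2}$, $$\|f-\mathcal{I}^\lambda_{\Phi_N,X_n}f\|_{L^2(\Omega)}\le C\big[\sqrt n\,h_{n,\Omega}^{\frac12}(\log N)N^{-s_0}+h_{n,\Omega}^sN^{(s-s_0)\vee0}\big]\|f\|_{C^{s_0}(\overline\Omega)},$$ $$\|f-\mathcal{I}^\lambda_{\Phi_N,X_n}f\|_{L^\infty(\Omega)}\le C\big[\sqrt n(\log N)N^{-s_0}+h_{n,\Omega}^{s-\frac12}N^{(s-s_0)\vee0}\big]\|f\|_{C^{s_0}(\overline\Omega)},$$ where $C$ is independent of $N$ and $n$. If the design points satisfy $h_{n,\Omega}\lesssim n^{-1}$, then setting $2N+1=n$ (so that invertibility of $K_{\Phi_N}$ is ensured) we have $$\|f-\mathcal{I}^\lambda_{\Phi_N,X_n}f\|_{L^2(\Omega)}\le C(\log n)n^{-(s_0\wedge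 s)}\|f\|_{C^{s_0}(\overline\Omega)},$$ $$\|f-\mathcal{I}^\lambda_{\Phi_N,X_n}f\|_{L^\infty(\Omega)}\le C(\log n)n^{-(s_0\wedge s-\frac12)}\|f\|_{C^{s_0}(\overline\Omega)}.$$
   Context: $N\ge1$ is a truncation parameter. $X_n=\{x_1,\dots,x_n\}\subset\Omega$ is a fixed set of $n$ distinct points with fill distance $h_{n,\Omega}:=\sup_{x\in\Omega}\operatorname{dist}(x,X_n)$. For a kernel $\Psi$: $K_\Psi:=[\Psi(x_i,x_j)]_{i,j=1}^n$, $k_\Psi(x):=(\Psi(x,x_1),\dots,\Psi(x,x_n))^T$, and for $\lambda\ge0$, $\mathcal{I}^\lambda_{\Psi,X_n}f(x):=k_\Psi(x)^T(K_\Psi+\lambda I)^{-1}Y$ with $Y=(f(x_1),\dots,f(x_n))^T$. $C^{s_0}(\overline\Omega)$ is the usual space of $s_0$-times continuously differentiable functions on $\overline\Omega$ with its usual norm. $a\wedge b=\min(a,b)$, $a\vee b=\max(a,b)$; $a\lesssim b$ means $a\le cb$ for a universal constant $c$, and $a\asymp b$ means both $a\lesssim b$ and $b\lesssim a$. *)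

theory Defs
  imports
    "HOL-Probability.Essential_Supremum"
    "Jordan_Normal_Form.Gauss_Jordan_Elimination"
begin

definition fill_distance :: "real set \<Rightarrow> real set \<Rightarrow> real" where
  "fill_distance \<Omega> X = (SUP x\<in>\<Omega>. infdist x X)"

text \<open>The design points are given as a list, so that \<open>X ! i\<close> (for \<open>i < length X\<close>) is the point
  \<open>x\<^sub>i\<^sub>+\<^sub>1\<close>.\<close>

definition kernel_matrix :: "(real \<Rightarrow> real \<Rightarrow> real) \<Rightarrow> real list \<Rightarrow> real Matrix.mat" where
  "kernel_matrix \<Psi> X = Matrix.mat (length X) (length X) (\<lambda>(i, j). \<Psi> (X ! i) (X ! j))"

definition kernel_vec :: "(real \<Rightarrow> real \<Rightarrow> real) \<Rightarrow> real list \<Rightarrow> real \<Rightarrow> real Matrix.vec" where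
  "kernel_vec \<Psi> X x = Matrix.vec (length X) (\<lambda>i. \<Psi> x (X ! i))"

definition data_vec :: "real list \<Rightarrow> (real \<Rightarrow> real) \<Rightarrow> real Matrix.vec" where
  "data_vec X f = Matrix.vec (length X) (\<lambda>i. f (X ! i))"

text \<open>\<open>the (mat_inverse A)\<close> is the inverse of \<open>A\<close> whenever \<open>A\<close> is invertible. For a positive
  semidefinite kernel and \<open>\<lambda> > 0\<close> the regularized matrix below is always invertible.\<close>

definition regularized_interpolant ::
    "(real \<Rightarrow> real \<Rightarrow> real) \<Rightarrow> real list \<Rightarrow> real \<Rightarrow> (real \<Rightarrow> real) \<Rightarrow> real \<Rightarrow> real" where
  "regularized_interpolant \<Psi> X lam f x =
     scalar_prod (kernel_vec \<Psi> X x)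
       (the (mat_inverse (kernel_matrix \<Psi> X + lam \<cdot>\<^sub>m 1\<^sub>m (length X))) *\<^sub>v data_vec X f)"

definition fourier_kernel :: "nat \<Rightarrow> nat \<Rightarrow> real \<Rightarrow> real \<Rightarrow> real" where
  "fourier_kernel s N x y =
     1 + (\<Sum>k=1..N. (1 + 4 * pi\<^sup>2 * (real k)\<^sup>2) powr (- real s)
                      * cos (2 * pi * real k * x) * cos (2 * pi * real k * y))
       + (\<Sum>k=1..N. (1 + 4 * pi\<^sup>2 * (real k)\<^sup>2) powr (- real s)
                      * sin (2 * pi * real k * x) * sin (2 * pi * real k * y))"

text \<open>Derivatives are taken within \<open>S\<close>; for \<open>S = {a..b}\<close> with \<open>a < b\<close> they are the usual
  derivatives in the interior and one-sided derivatives at the endpoints, and depend only on the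
  values of the function on \<open>S\<close>.\<close>

primrec nth_deriv_within :: "real set \<Rightarrow> nat \<Rightarrow> (real \<Rightarrow> real) \<Rightarrow> real \<Rightarrow> real" where
  "nth_deriv_within S 0 f = f"
| "nth_deriv_within S (Suc k) f = (\<lambda>x. vector_derivative (nth_deriv_within S k f) (at x within S))"

definition Ck_space :: "nat \<Rightarrow> real set \<Rightarrow> (real \<Rightarrow> real) set" where
  "Ck_space k S = {f. (\<forall>j<k. nth_deriv_within S j f differentiable_on S) \<and>
                      (\<forall>j\<le>k. continuous_on S (nth_deriv_within S j f))}"

definition Ck_norm :: "nat \<Rightarrow> real set \<Rightarrow> (real \<Rightarrow> real) \<Rightarrow> real" where
  "Ck_norm k S f = (\<Sum>j\<le>k. SUP x\<in>S. \<bar>nth_deriv_within S j f x\<bar>)"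

text \<open>The Lebesgue norms take values in the extended nonnegative reals, so that an upper bound on
  them carries integrability, respectively essential boundedness.\<close>

definition L2_norm :: "real set \<Rightarrow> (real \<Rightarrow> real) \<Rightarrow> ennreal" where
  "L2_norm \<Omega> g =
     (let I = (\<integral>\<^sup>+ x\<in>\<Omega>. ennreal ((g x)\<^sup>2) \<partial>lborel)
      in if I = \<infinity> then \<infinity> else ennreal (sqrt (enn2real I)))"

definition Linf_norm :: "real set \<Rightarrow> (real \<Rightarrow> real) \<Rightarrow> ennreal" where
  "Linf_norm \<Omega> g = esssup (restrict_space lborel \<Omega>) (\<lambda>x. ennreal \<bar>g x\<bar>)"

end

(* Extend f to a 1-periodic function of class C^s0 and approximate it by a trigonometric polynomial p of
   degree N with |f - p| <= eps = O(N^-s0) and H^s norm P = O(N^max(s-s0,0)).  Such polynomials form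
   the native space of the truncated kernel, with the weighted l2 norm of the Fourier coefficients as
   its norm.  Since the interpolant minimizes a regularized energy, u = p - I f satisfies
   |u|_H^2 + sum u(x_i)^2 / lam <= |p|_H^2 + n eps^2 / lam.  On cells of length comparable to h that
   contain enough separated design points, u is controlled by its values at these points and by its
   s-th derivative; with lam comparable to h^(2s-1) this gives the bounds up to sqrt n eps.
   The logarithm is only needed to be bounded below: for N = 1 the kernel has rank 3, so its matrix
   is singular once the fill distance is small. *)

theory Submission
  imports Defs "Jordan_Normal_Form.Determinant"
begin

section \<open>Periodic functions of class \<open>C\<^sup>m\<close>\<close>

text \<open>Fourier partial sums would cost a factor log N in the uniform error. Fejer-Korovkin
  means avoid it: they average against a nonnegative kernel and commute with differentiation, so one
  and the same \<open>p\<close> is close to the extension of f and keeps bounds on its first s0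
  derivatives. Having degree N then turns bounds on min(s, s0) derivatives into one on the native
  norm, at the price N^(s - min(s, s0)), as in Bernstein's inequality. The values f(x_i) are treated
  as noisy samples of \<open>p\<close> with noise of size eps; this is the origin of sqrt n. The
  choice of lam makes the quantity in the sampling bound, sum u(x_i)^2 + h^(2s-1) |u|_H^2,
  comparable to lam times the energy that minimality controls, so the two inequalities fit together.
  The sampling inequality is proved for every h: when h is too large for the cells to fit into
  Omega, a Sobolev embedding takes over. Hence h0 serves only to exclude N = 1.\<close>

definition trigsum :: "nat \<Rightarrow> (nat \<Rightarrow> real) \<Rightarrow> (nat \<Rightarrow> real) \<Rightarrow> real \<Rightarrow> real" where
  "trigsum N c d x = (\<Sum>k\<le>N. c k * cos (2 * pi * real k * x) + d k * sin (2 * pi * real k * x))"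

definition trigpoly :: "nat \<Rightarrow> (real \<Rightarrow> real) \<Rightarrow> bool" where
  "trigpoly N f \<longleftrightarrow> (\<exists>c d. f = trigsum N c d)"

text \<open>\<open>Cper m M F\<close>: \<open>F\<close> is 1-periodic of class \<open>C\<^sup>m\<close>, and \<open>F\<close> and its derivatives up to
  order \<open>m\<close> are bounded by \<open>M\<close>.\<close>

primrec Cper :: "nat \<Rightarrow> real \<Rightarrow> (real \<Rightarrow> real) \<Rightarrow> bool" where
  "Cper 0 M F \<longleftrightarrow> continuous_on UNIV F \<and> (\<forall>x. F (x + 1) = F x) \<and> (\<forall>x. \<bar>F x\<bar> \<le> M)"
| "Cper (Suc m) M F \<longleftrightarrow> (\<forall>x. F (x + 1) = F x) \<and> (\<forall>x. \<bar>F x\<bar> \<le> M) \<and>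
     (\<exists>G. Cper m M G \<and> (\<forall>x. (F has_real_derivative G x) (at x)))"

lemma CperD:
  assumes "Cper m M F"
  shows "F (x + 1) = F x" "\<bar>F x\<bar> \<le> M" "continuous_on S F"
proof -
  have "continuous_on UNIV F"
  proof (cases m)
    case (Suc k)
    then obtain G where "\<forall>x. (F has_real_derivative G x) (at x)" using assms by auto
    then show ?thesis by (intro DERIV_continuous_on) auto
  qed (use assms in auto)
  then show "continuous_on S F" by (rule continuous_on_subset) auto
  show "F (x + 1) = F x" "\<bar>F x\<bar> \<le> M" using assms by (cases m; auto)+
qed

lemma Cper_nonneg: "Cper m M F \<Longrightarrow> 0 \<le> M"
  using CperD(2)[of m M F 0] by linarith

lemma Cper_mono: "Cper m M F \<Longrightarrow> M \<le> M' \<Longrightarrow> Cper m M' F"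
proof (induction m arbitrary: F)
  case 0 then show ?case by (auto intro: order.trans)
next
  case (Suc m) then show ?case by (auto intro: order.trans)
qed

lemma Cper_SucD: "Cper (Suc m) M F \<Longrightarrow> Cper m M F"
proof (induction m arbitrary: F)
  case 0
  from CperD[OF 0] show ?case by auto
next
  case (Suc m)
  from Suc.prems obtain G where G: "Cper (Suc m) M G" "\<forall>x. (F has_real_derivative G x) (at x)" by auto
  with Suc.IH[OF G(1)] show ?case using Suc.prems by auto
qed

lemma Cper_le: "Cper m M F \<Longrightarrow> k \<le> m \<Longrightarrow> Cper k M F"
proof (induction m)
  case (Suc m)
  then show ?case using Cper_SucD le_Suc_eq by blast
qed simp

lemma Cper_add: "Cper m M F \<Longrightarrow> Cper m L G \<Longrightarrow> Cper m (M + L) (\<lambda>x. F x + G x)"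
proof (induction m arbitrary: F G)
  case 0
  have "\<bar>F x + G x\<bar> \<le> M + L" for x using CperD(2)[OF 0(1), of x] CperD(2)[OF 0(2), of x] by linarith
  with 0 show ?case by (auto intro: continuous_on_add)
next
  case (Suc m)
  obtain F' G' where *: "Cper m M F'" "\<forall>x. (F has_real_derivative F' x) (at x)"
    "Cper m L G'" "\<forall>x. (G has_real_derivative G' x) (at x)" using Suc.prems by auto
  have "\<bar>F x + G x\<bar> \<le> M + L" for x
    using CperD(2)[OF Suc.prems(1), of x] CperD(2)[OF Suc.prems(2), of x] by linarith
  moreover have "((\<lambda>x. F x + G x) has_real_derivative F' x + G' x) (at x)" for x
    using * by (intro DERIV_add) auto
  ultimately show ?case using Suc.IH[OF *(1,3)] Suc.prems by auto
qed

text \<open>The factor \<open>2 ^ m\<close> counts the terms of the Leibniz rule: each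
  differentiation splits a product in two.\<close>

lemma Cper_mult: "Cper m M F \<Longrightarrow> Cper m L G \<Longrightarrow> Cper m (2 ^ m * M * L) (\<lambda>x. F x * G x)"
proof (induction m arbitrary: F G)
  case 0
  then have "0 \<le> M" "0 \<le> L" using Cper_nonneg by blast+
  then have "\<bar>F x * G x\<bar> \<le> M * L" for x using 0 by (auto simp: abs_mult intro!: mult_mono)
  with 0 show ?case by (auto intro: continuous_on_mult)
next
  case (Suc m)
  obtain F' G' where *: "Cper m M F'" "\<forall>x. (F has_real_derivative F' x) (at x)"
    "Cper m L G'" "\<forall>x. (G has_real_derivative G' x) (at x)" using Suc.prems by auto
  have M: "0 \<le> M" "0 \<le> L" using Suc.prems Cper_nonneg by blast+
  have "\<bar>F x * G x\<bar> \<le> M * L" for x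
    using Suc.prems M by (auto simp: abs_mult intro!: mult_mono)
  also have "M * L \<le> 2 ^ Suc m * M * L"
    using mult_right_mono[of 1 "2 ^ Suc m :: real" "M * L"] M one_le_power[of "2::real" "Suc m"]
    by (simp add: mult_ac del: power_Suc)
  finally have bd: "\<bar>F x * G x\<bar> \<le> 2 ^ Suc m * M * L" for x .
  have "((\<lambda>x. F x * G x) has_real_derivative F' x * G x + F x * G' x) (at x)" for x
    using * by (auto intro!: derivative_eq_intros)
  moreover have "Cper m (2 ^ Suc m * M * L) (\<lambda>x. F' x * G x + F x * G' x)"
    using Cper_add[OF Suc.IH[OF *(1) Cper_SucD[OF Suc.prems(2)]] Suc.IH[OF Cper_SucD[OF Suc.prems(1)] *(3)]]
    by (simp add: mult_ac)
  ultimately show ?case using bd Suc.prems by auto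
qed

lemma Cper_const: "Cper m \<bar>c\<bar> (\<lambda>x. c)"
proof (induction m arbitrary: c)
  case (Suc m)
  have "Cper m \<bar>c\<bar> (\<lambda>x. 0)" using Cper_mono[OF Suc.IH[of 0]] by simp
  then show ?case by (auto intro!: exI[of _ "\<lambda>x. 0"])
qed auto

lemma Cper_scale: "Cper m M F \<Longrightarrow> Cper m (\<bar>r\<bar> * M) (\<lambda>x. r * F x)"
proof (induction m arbitrary: F)
  case 0 then show ?case by (auto simp: abs_mult intro!: mult_left_mono continuous_intros)
next
  case (Suc m)
  then obtain F' where *: "Cper m M F'" "\<forall>x. (F has_real_derivative F' x) (at x)" by auto
  have "((\<lambda>x. r * F x) has_real_derivative r * F' x) (at x)" for x
    using * by (auto intro!: derivative_eq_intros)
  with Suc.IH[OF *(1)] Suc.prems show ?case by (auto simp: abs_mult intro!: mult_left_mono)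
qed

lemma Cper_diff: "Cper m M F \<Longrightarrow> Cper m L G \<Longrightarrow> Cper m (M + L) (\<lambda>x. F x - G x)"
  using Cper_add[of m M F L "\<lambda>x. (-1) * G x"] Cper_scale[of m L G "-1"] by simp

lemma periodic_shift_int:
  fixes F :: "real \<Rightarrow> real"
  assumes per: "\<And>x. F (x + 1) = F x"
  shows "F (x + of_int k) = F x"
proof (induction k rule: int_induct[of _ 0])
  case (step1 i)
  then show ?case using per[of "x + of_int i"] by (simp add: add.assoc)
next
  case (step2 i)
  then show ?case using per[of "x + of_int (i - 1)"] by (simp add: add.assoc)
qed simp

text \<open>Zero mean over a period is what makes an antiderivative of a periodic function periodic.
  Every point has a translate in \<open>[a, a + 1)\<close>, where the value differs from
  \<open>F a = c\<close> by at most \<open>M\<close>; hence the bound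
  \<open>\<bar>c\<bar> + M\<close>.\<close>

lemma Cper_antiderivative:
  assumes G: "Cper m M G" and int0: "integral {0..1} G = 0"
  obtains F where "\<And>x. (F has_real_derivative G x) (at x)" "F a = c" "Cper (Suc m) (\<bar>c\<bar> + M) F"
proof -
  have cG: "isCont G x" for x
    using CperD(3)[OF G, of UNIV] by (simp add: continuous_on_eq_continuous_at)
  obtain F0 where F0: "\<And>x. (F0 has_real_derivative G x) (at x)"
    using einterval_antiderivative[of "-\<infinity>" "\<infinity>" G] cG
    by (auto simp: has_real_derivative_iff_has_vector_derivative)
  define F where "F x = F0 x - F0 a + c" for x
  have F: "(F has_real_derivative G x) (at x)" for x
    unfolding F_def[abs_def] using F0[of x] by (auto intro!: derivative_eq_intros)
  have "(G has_integral (F 1 - F 0)) {0..1}"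
    by (rule fundamental_theorem_of_calculus)
      (auto simp: has_real_derivative_iff_has_vector_derivative[symmetric] intro: has_field_derivative_at_within F)
  with int0 have F01: "F 1 = F 0" by (auto dest: integral_unique)
  have per: "F (x + 1) = F x" for x
  proof -
    have "((\<lambda>x. F (x + 1) - F x) has_real_derivative 0) (at x)" for x
    proof -
      have "((\<lambda>x. F (x + 1)) has_real_derivative G (x + 1)) (at x)"
        using F[of "x + 1"] by (simp add: DERIV_shift)
      from DERIV_diff[OF this F[of x]] show ?thesis using CperD(1)[OF G] by simp
    qed
    then have "F (x + 1) - F x = F (0 + 1) - F 0"
      by (intro DERIV_isconst_all) auto
    then show ?thesis using F01 by simp
  qed
  have bd: "\<bar>F x\<bar> \<le> \<bar>c\<bar> + M" for x
  proof -
    define k where "k = \<lfloor>x - a\<rfloor>"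
    have "F x = F (x - of_int k)" using periodic_shift_int[of F "x - of_int k" k] per by simp
    moreover have "\<bar>F (x - of_int k) - F a\<bar> \<le> M * \<bar>x - of_int k - a\<bar>"
    proof -
      have "norm (F (x - of_int k) - F a) \<le> M * norm (x - of_int k - a)"
        by (rule field_differentiable_bound[of UNIV F G])
          (use F CperD(2)[OF G] in auto)
      then show ?thesis by simp
    qed
    moreover have "M * \<bar>x - of_int k - a\<bar> \<le> M * 1"
      unfolding k_def by (rule mult_left_mono) (use Cper_nonneg[OF G] in linarith)+
    ultimately show ?thesis unfolding F_def by auto
  qed
  have G': "Cper m (\<bar>c\<bar> + M) G" using Cper_mono[OF G] by simp
  show thesis
    by (rule that[of F]) (use F per bd G' F_def in auto)
qed

section \<open>Smooth bumps and a periodic retraction onto the interval\<close>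

lemma Cper_cos: "\<exists>M. Cper m M (\<lambda>x. p * cos (2 * pi * (x - y)) + q * sin (2 * pi * (x - y)))"
proof (induction m arbitrary: p q)
  case 0
  have "\<bar>p * cos t + q * sin t\<bar> \<le> \<bar>p\<bar> + \<bar>q\<bar>" for t
  proof -
    have "\<bar>p * cos t + q * sin t\<bar> \<le> \<bar>p * cos t\<bar> + \<bar>q * sin t\<bar>" by (rule abs_triangle_ineq)
    also have "\<dots> \<le> \<bar>p\<bar> + \<bar>q\<bar>"
      by (intro add_mono) (auto simp: abs_mult intro!: mult_left_le)
    finally show ?thesis .
  qed
  moreover have "2 * pi * (x + 1 - y) = 2 * pi * (x - y) + 2 * pi" for x by (simp add: algebra_simps)
  ultimately show ?case by (auto intro!: exI[of _ "\<bar>p\<bar> + \<bar>q\<bar>"] continuous_intros)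
next
  case (Suc m)
  \<comment> \<open>The derivative stays in the family, with coefficients \<open>2 * pi * q\<close>
    and \<open>- 2 * pi * p\<close>; this is why the statement carries both a cosine and a
    sine.\<close>
  obtain M where M: "Cper m M (\<lambda>x. (2*pi*q) * cos (2 * pi * (x - y)) + (-2*pi*p) * sin (2 * pi * (x - y)))"
    using Suc.IH by blast
  obtain L where L: "Cper m L (\<lambda>x. p * cos (2 * pi * (x - y)) + q * sin (2 * pi * (x - y)))"
    using Suc.IH by blast
  have "((\<lambda>x. p * cos (2 * pi * (x - y)) + q * sin (2 * pi * (x - y))) has_real_derivative
     (2*pi*q) * cos (2 * pi * (x - y)) + (-2*pi*p) * sin (2 * pi * (x - y))) (at x)" for x
    by (auto intro!: derivative_eq_intros simp: algebra_simps)
  moreover have "Cper m (max M L) (\<lambda>x. (2*pi*q) * cos (2 * pi * (x - y)) + (-2*pi*p) * sin (2 * pi * (x - y)))"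
    by (rule Cper_mono[OF M]) simp
  ultimately show ?case using CperD(1,2)[OF Cper_mono[OF L, of "max M L"]]
    by (intro exI[of _ "max M L"]) (auto simp del: One_nat_def)
qed

text \<open>An exponent of at least two smooths the kink of \<open>max 0 x\<close>: away from 0 the
  function is locally 0 or a power, and at 0 the difference quotient is at most
  \<open>\<bar>h\<bar> ^ Suc m\<close>.\<close>

lemma pos_part_power_deriv:
  fixes x :: real
  shows "((\<lambda>x. max 0 x ^ Suc (Suc m)) has_real_derivative real (Suc (Suc m)) * max 0 x ^ Suc m) (at x)"
proof -
  consider "x < 0" | "x > 0" | "x = 0" by linarith
  then show ?thesis
  proof cases
    case 1
    have "((\<lambda>x. 0) has_real_derivative real (Suc (Suc m)) * max 0 x ^ Suc m) (at x)" using 1 by (auto simp: max_def)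
    then show ?thesis
      by (rule has_field_derivative_transform_within_open[of _ _ _ "{..<0}"]) (use 1 in \<open>auto simp: max_def\<close>)
  next
    case 2
    have "((\<lambda>x. x ^ Suc (Suc m)) has_real_derivative real (Suc (Suc m)) * max 0 x ^ Suc m) (at x)"
      using DERIV_pow[of "Suc (Suc m)" x] 2 by (simp add: max_def del: power_Suc)
    then show ?thesis
      by (rule has_field_derivative_transform_within_open[of _ _ _ "{0<..}"]) (use 2 in \<open>auto simp: max_def\<close>)
  next
    case 3
    have "((\<lambda>h. max 0 h ^ Suc (Suc m) / h) \<longlongrightarrow> 0) (at (0::real))"
    proof (rule Lim_null_comparison)
      show "\<forall>\<^sub>F h in at 0. norm (max 0 h ^ Suc (Suc m) / h) \<le> \<bar>h\<bar> ^ Suc m"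
      proof (intro always_eventually allI)
        fix h :: real
        show "norm (max 0 h ^ Suc (Suc m) / h) \<le> \<bar>h\<bar> ^ Suc m"
        proof (cases "h > 0")
          case False
          then have "max 0 h ^ Suc (Suc m) / h = 0" by simp
          then show ?thesis by (simp only: norm_zero) simp
        qed (simp add: max_def)
      qed
      show "((\<lambda>h. \<bar>h\<bar> ^ Suc m) \<longlongrightarrow> 0) (at (0::real))"
        by (auto intro!: tendsto_eq_intros)
    qed
    then show ?thesis using 3 by (simp add: DERIV_def)
  qed
qed

text \<open>The derivative is a lower power times \<open>P'\<close>, so each additional power buys
  one derivative. The hypothesis covers all orders because \<open>P'\<close> is needed in a new
  class at every step of the induction.\<close>

lemma Cper_pos_part_power:
  assumes "\<And>m. \<exists>M. Cper m M P"
  shows "\<exists>M. Cper m M (\<lambda>x. max 0 (P x) ^ Suc m)"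
proof (induction m)
  case 0
  obtain M where M: "Cper 0 M P" using assms by blast
  have "\<bar>max 0 (P x)\<bar> \<le> M" for x using CperD(2)[OF M, of x] by linarith
  then show ?case using M by (auto intro!: exI[of _ M] continuous_intros)
next
  case (Suc m)
  obtain M where M: "Cper m M (\<lambda>x. max 0 (P x) ^ Suc m)" using Suc.IH by blast
  obtain L where L: "Cper (Suc m) L P" using assms by blast
  then obtain P' where P': "Cper m L P'" "\<And>x. (P has_real_derivative P' x) (at x)" by auto
  define K where "K = real (Suc (Suc m)) * (2 ^ m * M * L)"
  have K: "Cper m K (\<lambda>x. real (Suc (Suc m)) * (max 0 (P x) ^ Suc m * P' x))"
    using Cper_scale[OF Cper_mult[OF M P'(1)], of "real (Suc (Suc m))"] unfolding K_def by simp
  have d: "((\<lambda>x. max 0 (P x) ^ Suc (Suc m)) has_real_derivative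
      real (Suc (Suc m)) * (max 0 (P x) ^ Suc m * P' x)) (at x)" for x
    using DERIV_chain2[OF pos_part_power_deriv P'(2)[of x], of m] by (simp add: mult_ac)
  have bd: "\<bar>max 0 (P x) ^ Suc (Suc m)\<bar> \<le> L ^ Suc (Suc m)" for x
  proof -
    have "max 0 (P x) ^ Suc (Suc m) \<le> L ^ Suc (Suc m)"
      using CperD(2)[OF L, of x] by (intro power_mono) auto
    then show ?thesis by (simp add: abs_mult power_abs)
  qed
  have "Cper m (max K (L ^ Suc (Suc m))) (\<lambda>x. real (Suc (Suc m)) * (max 0 (P x) ^ Suc m * P' x))"
    by (rule Cper_mono[OF K]) simp
  then show ?case unfolding Cper.simps(2)
    using bd d CperD(1)[OF L] by (intro exI[of _ "max K (L ^ Suc (Suc m))"]) (auto simp del: power_Suc intro: max.coboundedI2)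
qed

lemma cos_le_cos_abs:
  assumes "\<bar>x\<bar> \<le> y" "y \<le> pi" shows "cos y \<le> cos x"
proof -
  have "cos y \<le> cos \<bar>x\<bar>" by (rule cos_monotone_0_pi_le) (use assms in auto)
  then show ?thesis by simp
qed

text \<open>A bump of class \<open>C\<^sup>m\<close> with unit mean that vanishes on \<open>{a..b}\<close>: the positive part of
  \<open>cos r - cos (2 \<pi> (x - (a + b) / 2))\<close>, \<open>r = \<pi> (b - a)\<close>, raised to the power \<open>m + 1\<close>.\<close>

lemma Cper_bump:
  assumes "0 < a" "a < b" "b < 1"
  obtains B \<beta> where "Cper m B \<beta>" "integral {0..1} \<beta> = 1" "\<And>x. x \<in> {a..b} \<Longrightarrow> \<beta> x = 0"
proof -
  define P where "P x = cos (pi * (b - a)) - cos (2 * pi * (x - (a + b) / 2))" for x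
  have "\<exists>M. Cper m M P" for m
  proof -
    obtain M where "Cper m M (\<lambda>x. (-1) * cos (2 * pi * (x - (a+b)/2)) + 0 * sin (2 * pi * (x - (a+b)/2)))"
      using Cper_cos by blast
    from Cper_add[OF Cper_const[of m "cos (pi * (b - a))"] this] show ?thesis unfolding P_def by auto
  qed
  from Cper_pos_part_power[OF this, of m] obtain M where M: "Cper m M (\<lambda>x. max 0 (P x) ^ Suc m)" by blast
  define I where "I = integral {0..1} (\<lambda>x. max 0 (P x) ^ Suc m)"
  have zero: "max 0 (P x) = 0" if "x \<in> {a..b}" for x
  proof -
    have *: "\<bar>x - (a + b) / 2\<bar> \<le> (b - a) / 2" using that by (auto simp: abs_le_iff field_simps)
    have "\<bar>2 * pi * (x - (a + b) / 2)\<bar> = (2 * pi) * \<bar>x - (a + b) / 2\<bar>" by (simp add: abs_mult)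
    also have "\<dots> \<le> (2 * pi) * ((b - a) / 2)" using * by (intro mult_left_mono) auto
    finally have "\<bar>2 * pi * (x - (a + b) / 2)\<bar> \<le> pi * (b - a)" by simp
    moreover have "pi * (b - a) \<le> pi" using assms by simp
    ultimately show ?thesis using cos_le_cos_abs unfolding P_def by fastforce
  qed
  \<comment> \<open>The integrand is nonnegative and continuous, so a vanishing integral would force
    \<open>P 0 \<le> 0\<close>; but
    \<open>P 0 = 2 * sin (pi * a) * sin (pi * b) > 0\<close>.\<close>
  have "I > 0"
  proof -
    have cont: "continuous_on {0..1} (\<lambda>x. max 0 (P x) ^ Suc m)" by (rule CperD(3)[OF M])
    have nn: "I \<ge> 0" unfolding I_def
      by (rule integral_nonneg) (use cont in \<open>auto intro: integrable_continuous_real\<close>)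
    have "I \<noteq> 0"
    proof
      assume "I = 0"
      have "((\<lambda>x. max 0 (P x) ^ Suc m) has_integral I) {0..1}"
        unfolding I_def using cont by (intro integrable_integral integrable_continuous_real)
      then have "max 0 (P 0) ^ Suc m = 0"
        using has_integral_0_cbox_imp_0[of 0 1 "\<lambda>x. max 0 (P x) ^ Suc m" 0] cont \<open>I = 0\<close> by auto
      then have "P 0 \<le> 0" by (cases "P 0 > 0") (auto simp: max_def)
      then have le: "cos (pi * (b - a)) \<le> cos (pi * (a + b))"
      proof -
        have "2 * pi * (0 - (a + b) / 2) = - (pi * (a + b))" by (simp add: field_simps)
        then show ?thesis using \<open>P 0 \<le> 0\<close> unfolding P_def by (metis cos_minus diff_le_0_iff_le)
      qed
      have "cos (pi * (a + b)) < cos (pi * (b - a))"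
      proof -
        have "cos (pi * (b - a)) - cos (pi * (a + b)) = 2 * sin (pi * a) * sin (pi * b)"
          by (simp add: algebra_simps cos_add cos_diff)
        moreover have "sin (pi * a) > 0" "sin (pi * b) > 0"
          using assms by (auto intro!: sin_gt_zero)
        ultimately show ?thesis by (simp add: algebra_simps)
      qed
      with le show False by simp
    qed
    with nn show ?thesis by simp
  qed
  show thesis
  proof (rule that)
    show "Cper m (\<bar>1/I\<bar> * M) (\<lambda>x. (1/I) * max 0 (P x) ^ Suc m)" by (rule Cper_scale[OF M])
    show "integral {0..1} (\<lambda>x. (1/I) * max 0 (P x) ^ Suc m) = 1"
      using \<open>I > 0\<close> by (simp only: integral_mult_right I_def[symmetric]) simp
    show "(1/I) * max 0 (P x) ^ Suc m = 0" if "x \<in> {a..b}" for x using zero[OF that] by simp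
  qed
qed

text \<open>With \<open>t = x - (a + b) / 2\<close>, the quotient below is \<open>tan (\<pi> t)\<close> on \<open>{a..b}\<close>.\<close>

lemma periodic_retraction:
  assumes "0 < a" "a < b" "b < 1"
  obtains \<tau> :: "real \<Rightarrow> real" where "continuous_on UNIV \<tau>" "\<And>x. \<tau> (x + 1) = \<tau> x"
    "\<And>x. \<tau> x \<in> {a..b}" "\<And>x. x \<in> {a..b} \<Longrightarrow> \<tau> x = x"
proof -
  define r where "r = (b - a) / 2"
  \<comment> \<open>The value of \<open>1 + cos (2 * pi * t)\<close> at \<open>t = r\<close>. As a
    floor for the denominator in the half-angle formula for \<open>tan (pi * t)\<close> it is
    inactive for \<open>\<bar>t\<bar> \<le> r\<close> and prevents a division by 0 at
    \<open>t = 1/2\<close>.\<close>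
  define \<delta> where "\<delta> = 1 + cos (2 * pi * r)"
  define w where "w t = arctan (sin (2 * pi * t) / max (1 + cos (2 * pi * t)) \<delta>) / pi" for t
  define \<tau> where "\<tau> x = (a + b) / 2 + max (- r) (min r (w (x - (a + b) / 2)))" for x
  have r: "0 < r" "r < 1/2" using assms by (auto simp: r_def)
  have "cos pi < cos (2 * pi * r)" by (rule cos_monotone_0_pi) (use r in auto)
  then have \<delta>: "\<delta> > 0" by (simp add: \<delta>_def)
  have w_eq: "w t = t" if "\<bar>t\<bar> \<le> r" for t
  proof -
    have "\<bar>2 * pi * t\<bar> \<le> 2 * pi * r" using that by (simp add: abs_mult)
    then have "cos (2 * pi * r) \<le> cos (2 * pi * t)"
      by (rule cos_le_cos_abs) (use r in simp)
    then have "max (1 + cos (2 * pi * t)) \<delta> = 1 + cos (2 * pi * t)" by (simp add: \<delta>_def)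
    moreover have "1 + cos (2 * pi * t) = 2 * cos (pi * t) ^ 2"
      using cos_double_cos[of "pi * t"] by (simp add: mult_ac)
    moreover have "sin (2 * pi * t) = 2 * sin (pi * t) * cos (pi * t)"
      using sin_double[of "pi * t"] by (simp add: mult_ac)
    ultimately have "w t = arctan (tan (pi * t)) / pi"
      unfolding w_def by (simp add: tan_def power2_eq_square)
    also have "arctan (tan (pi * t)) = pi * t"
    proof (rule arctan_tan)
      have "\<bar>pi * t\<bar> < pi / 2"
        using that r mult_strict_left_mono[of "\<bar>t\<bar>" "1/2" pi] by (simp add: abs_mult)
      then show "- (pi / 2) < pi * t" "pi * t < pi / 2" unfolding abs_less_iff by linarith+
    qed
    finally show ?thesis by simp
  qed
  show thesis
  proof (rule that[of \<tau>])
    have "max (1 + cos (2 * pi * (x - (a + b) / 2))) \<delta> \<noteq> 0" for x using \<delta> by auto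
    then show "continuous_on UNIV \<tau>"
      unfolding \<tau>_def w_def by (intro continuous_intros) auto
    fix x
    have "2 * pi * (x + 1 - (a + b) / 2) = 2 * pi * (x - (a + b) / 2) + 2 * pi" by (simp add: algebra_simps)
    then have "w (x + 1 - (a + b) / 2) = w (x - (a + b) / 2)" unfolding w_def by simp
    then show "\<tau> (x + 1) = \<tau> x" by (simp add: \<tau>_def)
    have "\<bar>max (- r) (min r (w (x - (a + b) / 2)))\<bar> \<le> r" using r by auto
    then show "\<tau> x \<in> {a..b}" unfolding \<tau>_def r_def by (auto simp: abs_le_iff field_simps)
    assume "x \<in> {a..b}"
    then have *: "\<bar>x - (a + b) / 2\<bar> \<le> r" by (auto simp: r_def abs_le_iff field_simps)
    then have "max (- r) (min r (x - (a + b) / 2)) = x - (a + b) / 2" by (auto simp: abs_le_iff)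
    then show "\<tau> x = x" by (simp add: \<tau>_def w_eq[OF *])
  qed
qed

text \<open>Extend the derivative first and integrate; a multiple of a bump supported off \<open>{a..b}\<close> restores
  the zero mean that periodicity of the antiderivative requires.\<close>

lemma Cper_extension:
  fixes a b :: real
  assumes ab: "0 < a" "a < b" "b < 1"
  shows "\<exists>C\<ge>0. \<forall>D M. (\<forall>j<m. \<forall>x\<in>{a..b}. (D j has_real_derivative D (Suc j) x) (at x within {a..b})) \<longrightarrow>
     continuous_on {a..b} (D m) \<longrightarrow> (\<forall>j\<le>m. \<forall>x\<in>{a..b}. \<bar>D j x\<bar> \<le> M) \<longrightarrow>
     (\<exists>F. Cper m (C * M) F \<and> (\<forall>x\<in>{a..b}. F x = D 0 x))"
proof (induction m)
  case 0
  obtain \<tau> :: "real \<Rightarrow> real" where \<tau>: "continuous_on UNIV \<tau>" "\<And>x. \<tau> (x + 1) = \<tau> x"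
    "\<And>x. \<tau> x \<in> {a..b}" "\<And>x. x \<in> {a..b} \<Longrightarrow> \<tau> x = x" using periodic_retraction[OF ab] by blast
  show ?case
  proof (intro exI[of _ 1] conjI allI impI)
    fix D :: "nat \<Rightarrow> real \<Rightarrow> real" and M
    assume D: "continuous_on {a..b} (D 0)" and M: "\<forall>j\<le>0. \<forall>x\<in>{a..b}. \<bar>D j x\<bar> \<le> M"
    have "continuous_on UNIV (\<lambda>x. D 0 (\<tau> x))"
      by (rule continuous_on_compose2[OF D \<tau>(1)]) (use \<tau>(3) in auto)
    then show "\<exists>F. Cper 0 (1 * M) F \<and> (\<forall>x\<in>{a..b}. F x = D 0 x)"
      using \<tau> M by (intro exI[of _ "\<lambda>x. D 0 (\<tau> x)"]) auto
  qed simp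
next
  case (Suc m)
  then obtain C where C: "C \<ge> 0" and ext: "\<And>D M. (\<forall>j<m. \<forall>x\<in>{a..b}. (D j has_real_derivative D (Suc j) x) (at x within {a..b})) \<Longrightarrow>
     continuous_on {a..b} (D m) \<Longrightarrow> (\<forall>j\<le>m. \<forall>x\<in>{a..b}. \<bar>D j x\<bar> \<le> M) \<Longrightarrow>
     (\<exists>F. Cper m (C * M) F \<and> (\<forall>x\<in>{a..b}. F x = D 0 x))" by auto
  obtain B \<beta> where \<beta>: "Cper m B \<beta>" "integral {0..1} \<beta> = 1" "\<And>x. x \<in> {a..b} \<Longrightarrow> \<beta> x = 0"
    using Cper_bump[OF ab] by blast
  have B: "B \<ge> 0" by (rule Cper_nonneg[OF \<beta>(1)])
  show ?case
  \<comment> \<open>1 pays for the value at \<open>a\<close>, \<open>C\<close> for the extension of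
    the derivative, and \<open>C * B\<close> for the bump that corrects the mean \<open>I\<close>,
    since \<open>\<bar>I\<bar> \<le> C * M\<close>.\<close>
  proof (intro exI[of _ "1 + (C + C * B)"] conjI allI impI)
    fix D :: "nat \<Rightarrow> real \<Rightarrow> real" and M
    assume D: "\<forall>j<Suc m. \<forall>x\<in>{a..b}. (D j has_real_derivative D (Suc j) x) (at x within {a..b})"
      and cD: "continuous_on {a..b} (D (Suc m))" and M: "\<forall>j\<le>Suc m. \<forall>x\<in>{a..b}. \<bar>D j x\<bar> \<le> M"
    obtain G where G: "Cper m (C * M) G" "\<forall>x\<in>{a..b}. G x = D 1 x"
      using ext[of "\<lambda>j. D (Suc j)" M] D cD M by auto
    define I where "I = integral {0..1} G"
    have "a \<in> {a..b}" using ab by simp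
    then have Ma: "\<bar>D 0 a\<bar> \<le> M" using M by blast
    have iG: "G integrable_on {0..1}" "\<beta> integrable_on {0..1}"
      using CperD(3)[OF G(1)] CperD(3)[OF \<beta>(1)] by (auto intro: integrable_continuous_real)
    have "norm (integral {0..1} G) \<le> C * M * (1 - 0)"
      by (rule integral_bound) (use CperD[OF G(1)] in auto)
    then have I: "\<bar>I\<bar> \<le> C * M" by (simp add: I_def)
    define G1 where "G1 x = G x - I * \<beta> x" for x
    have "\<bar>I\<bar> * B \<le> C * M * B" using I B by (rule mult_right_mono)
    then have G1: "Cper m ((C + C * B) * M) G1"
      unfolding G1_def
      by (intro Cper_mono[OF Cper_diff[OF G(1) Cper_scale[OF \<beta>(1)]]]) (simp add: algebra_simps)
    have "integral {0..1} G1 = 0"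
      unfolding G1_def using iG \<beta>(2) I_def by (subst integral_diff) (auto intro: integrable_on_mult_right)
    then obtain F where F: "\<And>x. (F has_real_derivative G1 x) (at x)" "F a = D 0 a"
      "Cper (Suc m) (\<bar>D 0 a\<bar> + (C + C * B) * M) F"
      using Cper_antiderivative[OF G1] by metis
    have "F x = D 0 x" if "x \<in> {a..b}" for x
    proof -
      have "((\<lambda>x. F x - D 0 x) has_real_derivative 0) (at y within {a..b})" if y: "y \<in> {a..b}" for y
      proof -
        have "(D 0 has_real_derivative D 1 y) (at y within {a..b})" using D y by auto
        from DERIV_diff[OF has_field_derivative_at_within[OF F(1)[of y], of "{a..b}"] this]
        show ?thesis using G(2) \<beta>(3) y by (simp add: G1_def)
      qed
      then have "F x - D 0 x = F a - D 0 a"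
        using has_field_derivative_zero_constant[of "{a..b}" "\<lambda>x. F x - D 0 x"] that \<open>a \<in> {a..b}\<close>
        by (metis convex_real_interval(5))
      then show ?thesis using F(2) by simp
    qed
    moreover have "Cper (Suc m) ((1 + (C + C * B)) * M) F"
      by (rule Cper_mono[OF F(3)]) (use Ma in \<open>simp add: algebra_simps\<close>)
    ultimately show "\<exists>F. Cper (Suc m) ((1 + (C + C * B)) * M) F \<and> (\<forall>x\<in>{a..b}. F x = D 0 x)" by blast
  qed (use C B in auto)
qed

section \<open>Fejer-Korovkin approximation\<close>

lemma trigpoly_add: "trigpoly N f \<Longrightarrow> trigpoly N g \<Longrightarrow> trigpoly N (\<lambda>x. f x + g x)"
proof -
  assume "trigpoly N f" "trigpoly N g"
  then obtain c d c' d' where "f = trigsum N c d" "g = trigsum N c' d'" by (auto simp: trigpoly_def)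
  then have "(\<lambda>x. f x + g x) = trigsum N (\<lambda>k. c k + c' k) (\<lambda>k. d k + d' k)"
    by (auto simp: trigsum_def fun_eq_iff sum.distrib[symmetric] algebra_simps)
  then show ?thesis by (auto simp: trigpoly_def)
qed

lemma trigpoly_scale: "trigpoly N f \<Longrightarrow> trigpoly N (\<lambda>x. r * f x)"
proof -
  assume "trigpoly N f"
  then obtain c d where "f = trigsum N c d" by (auto simp: trigpoly_def)
  then have "(\<lambda>x. r * f x) = trigsum N (\<lambda>k. r * c k) (\<lambda>k. r * d k)"
    by (auto simp: trigsum_def fun_eq_iff sum_distrib_left algebra_simps)
  then show ?thesis by (auto simp: trigpoly_def)
qed

lemma trigpoly_zero: "trigpoly N (\<lambda>x. 0)"
proof -
  have "(\<lambda>x. 0) = trigsum N (\<lambda>k. 0) (\<lambda>k. 0)" by (simp add: trigsum_def fun_eq_iff)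
  then show ?thesis unfolding trigpoly_def by blast
qed

lemma trigpoly_sum: "(\<And>i. i \<in> I \<Longrightarrow> trigpoly N (f i)) \<Longrightarrow> trigpoly N (\<lambda>x. \<Sum>i\<in>I. f i x)"
  by (induction I rule: infinite_finite_induct) (auto intro: trigpoly_add trigpoly_zero)

lemma trigpoly_cos_sin:
  assumes "k \<le> N"
  shows "trigpoly N (\<lambda>x. p * cos (2 * pi * real k * x) + q * sin (2 * pi * real k * x))"
proof -
  have "(\<lambda>x. p * cos (2 * pi * real k * x) + q * sin (2 * pi * real k * x)) =
    trigsum N (\<lambda>j. if j = k then p else 0) (\<lambda>j. if j = k then q else 0)"
  proof
    fix x
    have "trigsum N (\<lambda>j. if j = k then p else 0) (\<lambda>j. if j = k then q else 0) x
      = (\<Sum>j\<le>N. if j = k then p * cos (2 * pi * real k * x) + q * sin (2 * pi * real k * x) else 0)"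
      unfolding trigsum_def by (intro sum.cong) auto
    then show "p * cos (2 * pi * real k * x) + q * sin (2 * pi * real k * x) =
      trigsum N (\<lambda>j. if j = k then p else 0) (\<lambda>j. if j = k then q else 0) x" using assms by simp
  qed
  then show ?thesis unfolding trigpoly_def by blast
qed

lemma trigpoly_cos_sin_int:
  assumes "\<bar>k\<bar> \<le> int N"
  shows "trigpoly N (\<lambda>x. p * cos (2 * pi * of_int k * x) + q * sin (2 * pi * of_int k * x))"
proof (cases "k \<ge> 0")
  case True
  then show ?thesis using trigpoly_cos_sin[of "nat k" N p q] assms by simp
next
  case False
  have "2 * pi * real_of_int k * x = - (2 * pi * real (nat (- k)) * x)" for x using False by simp
  then show ?thesis using trigpoly_cos_sin[of "nat (- k)" N p "- q"] assms False
    by (simp only: cos_minus sin_minus) simp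
qed

section \<open>Convolution with cosines over one period\<close>

definition cosconv :: "(real \<Rightarrow> real) \<Rightarrow> int \<Rightarrow> real \<Rightarrow> real" where
  "cosconv G k x = integral {0..1} (\<lambda>y. G y * cos (2 * pi * of_int k * (x - y)))"

lemma cosconv_expand:
  assumes "continuous_on {0..1} G"
  shows "cosconv G k x = integral {0..1} (\<lambda>y. G y * cos (2 * pi * of_int k * y)) * cos (2 * pi * of_int k * x)
     + integral {0..1} (\<lambda>y. G y * sin (2 * pi * of_int k * y)) * sin (2 * pi * of_int k * x)"
proof -
  have i: "(\<lambda>y. G y * cos (2 * pi * of_int k * y)) integrable_on {0..1}"
     "(\<lambda>y. G y * sin (2 * pi * of_int k * y)) integrable_on {0..1}"
    using assms by (auto intro!: integrable_continuous_real continuous_intros)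
  have "cosconv G k x = integral {0..1} (\<lambda>y. G y * cos (2 * pi * of_int k * y) * cos (2 * pi * of_int k * x)
      + G y * sin (2 * pi * of_int k * y) * sin (2 * pi * of_int k * x))"
    unfolding cosconv_def by (simp add: right_diff_distrib cos_diff algebra_simps)
  then show ?thesis
    using i by (simp add: integral_add integrable_on_mult_left)
qed

lemma trigpoly_cosconv:
  "continuous_on {0..1} G \<Longrightarrow> \<bar>k\<bar> \<le> int N \<Longrightarrow> trigpoly N (cosconv G k)"
  using trigpoly_cos_sin_int[of k N] by (simp add: cosconv_expand fun_eq_iff[symmetric] ext[of "cosconv G k", OF cosconv_expand])

text \<open>\<open>A\<close> and \<open>B\<close> are Fourier coefficients of \<open>G\<close>.
  Integration by parts gives those of \<open>G'\<close> as \<open>w * B\<close> and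
  \<open>- w * A\<close>, which is how differentiation acts on
  \<open>A * cos (w * x) + B * sin (w * x)\<close>; periodicity kills the boundary terms.\<close>

lemma cosconv_deriv:
  assumes G': "continuous_on {0..1} G'" and d: "\<And>x. (G has_real_derivative G' x) (at x)"
    and per: "\<And>x. G (x + 1) = G x"
  shows "(cosconv G k has_real_derivative cosconv G' k x) (at x)"
proof -
  have cG: "continuous_on {0..1} G" using d by (auto intro: DERIV_continuous_on has_field_derivative_at_within)
  define w where "w = 2 * pi * real_of_int k"
  define A where "A = integral {0..1} (\<lambda>y. G y * cos (w * y))"
  define B where "B = integral {0..1} (\<lambda>y. G y * sin (w * y))"
  have ig: "(\<lambda>y. G y * cos (w * y)) integrable_on {0..1}" "(\<lambda>y. G y * sin (w * y)) integrable_on {0..1}"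
    "(\<lambda>y. G' y * cos (w * y)) integrable_on {0..1}" "(\<lambda>y. G' y * sin (w * y)) integrable_on {0..1}"
    using cG G' by (auto intro!: integrable_continuous_real continuous_intros)
  have w1: "cos w = 1" "sin w = 0"
    using cos_int_2pin[of k] sin_int_2pin[of k] by (simp_all add: w_def mult_ac)
  have G1: "G 1 = G 0" using per[of 0] by simp
  have "((\<lambda>y. G' y * cos (w * y) - w * (G y * sin (w * y))) has_integral (G 1 * cos (w * 1) - G 0 * cos (w * 0))) {0..1}"
    by (rule fundamental_theorem_of_calculus)
      (auto simp: has_real_derivative_iff_has_vector_derivative[symmetric] algebra_simps
        intro!: derivative_eq_intros has_field_derivative_at_within[OF d])
  then have "integral {0..1} (\<lambda>y. G' y * cos (w * y) - w * (G y * sin (w * y))) = 0"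
    using w1 G1 by (auto dest: integral_unique)
  then have e1: "integral {0..1} (\<lambda>y. G' y * cos (w * y)) = w * B"
    unfolding B_def using ig by (subst (asm) integral_diff) (auto intro: integrable_on_mult_right)
  have "((\<lambda>y. G' y * sin (w * y) + w * (G y * cos (w * y))) has_integral (G 1 * sin (w * 1) - G 0 * sin (w * 0))) {0..1}"
    by (rule fundamental_theorem_of_calculus)
      (auto simp: has_real_derivative_iff_has_vector_derivative[symmetric] algebra_simps
        intro!: derivative_eq_intros has_field_derivative_at_within[OF d])
  then have "integral {0..1} (\<lambda>y. G' y * sin (w * y) + w * (G y * cos (w * y))) = 0"
    using w1 G1 by (auto dest: integral_unique)
  then have e2: "integral {0..1} (\<lambda>y. G' y * sin (w * y)) = - w * A"
    unfolding A_def using ig by (subst (asm) integral_add) (auto intro: integrable_on_mult_right)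
  have "cosconv G k = (\<lambda>x. A * cos (w * x) + B * sin (w * x))"
    unfolding A_def B_def w_def using cosconv_expand[OF cG] by auto
  moreover have "cosconv G' k x = w * B * cos (w * x) + - w * A * sin (w * x)"
    unfolding e1[symmetric] e2[symmetric] unfolding w_def using cosconv_expand[OF G'] by auto
  ultimately show ?thesis by (auto intro!: derivative_eq_intros simp: algebra_simps)
qed

lemma integral_cos_period:
  "((\<lambda>y. cos (2 * pi * of_int k * (x - y))) has_integral (if k = 0 then 1 else 0)) {0..1}"
proof (cases "k = 0")
  case True then show ?thesis using has_integral_const_real[of "1::real" 0 1] by simp
next
  case False
  define w where "w = 2 * pi * real_of_int k"
  have w: "w \<noteq> 0" "cos w = 1" "sin w = 0"
    using cos_int_2pin[of k] sin_int_2pin[of k] False by (simp_all add: w_def mult_ac)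
  have "((\<lambda>y. cos (w * (x - y))) has_integral (- sin (w * (x - 1)) / w - (- sin (w * (x - 0)) / w))) {0..1}"
    by (rule fundamental_theorem_of_calculus)
      (use w in \<open>auto simp: has_real_derivative_iff_has_vector_derivative[symmetric]
        intro!: derivative_eq_intros\<close>)
  moreover have "sin (w * (x - 1)) = sin (w * x)" using w by (simp add: right_diff_distrib sin_diff)
  ultimately show ?thesis using False unfolding w_def by simp
qed

text \<open>The Fejer-Korovkin kernel of degree \<open>N\<close>: the squared modulus of
  \<open>\<Sum>\<^sub>j sin (j \<theta>) e\<^sup>2\<^sup>\<pi>\<^sup>i\<^sup>j\<^sup>t\<close>, normalized to unit mean.\<close>

definition fk_coeff :: "nat \<Rightarrow> nat \<Rightarrow> real" where
  "fk_coeff N j = sin (real j * (pi / real (N + 2)))"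

definition fk_mass :: "nat \<Rightarrow> real" where
  "fk_mass N = (\<Sum>j=1..N+1. (fk_coeff N j)\<^sup>2)"

definition fk_kernel :: "nat \<Rightarrow> real \<Rightarrow> real" where
  "fk_kernel N t = (\<Sum>j=1..N+1. \<Sum>l=1..N+1. fk_coeff N j * fk_coeff N l * cos (2 * pi * of_int (int j - int l) * t)) / fk_mass N"

definition fk_mean :: "nat \<Rightarrow> (real \<Rightarrow> real) \<Rightarrow> real \<Rightarrow> real" where
  "fk_mean N G x = (\<Sum>j=1..N+1. \<Sum>l=1..N+1. fk_coeff N j * fk_coeff N l * cosconv G (int j - int l) x) / fk_mass N"

lemma fk_mass_pos: "fk_mass N > 0"
proof -
  have "fk_coeff N 1 > 0" unfolding fk_coeff_def by (rule sin_gt_zero) (auto simp: field_simps add_pos_nonneg)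
  then have "(fk_coeff N 1)\<^sup>2 > 0" by simp
  also have "(fk_coeff N 1)\<^sup>2 \<le> fk_mass N" unfolding fk_mass_def by (rule member_le_sum) auto
  finally show ?thesis .
qed

text \<open>The addition formula separates \<open>j\<close> from \<open>l\<close>, and the double
  sum becomes a sum of two squares, those of a real and an imaginary part.\<close>

lemma fk_kernel_nonneg: "fk_kernel N t \<ge> 0"
proof -
  define c s where "c j = cos (2 * pi * real j * t)" and "s j = sin (2 * pi * real j * t)" for j :: nat
  have "cos (2 * pi * of_int (int j - int l) * t) = c j * c l + s j * s l" for j l
    unfolding c_def s_def cos_diff[symmetric] by (simp add: algebra_simps)
  then have "fk_kernel N t = (\<Sum>j=1..N+1. \<Sum>l=1..N+1. fk_coeff N j * c j * (fk_coeff N l * c l)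
      + fk_coeff N j * s j * (fk_coeff N l * s l)) / fk_mass N"
    unfolding fk_kernel_def by (simp add: algebra_simps del: sum.cl_ivl_Suc)
  also have "\<dots> = ((\<Sum>j=1..N+1. fk_coeff N j * c j)\<^sup>2 + (\<Sum>j=1..N+1. fk_coeff N j * s j)\<^sup>2) / fk_mass N"
    by (simp only: sum.distrib power2_eq_square sum_product)
  also have "\<dots> \<ge> 0" using fk_mass_pos[of N] by (intro divide_nonneg_pos) auto
  finally show ?thesis .
qed

text \<open>\<open>fk_mean\<close> is built from \<open>cosconv\<close> so that its degree and its
  derivatives can be read off; the estimates need this other form, an integral against the
  kernel.\<close>

lemma fk_mean_integral:
  assumes "continuous_on {0..1} G"
  shows "((\<lambda>y. G y * fk_kernel N (x - y)) has_integral fk_mean N G x) {0..1}"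
proof -
  have "((\<lambda>y. (\<Sum>j=1..N+1. \<Sum>l=1..N+1. fk_coeff N j * fk_coeff N l * (G y * cos (2 * pi * of_int (int j - int l) * (x - y)))) / fk_mass N)
    has_integral (\<Sum>j=1..N+1. \<Sum>l=1..N+1. fk_coeff N j * fk_coeff N l * cosconv G (int j - int l) x) / fk_mass N) {0..1}"
    unfolding cosconv_def using assms
    by (intro has_integral_divide has_integral_sum has_integral_mult_right integrable_integral
        integrable_continuous_real continuous_intros) auto
  moreover have "(\<Sum>j=1..N+1. \<Sum>l=1..N+1. fk_coeff N j * fk_coeff N l * (G y * cos (2 * pi * of_int (int j - int l) * (x - y)))) / fk_mass N
     = G y * fk_kernel N (x - y)" for y
    unfolding fk_kernel_def by (simp add: sum_distrib_left mult_ac del: sum.cl_ivl_Suc)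
  ultimately show ?thesis unfolding fk_mean_def by simp
qed

lemma fk_kernel_mean: "((\<lambda>y. fk_kernel N (x - y)) has_integral 1) {0..1}"
proof -
  have "((\<lambda>y. fk_kernel N (x - y)) has_integral
     (\<Sum>j=1..N+1. \<Sum>l=1..N+1. fk_coeff N j * fk_coeff N l * (if int j - int l = 0 then 1 else 0)) / fk_mass N) {0..1}"
    unfolding fk_kernel_def
    by (intro has_integral_divide has_integral_sum has_integral_mult_right integral_cos_period) auto
  moreover have "(\<Sum>j=1..N+1. \<Sum>l=1..N+1. fk_coeff N j * fk_coeff N l * (if int j - int l = 0 then 1 else 0)) = fk_mass N"
  proof -
    have "(\<Sum>l=1..N+1. fk_coeff N j * fk_coeff N l * (if int j - int l = 0 then 1 else 0)) = (fk_coeff N j)\<^sup>2"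
      if "j \<in> {1..N+1}" for j
    proof -
      have "(\<Sum>l=1..N+1. fk_coeff N j * fk_coeff N l * (if int j - int l = 0 then 1 else 0)) =
         (\<Sum>l=1..N+1. if l = j then (fk_coeff N j)\<^sup>2 else 0)"
        by (intro sum.cong) (auto simp: power2_eq_square)
      then show ?thesis using that by simp
    qed
    then show ?thesis unfolding fk_mass_def by (intro sum.cong) auto
  qed
  ultimately show ?thesis using fk_mass_pos[of N] by simp
qed

text \<open>The coefficients form the top eigenvector of the path with \<open>N + 1\<close>
  vertices. Among squared moduli of degree \<open>N\<close> this choice maximizes the first Fourier
  coefficient and so concentrates the kernel best at 0.\<close>

lemma fk_coeff_recurrence:
  "fk_coeff N (Suc (Suc j)) + fk_coeff N j = 2 * cos (pi / real (N + 2)) * fk_coeff N (Suc j)"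
proof -
  define \<theta> where "\<theta> = pi / real (N + 2)"
  have "real (Suc (Suc j)) * \<theta> = real (Suc j) * \<theta> + \<theta>" "real j * \<theta> = real (Suc j) * \<theta> - \<theta>"
    by (simp_all add: algebra_simps)
  then show ?thesis unfolding fk_coeff_def \<theta>_def[symmetric] by (simp add: sin_add sin_diff)
qed

text \<open>By \<open>(sin (pi * t))\<^sup>2 = (1 - cos (2 * pi * t)) / 2\<close> only the mean of
  \<open>cos (2 * pi * t)\<close> against the kernel is required. This cosine couples neighbouring
  coefficients, and the eigenvector relation evaluates the mean to
  \<open>cos \<theta>\<close>.\<close>

lemma fk_kernel_moment:
  "((\<lambda>y. (sin (pi * (x - y)))\<^sup>2 * fk_kernel N (x - y)) has_integral (1 - cos (pi / real (N + 2))) / 2) {0..1}"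
proof -
  define e :: "int \<Rightarrow> real" where "e m = (if m = 0 then 1 else 0)" for m
  define \<theta> where "\<theta> = pi / real (N + 2)"
  have split: "cos (2 * pi * of_int k * t) * cos (2 * pi * t) =
      (cos (2 * pi * of_int (k - 1) * t) + cos (2 * pi * of_int (k + 1) * t)) / 2" for k t
  proof -
    have "2 * pi * of_int (k - 1) * t = 2 * pi * of_int k * t - 2 * pi * t"
      "2 * pi * of_int (k + 1) * t = 2 * pi * of_int k * t + 2 * pi * t" by (simp_all add: algebra_simps)
    then show ?thesis by (simp only: cos_add cos_diff) simp
  qed
  have 1: "((\<lambda>y. (\<Sum>j=1..N+1. \<Sum>l=1..N+1. fk_coeff N j * fk_coeff N l *
       ((cos (2 * pi * of_int (int j - int l - 1) * (x - y)) + cos (2 * pi * of_int (int j - int l + 1) * (x - y))) / 2)) / fk_mass N) has_integral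
     (\<Sum>j=1..N+1. \<Sum>l=1..N+1. fk_coeff N j * fk_coeff N l * ((e (int j - int l - 1) + e (int j - int l + 1)) / 2)) / fk_mass N) {0..1}"
    unfolding e_def
    by (intro has_integral_divide has_integral_sum has_integral_mult_right has_integral_add integral_cos_period) auto
  have 2: "(\<Sum>j=1..N+1. \<Sum>l=1..N+1. fk_coeff N j * fk_coeff N l *
       ((cos (2 * pi * of_int (int j - int l - 1) * t) + cos (2 * pi * of_int (int j - int l + 1) * t)) / 2)) / fk_mass N
      = cos (2 * pi * t) * fk_kernel N t" for t
    unfolding fk_kernel_def split[symmetric] by (simp add: sum_distrib_left mult_ac del: sum.cl_ivl_Suc)
  have 3: "(\<Sum>l=1..N+1. fk_coeff N j * fk_coeff N l * ((e (int j - int l - 1) + e (int j - int l + 1)) / 2))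
      = cos \<theta> * (fk_coeff N j)\<^sup>2" if j: "j \<in> {1..N+1}" for j
  proof -
    \<comment> \<open>Both ends of the coefficient sequence vanish, so nothing is lost at
      \<open>j = 1\<close> and \<open>j = N + 1\<close>, where one neighbour falls outside the range
      of summation.\<close>
    have z: "fk_coeff N 0 = 0" "fk_coeff N (N + 2) = 0"
    proof -
      have "real (N + 2) * (pi / real (N + 2)) = pi" by simp
      then show "fk_coeff N 0 = 0" "fk_coeff N (N + 2) = 0" unfolding fk_coeff_def by simp_all
    qed
    obtain i where i: "j = Suc i" using j by (cases j) auto
    have "(\<Sum>l=1..N+1. fk_coeff N l * e (int j - int l - 1)) = (\<Sum>l=1..N+1. if l = i then fk_coeff N i else 0)"
      unfolding e_def by (intro sum.cong) (auto simp: i)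
    also have "\<dots> = fk_coeff N i" using j z i by (cases i) auto
    finally have 1: "(\<Sum>l=1..N+1. fk_coeff N l * e (int j - int l - 1)) = fk_coeff N i" .
    have "(\<Sum>l=1..N+1. fk_coeff N l * e (int j - int l + 1)) = (\<Sum>l=1..N+1. if l = Suc j then fk_coeff N (Suc j) else 0)"
      unfolding e_def by (intro sum.cong) auto
    also have "\<dots> = fk_coeff N (Suc j)"
    proof (cases "j = N + 1")
      case True then show ?thesis using z by simp
    qed (use j in auto)
    finally have 2: "(\<Sum>l=1..N+1. fk_coeff N l * e (int j - int l + 1)) = fk_coeff N (Suc j)" .
    have "(\<Sum>l=1..N+1. fk_coeff N j * fk_coeff N l * ((e (int j - int l - 1) + e (int j - int l + 1)) / 2))
      = fk_coeff N j / 2 * ((\<Sum>l=1..N+1. fk_coeff N l * e (int j - int l - 1)) + (\<Sum>l=1..N+1. fk_coeff N l * e (int j - int l + 1)))"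
      unfolding sum_distrib_left sum.distrib[symmetric] by (intro sum.cong) (auto simp: field_simps)
    also have "\<dots> = fk_coeff N j / 2 * (2 * cos \<theta> * fk_coeff N j)"
      unfolding 1 2 using fk_coeff_recurrence[of N i] i \<theta>_def by (simp add: add.commute)
    finally show ?thesis by (simp add: power2_eq_square)
  qed
  have 4: "(\<Sum>j=1..N+1. \<Sum>l=1..N+1. fk_coeff N j * fk_coeff N l * ((e (int j - int l - 1) + e (int j - int l + 1)) / 2))
      = (\<Sum>j=1..N+1. cos \<theta> * (fk_coeff N j)\<^sup>2)" by (rule sum.cong[OF refl 3])
  from 1 have "((\<lambda>y. cos (2 * pi * (x - y)) * fk_kernel N (x - y)) has_integral
     (\<Sum>j=1..N+1. cos \<theta> * (fk_coeff N j)\<^sup>2) / fk_mass N) {0..1}"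
    unfolding 2 4 .
  moreover have "(\<Sum>j=1..N+1. cos \<theta> * (fk_coeff N j)\<^sup>2) / fk_mass N = cos \<theta>"
    using fk_mass_pos[of N] unfolding sum_distrib_left[symmetric] fk_mass_def by simp
  ultimately have *: "((\<lambda>y. cos (2 * pi * (x - y)) * fk_kernel N (x - y)) has_integral cos \<theta>) {0..1}" by simp
  have "((\<lambda>y. (fk_kernel N (x - y) - cos (2 * pi * (x - y)) * fk_kernel N (x - y)) / 2) has_integral (1 - cos \<theta>) / 2) {0..1}"
    by (intro has_integral_divide has_integral_diff fk_kernel_mean *)
  moreover have "(fk_kernel N t - cos (2 * pi * t) * fk_kernel N t) / 2 = (sin (pi * t))\<^sup>2 * fk_kernel N t" for t
  proof -
    have "cos (2 * pi * t) = 1 - 2 * (sin (pi * t))\<^sup>2"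
      using cos_double_sin[of "pi * t"] by (simp add: mult_ac)
    then show ?thesis by (simp only:) (simp add: field_simps)
  qed
  ultimately show ?thesis unfolding \<theta>_def by simp
qed

lemma trigpoly_fk_mean: "continuous_on {0..1} G \<Longrightarrow> trigpoly N (fk_mean N G)"
proof -
  assume G: "continuous_on {0..1} G"
  have "trigpoly N (\<lambda>x. (1 / fk_mass N) * (\<Sum>j=1..N+1. \<Sum>l=1..N+1. fk_coeff N j * fk_coeff N l * cosconv G (int j - int l) x))"
    by (intro trigpoly_scale trigpoly_sum trigpoly_cosconv G) auto
  then show ?thesis by (simp add: fk_mean_def[abs_def] del: sum.cl_ivl_Suc)
qed

lemma trigsum_periodic: "trigsum N c d (x + 1) = trigsum N c d x"
proof -
  have "2 * pi * real k * (x + 1) = 2 * pi * real k * x + 2 * pi * real k" for k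
    by (simp add: algebra_simps)
  moreover have "cos (t + 2 * pi * real k) = cos t" "sin (t + 2 * pi * real k) = sin t" for t k
    using cos_int_2pin[of "int k"] sin_int_2pin[of "int k"] by (simp_all add: cos_add sin_add)
  ultimately show ?thesis unfolding trigsum_def by simp
qed

text \<open>The kernel is a probability density on a period. That the constant is 1 lets
  \<open>Cper_fk_mean\<close> keep the same \<open>M\<close> for all derivatives.\<close>

lemma fk_mean_abs_le:
  assumes G: "continuous_on {0..1} G" and M: "\<And>y. y \<in> {0..1} \<Longrightarrow> \<bar>G y\<bar> \<le> M"
  shows "\<bar>fk_mean N G x\<bar> \<le> M"
proof -
  have "((\<lambda>y. M * fk_kernel N (x - y)) has_integral M * 1) {0..1}"
    by (rule has_integral_mult_right[OF fk_kernel_mean])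
  moreover have "\<bar>G y * fk_kernel N (x - y)\<bar> \<le> M * fk_kernel N (x - y)" if "y \<in> {0..1}" for y
    using M[OF that] fk_kernel_nonneg[of N "x - y"] by (simp add: abs_mult mult_right_mono)
  ultimately show ?thesis
    using integral_norm_bound_integral[of "\<lambda>y. G y * fk_kernel N (x - y)" "{0..1}" "\<lambda>y. M * fk_kernel N (x - y)"]
      fk_mean_integral[OF G, of N x]
    by (metis (no_types, lifting) has_integral_integrable integral_unique mult.right_neutral real_norm_def)
qed

lemma fk_mean_deriv:
  assumes "continuous_on {0..1} G'" "\<And>x. (G has_real_derivative G' x) (at x)" "\<And>x. G (x + 1) = G x"
  shows "(fk_mean N G has_real_derivative fk_mean N G' x) (at x)"
  unfolding fk_mean_def
  by (intro DERIV_cdivide DERIV_sum DERIV_cmult cosconv_deriv assms)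

lemma Cper_fk_mean: "Cper m M G \<Longrightarrow> Cper m M (fk_mean N G)"
proof (induction m arbitrary: G)
  case 0
  have c: "continuous_on {0..1} G" by (rule CperD(3)[OF 0])
  obtain u v where J: "fk_mean N G = trigsum N u v" using trigpoly_fk_mean[OF c, of N] by (auto simp: trigpoly_def)
  have "continuous_on UNIV (trigsum N u v)" unfolding trigsum_def[abs_def] by (intro continuous_intros)
  then show ?case
    using fk_mean_abs_le[OF c CperD(2)[OF 0], of N] trigsum_periodic J by simp
next
  case (Suc m)
  then obtain G' where G': "Cper m M G'" "\<And>x. (G has_real_derivative G' x) (at x)" by auto
  have c: "continuous_on {0..1} G" by (rule CperD(3)[OF Suc.prems])
  obtain u v where J: "fk_mean N G = trigsum N u v" using trigpoly_fk_mean[OF c, of N] by (auto simp: trigpoly_def)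
  have "fk_mean N G (x + 1) = fk_mean N G x" for x unfolding J by (rule trigsum_periodic)
  moreover have "(fk_mean N G has_real_derivative fk_mean N G' x) (at x)" for x
    by (rule fk_mean_deriv[OF CperD(3)[OF G'(1)] G'(2) CperD(1)[OF Suc.prems]])
  ultimately show ?case
    using fk_mean_abs_le[OF c CperD(2)[OF Suc.prems]] Suc.IH[OF G'(1)] by auto
qed

text \<open>Jordan's inequality with a generous constant: for
  \<open>u = pi * \<bar>t\<bar> \<le> 2\<close> the Taylor bound gives
  \<open>sin u \<ge> u - u ^ 3 / 6 \<ge> u / 3\<close>, and
  \<open>u \<ge> 2 * \<bar>t\<bar>\<close>.\<close>

lemma abs_le_sin_pi:
  fixes t :: real
  assumes "\<bar>t\<bar> \<le> 1/2"
  shows "\<bar>t\<bar> \<le> 2 * \<bar>sin (pi * t)\<bar>"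
proof -
  define u where "u = pi * \<bar>t\<bar>"
  have u0: "0 \<le> u" by (simp add: u_def)
  have "u \<le> pi * (1/2)" unfolding u_def using assms by (intro mult_left_mono) auto
  then have u2: "u \<le> 2" using pi_less_4 by linarith
  have "\<bar>sin u - (\<Sum>m<3. sin_coeff m * u ^ m)\<bar> \<le> inverse (fact 3) * \<bar>u\<bar> ^ 3" by (rule Maclaurin_sin_bound)
  then have "\<bar>sin u - u\<bar> \<le> u ^ 3 / 6"
    using u0 by (simp add: sin_coeff_def numeral_eq_Suc divide_simps)
  moreover have "u ^ 3 \<le> 4 * u"
  proof -
    have "u\<^sup>2 \<le> 2\<^sup>2" using u0 u2 by (intro power_mono)
    then have "u * u\<^sup>2 \<le> u * 4" using u0 by (intro mult_left_mono) auto
    then show ?thesis by (simp add: power3_eq_cube power2_eq_square)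
  qed
  ultimately have "sin u \<ge> u / 3" by linarith
  moreover have "u \<ge> 2 * \<bar>t\<bar>" unfolding u_def using pi_ge_two by (intro mult_right_mono) auto
  moreover have "\<bar>sin (pi * t)\<bar> = \<bar>sin u\<bar>" unfolding u_def by (cases "t \<ge> 0") auto
  ultimately show ?thesis by linarith
qed

text \<open>\<open>\<bar>sin (pi * (x - y))\<bar>\<close> is comparable to the distance of
  \<open>x - y\<close> from the integers, and its square is what \<open>fk_kernel_moment\<close>
  integrates.\<close>

lemma periodic_lipschitz_sin:
  assumes per: "\<And>x. G (x + 1) = G x" and d: "\<And>x. (G has_real_derivative G' x) (at x)"
    and L: "\<And>x. \<bar>G' x\<bar> \<le> L"
  shows "\<bar>G x - G y\<bar> \<le> 2 * L * \<bar>sin (pi * (x - y))\<bar>"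
proof -
  have L0: "L \<ge> 0" using L[of 0] by linarith
  define k where "k = round (x - y)"
  define t where "t = x - y - of_int k"
  have t: "\<bar>t\<bar> \<le> 1/2" unfolding t_def k_def using of_int_round_abs_le[of "x - y"] by (simp add: abs_minus_commute)
  have "G x = G (y + t)" using periodic_shift_int[of G "y + t" k] per by (simp add: t_def)
  moreover have "norm (G (y + t) - G y) \<le> L * norm (y + t - y)"
    by (rule field_differentiable_bound[of UNIV G G']) (use d L in auto)
  ultimately have "\<bar>G x - G y\<bar> \<le> L * \<bar>t\<bar>" by simp
  also have "\<dots> \<le> L * (2 * \<bar>sin (pi * t)\<bar>)" using abs_le_sin_pi[OF t] L0 by (intro mult_left_mono)
  also have "\<bar>sin (pi * t)\<bar> = \<bar>sin (pi * (x - y))\<bar>"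
  proof -
    have "pi * t = pi * (x - y) - pi * of_int k" by (simp add: t_def right_diff_distrib)
    then have "\<bar>sin (pi * t)\<bar> = \<bar>sin (pi * (x - y))\<bar> * \<bar>cos (pi * of_int k)\<bar>"
      using sin_npi_int[of k] by (simp add: sin_diff abs_mult)
    moreover have "\<bar>cos (pi * of_int k)\<bar> = 1" using sin_npi_int[of k] cos_squared_eq[of "pi * of_int k"]
      by (simp add: abs_square_eq_1)
    ultimately show ?thesis by simp
  qed
  finally show ?thesis by (simp add: mult_ac)
qed

text \<open>By \<open>2 * z \<le> N * z\<^sup>2 + 1 / N\<close> the Lipschitz increment is bounded
  through the second moment of the kernel. That moment is at most \<open>(2 / N)\<^sup>2\<close>, so
  the two terms contribute 4 / N and 1 / N.\<close>

lemma fk_mean_error: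
  assumes N: "N \<ge> 1" and c: "continuous_on UNIV G" and per: "\<And>x. G (x + 1) = G x"
    and d: "\<And>x. (G has_real_derivative G' x) (at x)" and L: "\<And>x. \<bar>G' x\<bar> \<le> L"
  shows "\<bar>G x - fk_mean N G x\<bar> \<le> 5 / real N * L"
proof -
  have L0: "L \<ge> 0" using L[of 0] by linarith
  have cG: "continuous_on {0..1} G" by (rule continuous_on_subset[OF c]) auto
  define s where "s y = (sin (pi * (x - y)))\<^sup>2" for y
  define \<mu> where "\<mu> = (1 - cos (pi / real (N + 2))) / 2"
  have "((\<lambda>y. G x * fk_kernel N (x - y) - G y * fk_kernel N (x - y)) has_integral (G x * 1 - fk_mean N G x)) {0..1}"
    by (intro has_integral_diff has_integral_mult_right fk_kernel_mean fk_mean_integral cG)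
  then have 1: "((\<lambda>y. (G x - G y) * fk_kernel N (x - y)) has_integral (G x - fk_mean N G x)) {0..1}"
    by (simp add: algebra_simps)
  have 2: "((\<lambda>y. L * (real N * (s y * fk_kernel N (x - y)) + fk_kernel N (x - y) / real N)) has_integral
      (L * (real N * \<mu> + 1 / real N))) {0..1}"
    unfolding s_def \<mu>_def
    by (intro has_integral_mult_right has_integral_add has_integral_divide fk_kernel_mean fk_kernel_moment)
  have "\<bar>(G x - G y) * fk_kernel N (x - y)\<bar> \<le> L * (real N * (s y * fk_kernel N (x - y)) + fk_kernel N (x - y) / real N)" for y
  proof -
    define z where "z = \<bar>sin (pi * (x - y))\<bar>"
    have "0 \<le> (real N * z - 1)\<^sup>2" by simp
    then have "2 * z * real N \<le> (real N * z\<^sup>2 + 1 / real N) * real N"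
      using N by (simp add: power2_eq_square algebra_simps)
    then have z: "2 * z \<le> real N * z\<^sup>2 + 1 / real N" using N by simp
    have "\<bar>G x - G y\<bar> \<le> L * (2 * z)"
      using periodic_lipschitz_sin[OF per d L, of x y] by (simp add: z_def mult_ac)
    also have "\<dots> \<le> L * (real N * z\<^sup>2 + 1 / real N)" using z L0 by (intro mult_left_mono)
    also have "z\<^sup>2 = s y" by (simp add: z_def s_def)
    finally have "\<bar>G x - G y\<bar> * fk_kernel N (x - y) \<le> L * (real N * s y + 1 / real N) * fk_kernel N (x - y)"
      by (intro mult_right_mono fk_kernel_nonneg)
    then show ?thesis using fk_kernel_nonneg[of N "x - y"] by (simp only: abs_mult abs_of_nonneg) (simp add: algebra_simps)
  qed
  then have "\<bar>G x - fk_mean N G x\<bar> \<le> L * (real N * \<mu> + 1 / real N)"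
    using integral_norm_bound_integral[of "\<lambda>y. (G x - G y) * fk_kernel N (x - y)" "{0..1}"
        "\<lambda>y. L * (real N * (s y * fk_kernel N (x - y)) + fk_kernel N (x - y) / real N)"] 1 2
    by (metis (no_types, lifting) has_integral_integrable integral_unique real_norm_def)
  also have "\<dots> \<le> L * (real N * (4 / (real N)\<^sup>2) + 1 / real N)"
  proof -
    define u where "u = pi / real (N + 2) / 2"
    have "pi / real (N + 2) = 2 * u" unfolding u_def by (rule field_sum_of_halves[unfolded mult_2[symmetric], symmetric])
    then have "\<mu> = (sin u)\<^sup>2" unfolding \<mu>_def by (simp only: cos_double_sin) simp
    also have "\<dots> \<le> u\<^sup>2" using abs_sin_x_le_abs_x[of u] by (metis abs_le_square_iff)
    also have "\<dots> \<le> (2 / real N)\<^sup>2"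
    proof (rule power_mono)
      show "0 \<le> u" by (simp add: u_def)
      have "u \<le> 4 / real (N + 2) / 2" unfolding u_def using pi_less_4 by (intro divide_right_mono) auto
      also have "\<dots> \<le> 2 / real N" using N by (simp add: field_simps)
      finally show "u \<le> 2 / real N" .
    qed
    finally show ?thesis using L0 by (intro mult_left_mono add_mono) (auto simp: power_divide)
  qed
  also have "\<dots> = 5 / real N * L" using N by (simp add: power2_eq_square field_simps)
  finally show ?thesis .
qed

definition fk_defect :: "nat \<Rightarrow> (real \<Rightarrow> real) \<Rightarrow> real \<Rightarrow> real" where
  "fk_defect N G x = G x - fk_mean N G x"

lemma Cper_fk_defect: "Cper m M G \<Longrightarrow> Cper m (2 * M) (fk_defect N G)"
  using Cper_diff[OF _ Cper_fk_mean, of m M G M G N] by (simp add: fk_defect_def[abs_def])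

lemma Cper_fk_defect_gain:
  "N \<ge> 1 \<Longrightarrow> Cper (Suc m) M G \<Longrightarrow> Cper m (5 / real N * M) (fk_defect N G)"
proof (induction m arbitrary: G)
  case 0
  then obtain G' where G': "Cper 0 M G'" "\<And>x. (G has_real_derivative G' x) (at x)" by auto
  have "Cper 0 (2 * M) (fk_defect N G)" by (rule Cper_fk_defect[OF Cper_SucD[OF 0(2)]])
  moreover have "\<bar>fk_defect N G x\<bar> \<le> 5 / real N * M" for x
    unfolding fk_defect_def
    by (rule fk_mean_error[OF 0(1) CperD(3)[OF 0(2)] CperD(1)[OF 0(2)] G'(2) CperD(2)[OF G'(1)]])
  ultimately show ?case by auto
next
  case (Suc m)
  then obtain G' where G': "Cper (Suc m) M G'" "\<And>x. (G has_real_derivative G' x) (at x)"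
    unfolding Cper.simps(2)[of "Suc m"] by blast
  have "(fk_defect N G has_real_derivative fk_defect N G' x) (at x)" for x
    unfolding fk_defect_def[abs_def] using G'(2)
    by (intro DERIV_diff fk_mean_deriv CperD(3)[OF G'(1)] CperD(1)[OF Suc.prems(2)]) auto
  moreover have "Cper m (5 / real N * M) (fk_defect N G')" by (rule Suc.IH[OF Suc.prems(1) G'(1)])
  moreover have "\<bar>fk_defect N G x\<bar> \<le> 5 / real N * M" for x
    unfolding fk_defect_def
    by (rule fk_mean_error[OF Suc.prems(1) CperD(3)[OF Suc.prems(2)] CperD(1)[OF Suc.prems(2)] G'(2) CperD(2)[OF G'(1)]])
  moreover have "Cper m (2 * M) (fk_defect N G)" by (rule Cper_fk_defect) (use Suc.prems Cper_le le_SucI in blast)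
  ultimately show ?case using CperD(1) by (metis Cper.simps(2))
qed

text \<open>The operator \<open>1 - J\<close>, with \<open>J\<close> the Fejer-Korovkin mean, commutes with differentiation and trades
  one derivative for a factor \<open>1 / N\<close>; the approximant is \<open>F - (1 - J)\<^sup>m F\<close>.\<close>

lemma jackson:
  assumes N: "N \<ge> 1" and F: "Cper m M F"
  obtains p where "trigpoly N p" "\<And>x. \<bar>F x - p x\<bar> \<le> (5 / real N) ^ m * M" "Cper m ((1 + 2 ^ m) * M) p"
proof -
  define R where "R j = (fk_defect N ^^ j) F" for j
  have RS: "R (Suc j) = fk_defect N (R j)" for j by (simp add: R_def)
  have R0: "R 0 = F" by (simp add: R_def)
  \<comment> \<open>The iterates get two bounds: this one keeps all \<open>m\<close> derivatives at
    a factor 2 per step and controls the derivatives of the approximant; the next one spends a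
    derivative per step and controls the error.\<close>
  have 1: "Cper m (2 ^ j * M) (R j)" for j
  proof (induction j)
    case (Suc j) then show ?case using Cper_fk_defect[OF Suc, of N] by (simp add: RS mult_ac)
  qed (simp add: R0 F)
  have 2: "j \<le> m \<Longrightarrow> Cper (m - j) ((5 / real N) ^ j * M) (R j)" for j
  proof (induction j)
    case (Suc j)
    then have "Cper (Suc (m - Suc j)) ((5 / real N) ^ j * M) (R j)" by (simp add: Suc_diff_Suc del: Cper.simps)
    from Cper_fk_defect_gain[OF N this] show ?case by (simp add: RS mult_ac)
  qed (simp add: R0 F)
  have 3: "trigpoly N (\<lambda>x. F x - R j x)" for j
  proof (induction j)
    case 0 then show ?case by (simp add: R0 trigpoly_zero)
  next
    case (Suc j)
    from trigpoly_add[OF Suc trigpoly_fk_mean[OF CperD(3)[OF 1[of j]]]]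
    show ?case by (simp add: RS fk_defect_def diff_diff_eq2 diff_add_eq)
  qed
  show thesis
  proof (rule that[of "\<lambda>x. F x - R m x"])
    show "trigpoly N (\<lambda>x. F x - R m x)" by (rule 3)
    show "\<bar>F x - (F x - R m x)\<bar> \<le> (5 / real N) ^ m * M" for x using CperD(2)[OF 2[of m]] by simp
    show "Cper m ((1 + 2 ^ m) * M) (\<lambda>x. F x - R m x)"
      using Cper_diff[OF F 1[of m]] by (simp add: algebra_simps)
  qed
qed

section \<open>Sampling inequalities\<close>

text \<open>\<open>K\<close> bounds the ratio of interval length to point separation; the recursion
  records what one derivative costs in \<open>sampling_interval\<close>.\<close>

fun sampling_const :: "real \<Rightarrow> nat \<Rightarrow> real" where
  "sampling_const K 0 = 1"
| "sampling_const K (Suc m) = 1 + (2 * K + 1) * sampling_const K m"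

lemma sampling_const_ge_1: "K \<ge> 0 \<Longrightarrow> sampling_const K m \<ge> 1"
  by (induction m) auto

lemma integral_deriv_bound:
  fixes f g :: "real \<Rightarrow> real"
  assumes "\<And>y. y \<in> {c..d} \<Longrightarrow> (f has_real_derivative g y) (at y within {c..d})"
    and g: "continuous_on {c..d} g" and x: "x \<in> {c..d}" and y: "y \<in> {c..d}"
  shows "\<bar>f x - f y\<bar> \<le> integral {c..d} (\<lambda>t. \<bar>g t\<bar>)"
proof -
  have *: "\<bar>f v - f u\<bar> \<le> integral {c..d} (\<lambda>t. \<bar>g t\<bar>)" if uv: "u \<le> v" "u \<in> {c..d}" "v \<in> {c..d}" for u v
  proof -
    have sub: "{u..v} \<subseteq> {c..d}" using uv by auto
    have "(g has_integral (f v - f u)) {u..v}"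
      using uv sub assms(1) by (intro fundamental_theorem_of_calculus)
        (auto simp: has_real_derivative_iff_has_vector_derivative[symmetric] intro: DERIV_subset[OF _ sub])
    moreover have gi: "(\<lambda>t. \<bar>g t\<bar>) integrable_on {c..d}" "(\<lambda>t. \<bar>g t\<bar>) integrable_on {u..v}"
      using g continuous_on_subset[OF g sub] by (auto intro!: integrable_continuous_real continuous_intros)
    ultimately have "\<bar>f v - f u\<bar> \<le> integral {u..v} (\<lambda>t. \<bar>g t\<bar>)"
      using integral_norm_bound_integral[of g "{u..v}" "\<lambda>t. \<bar>g t\<bar>"]
      by (metis has_integral_integrable integral_unique order_refl real_norm_def)
    also have "\<dots> \<le> integral {c..d} (\<lambda>t. \<bar>g t\<bar>)"
      by (rule integral_subset_le[OF sub]) (use gi in auto)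
    finally show ?thesis .
  qed
  show ?thesis using *[of x y] *[of y x] x y by (cases "x \<le> y") (auto simp: abs_minus_commute)
qed

text \<open>Between two consecutive points the mean value theorem yields a point where the derivative is
  controlled by the values; using disjoint pairs of points keeps these new points separated.\<close>

lemma sampling_interval:
  fixes D :: "nat \<Rightarrow> real \<Rightarrow> real" and x :: "nat \<Rightarrow> real"
  assumes "\<delta> > 0" "d - c \<le> K * \<delta>"
    and "\<And>j y. j \<le> m \<Longrightarrow> y \<in> {c..d} \<Longrightarrow> (D j has_real_derivative D (Suc j) y) (at y within {c..d})"
    and "continuous_on {c..d} (D (Suc m))"
    and "\<And>i. i < 2 ^ m \<Longrightarrow> x i \<in> {c..d} \<and> \<bar>D 0 (x i)\<bar> \<le> A"
    and "\<And>i. Suc i < 2 ^ m \<Longrightarrow> x i + \<delta> \<le> x (Suc i)"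
    and "y \<in> {c..d}"
  shows "\<bar>D 0 y\<bar> \<le> sampling_const K m * (A + (d - c) ^ m * integral {c..d} (\<lambda>t. \<bar>D (Suc m) t\<bar>))"
  using assms(2-)
proof (induction m arbitrary: D x A y)
  case 0
  have "\<bar>D 0 y - D 0 (x 0)\<bar> \<le> integral {c..d} (\<lambda>t. \<bar>D (Suc 0) t\<bar>)"
    by (rule integral_deriv_bound[where g = "D (Suc 0)"]) (use 0 in auto)
  moreover have "\<bar>D 0 (x 0)\<bar> \<le> A" using 0 by auto
  ultimately show ?case by (simp add: abs_le_iff)
next
  case (Suc m)
  define H where "H = d - c"
  define J where "J = integral {c..d} (\<lambda>t. \<bar>D (Suc (Suc m)) t\<bar>)"
  have x0: "x 0 \<in> {c..d}" "\<bar>D 0 (x 0)\<bar> \<le> A" using Suc.prems(4)[of 0] by auto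
  have H: "H \<ge> 0" "H \<le> K * \<delta>" using x0 Suc.prems(1) by (auto simp: H_def)
  have K: "K \<ge> 0" using H assms(1) by (metis linorder_not_le mult_neg_pos order_trans)
  have A: "A \<ge> 0" using x0 by linarith
  have J0: "J \<ge> 0" unfolding J_def using Suc.prems(3)
    by (intro integral_nonneg integrable_continuous_real continuous_intros) auto
  have "\<exists>z. x (2*i) \<le> z \<and> z \<le> x (2*i+1) \<and> \<bar>D 1 z\<bar> \<le> 2 * A / \<delta>" if i: "i < 2 ^ m" for i
  proof -
    have 1: "2 * i < 2 ^ Suc m" "Suc (2 * i) < 2 ^ Suc m" using i by auto
    have gap: "x (2*i) + \<delta> \<le> x (2*i+1)" using Suc.prems(5)[OF 1(2)] by simp
    have mem: "x (2*i) \<in> {c..d}" "x (2*i+1) \<in> {c..d}" "\<bar>D 0 (x (2*i))\<bar> \<le> A" "\<bar>D 0 (x (2*i+1))\<bar> \<le> A"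
      using Suc.prems(4)[OF 1(1)] Suc.prems(4)[OF 1(2)] by auto
    have lt: "x (2*i) < x (2*i+1)" using gap assms(1) by simp
    have "(D 0 has_derivative (*) (D 1 y)) (at y within {x (2*i)..x (2*i+1)})"
      if "x (2*i) \<le> y" "y \<le> x (2*i+1)" for y
    proof -
      have "y \<in> {c..d}" using that mem by auto
      then have "(D 0 has_real_derivative D 1 y) (at y within {c..d})" using Suc.prems(2)[of 0 y] by simp
      then show ?thesis using mem by (auto simp: has_field_derivative_def intro: has_derivative_subset)
    qed
    from mvt_very_simple[OF less_imp_le[OF lt] this] obtain z
      where z: "z \<in> {x (2*i)..x (2*i+1)}" "D 0 (x (2*i+1)) - D 0 (x (2*i)) = D 1 z * (x (2*i+1) - x (2*i))"
      by auto
    have "\<bar>D 1 z\<bar> * \<delta> \<le> \<bar>D 1 z\<bar> * (x (2*i+1) - x (2*i))" using gap by (intro mult_left_mono) auto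
    also have "\<dots> = \<bar>D 0 (x (2*i+1)) - D 0 (x (2*i))\<bar>" using z(2) lt by (simp add: abs_mult)
    also have "\<dots> \<le> 2 * A" using mem by linarith
    finally have "\<bar>D 1 z\<bar> \<le> 2 * A / \<delta>" using assms(1) by (simp add: field_simps)
    then show ?thesis using z by auto
  qed
  then obtain z where z: "\<And>i. i < 2 ^ m \<Longrightarrow> x (2*i) \<le> z i \<and> z i \<le> x (2*i+1) \<and> \<bar>D 1 (z i)\<bar> \<le> 2 * A / \<delta>"
    by metis
  have D1: "\<bar>D 1 t\<bar> \<le> sampling_const K m * (2 * A / \<delta> + H ^ m * J)" if t: "t \<in> {c..d}" for t
  proof -
    have "\<bar>(\<lambda>j. D (Suc j)) 0 t\<bar> \<le> sampling_const K m * (2 * A / \<delta> + (d - c) ^ m * integral {c..d} (\<lambda>t. \<bar>(\<lambda>j. D (Suc j)) (Suc m) t\<bar>))"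
    proof (rule Suc.IH)
      show "d - c \<le> K * \<delta>" by (rule Suc.prems(1))
      show "(D (Suc j) has_real_derivative D (Suc (Suc j)) y) (at y within {c..d})" if "j \<le> m" "y \<in> {c..d}" for j y
        using Suc.prems(2) that by simp
      show "continuous_on {c..d} (D (Suc (Suc m)))" by (rule Suc.prems(3))
      show "z i \<in> {c..d} \<and> \<bar>D (Suc 0) (z i)\<bar> \<le> 2 * A / \<delta>" if "i < 2 ^ m" for i
        using z[OF that] Suc.prems(4)[of "2*i"] Suc.prems(4)[of "2*i+1"] that by auto
      show "z i + \<delta> \<le> z (Suc i)" if "Suc i < 2 ^ m" for i
      proof -
        have "z i \<le> x (2*i+1)" "x (2 * Suc i) \<le> z (Suc i)" using z[of i] z[of "Suc i"] that by auto
        moreover have "x (2*i+1) + \<delta> \<le> x (2 * Suc i)" using Suc.prems(5)[of "2*i+1"] that by simp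
        ultimately show ?thesis by linarith
      qed
    qed (rule t)
    then show ?thesis by (simp add: H_def J_def)
  qed
  define S where "S = sampling_const K m"
  have S: "S \<ge> 1" using sampling_const_ge_1[OF K] by (simp add: S_def)
  define B where "B = S * (2 * A / \<delta> + H ^ m * J)"
  have B0: "B \<ge> 0" unfolding B_def using S A H J0 assms(1) by (intro mult_nonneg_nonneg add_nonneg_nonneg) auto
  have "norm (D 0 y - D 0 (x 0)) \<le> B * norm (y - x 0)"
    by (rule field_differentiable_bound[of "{c..d}" "D 0" "D 1"])
      (use Suc.prems(2)[of 0] D1 Suc.prems(6) x0 in \<open>auto simp: B_def S_def\<close>)
  also have "\<dots> \<le> B * H" using B0 Suc.prems(6) x0 by (intro mult_left_mono) (auto simp: H_def)
  finally have "\<bar>D 0 y\<bar> \<le> A + B * H" using x0 by (simp add: abs_le_iff)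
  \<comment> \<open>The division by \<open>\<delta>\<close> in the mean value step is undone by
    integrating the derivative back over a length of at most \<open>H\<close>, since
    \<open>H / \<delta> \<le> K\<close>.\<close>
  also have "B * H = S * (2 * A * (H / \<delta>) + H ^ Suc m * J)" by (simp add: B_def algebra_simps)
  also have "\<dots> \<le> S * (2 * A * K + H ^ Suc m * J)"
    using S A H assms(1) by (intro mult_left_mono add_right_mono) (auto simp: field_simps)
  also have "A + S * (2 * A * K + H ^ Suc m * J) \<le> (1 + (2 * K + 1) * S) * (A + H ^ Suc m * J)"
  proof -
    define P where "P = H ^ Suc m * J"
    have "P \<ge> 0" unfolding P_def using H J0 by simp
    then have "0 \<le> P + 2 * K * S * P + S * A" using K S A by (intro add_nonneg_nonneg mult_nonneg_nonneg) auto
    then show ?thesis unfolding P_def[symmetric] by (simp add: algebra_simps)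
  qed
  finally show ?case by (simp add: S_def H_def J_def)
qed

text \<open>Cauchy-Schwarz against the constant 1, read off from a nonnegative variance:
  \<open>\<mu>\<close> is the mean of \<open>\<bar>g\<bar>\<close>, and the integral of
  \<open>(\<bar>g t\<bar> - \<mu>)\<^sup>2\<close> is expanded.\<close>

lemma integral_abs_square_le:
  fixes g :: "real \<Rightarrow> real"
  assumes "c < d" and g: "continuous_on {c..d} g"
  shows "(integral {c..d} (\<lambda>t. \<bar>g t\<bar>))\<^sup>2 \<le> (d - c) * integral {c..d} (\<lambda>t. (g t)\<^sup>2)"
proof -
  define I Q \<mu> where "I = integral {c..d} (\<lambda>t. \<bar>g t\<bar>)" and "Q = integral {c..d} (\<lambda>t. (g t)\<^sup>2)"
    and "\<mu> = I / (d - c)"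
  have "((\<lambda>t. (g t)\<^sup>2 - 2 * \<mu> * \<bar>g t\<bar> + \<mu>\<^sup>2) has_integral (Q - 2 * \<mu> * I + \<mu>\<^sup>2 * (d - c))) {c..d}"
    unfolding Q_def I_def using g assms(1) has_integral_const_real[of "\<mu>\<^sup>2" c d]
    by (intro has_integral_add has_integral_diff has_integral_mult_right integrable_integral
        integrable_continuous_real continuous_intros) (auto simp: mult.commute)
  moreover have "(g t)\<^sup>2 - 2 * \<mu> * \<bar>g t\<bar> + \<mu>\<^sup>2 = (\<bar>g t\<bar> - \<mu>)\<^sup>2" for t
    by (simp add: power2_eq_square algebra_simps)
  ultimately have "0 \<le> Q - 2 * \<mu> * I + \<mu>\<^sup>2 * (d - c)"
    by (metis (no_types, lifting) has_integral_nonneg zero_le_power2)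
  moreover have mu: "\<mu> * (d - c) = I" using assms(1) by (simp add: \<mu>_def)
  then have "\<mu>\<^sup>2 * (d - c) = \<mu> * I" by (simp add: power2_eq_square mult.assoc)
  ultimately have "\<mu> * I \<le> Q" by linarith
  then have "(d - c) * (\<mu> * I) \<le> (d - c) * Q" using assms(1) by (intro mult_left_mono) auto
  moreover have "(d - c) * (\<mu> * I) = I\<^sup>2"
    using mu by (metis mult.assoc mult.commute power2_eq_square)
  ultimately show ?thesis by (simp add: I_def Q_def)
qed

text \<open>Cut the cell into \<open>2 ^ m\<close> pieces of length \<open>w \<ge> 4 * h\<close>.
  Each midpoint has a design point within \<open>h \<le> w / 4\<close>, so these points lie in the
  open cell and are \<open>w / 2\<close> apart, which is \<open>sampling_interval\<close> with
  \<open>K = 2 ^ Suc m\<close>. The right-hand side involves only design points of the open cell, so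
  that cells can be summed.\<close>

lemma sampling_cell:
  fixes D :: "nat \<Rightarrow> real \<Rightarrow> real"
  assumes cd: "c < d" and h: "h > 0" "2 ^ m * (4 * h) \<le> d - c" and X: "finite X"
    and cover: "\<And>y. y \<in> {c<..<d} \<Longrightarrow> \<exists>x\<in>X. \<bar>y - x\<bar> \<le> h"
    and D: "\<And>j y. j \<le> m \<Longrightarrow> y \<in> {c..d} \<Longrightarrow> (D j has_real_derivative D (Suc j) y) (at y within {c..d})"
    and cD: "continuous_on {c..d} (D (Suc m))"
    and y: "y \<in> {c..d}"
  shows "(D 0 y)\<^sup>2 \<le> 2 * (sampling_const (2 ^ Suc m) m)\<^sup>2 *
     ((\<Sum>x\<in>X \<inter> {c<..<d}. (D 0 x)\<^sup>2) + (d - c) ^ (2 * m + 1) * integral {c..d} (\<lambda>t. (D (Suc m) t)\<^sup>2))"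
proof -
  define w where "w = (d - c) / 2 ^ m"
  define mid where "mid i = c + (real i + 1/2) * w" for i :: nat
  have w: "w > 0" "4 * h \<le> w" using cd h by (auto simp: w_def field_simps)
  have mid: "c + w / 2 \<le> mid i \<and> mid i \<le> d - w / 2" if "i < 2 ^ m" for i
  proof -
    have "real i + 1 \<le> 2 ^ m" using that by (metis Suc_leI of_nat_Suc of_nat_le_numeral_power_cancel_iff add.commute)
    then have "(real i + 1) * w \<le> 2 ^ m * w" using w by (intro mult_right_mono) auto
    also have "2 ^ m * w = d - c" by (simp add: w_def)
    finally have "mid i \<le> d - w / 2" by (simp add: mid_def algebra_simps)
    moreover have "0 \<le> real i * w" using w by simp
    ultimately show ?thesis by (simp add: mid_def algebra_simps)
  qed
  have "\<exists>x\<in>X. \<bar>mid i - x\<bar> \<le> h" if "i < 2 ^ m" for i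
    using mid[OF that] w by (intro cover) auto
  then obtain x where x: "\<And>i. i < 2 ^ m \<Longrightarrow> x i \<in> X \<and> \<bar>mid i - x i\<bar> \<le> h" by metis
  have xin: "x i \<in> X \<inter> {c<..<d}" if "i < 2 ^ m" for i
    using x[OF that] mid[OF that] w h by (auto simp: abs_le_iff)
  define A where "A = sqrt (\<Sum>x\<in>X \<inter> {c<..<d}. (D 0 x)\<^sup>2)"
  define J where "J = integral {c..d} (\<lambda>t. \<bar>D (Suc m) t\<bar>)"
  define S where "S = sampling_const (2 ^ Suc m) m"
  have "\<bar>D 0 y\<bar> \<le> sampling_const (2 ^ Suc m) m * (A + (d - c) ^ m * integral {c..d} (\<lambda>t. \<bar>D (Suc m) t\<bar>))"
  proof (rule sampling_interval[where \<delta> = "w / 2" and x = x])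
    show "w / 2 > 0" using w by simp
    show "d - c \<le> 2 ^ Suc m * (w / 2)" by (simp add: w_def)
    show "x i \<in> {c..d} \<and> \<bar>D 0 (x i)\<bar> \<le> A" if "i < 2 ^ m" for i
    proof -
      have "(D 0 (x i))\<^sup>2 \<le> (\<Sum>x\<in>X \<inter> {c<..<d}. (D 0 x)\<^sup>2)"
        by (rule member_le_sum[OF xin[OF that]]) (use X in auto)
      then have "\<bar>D 0 (x i)\<bar> \<le> A" unfolding A_def by (rule real_le_rsqrt[of "\<bar>D 0 (x i)\<bar>", simplified])
      then show ?thesis using xin[OF that] by auto
    qed
    show "x i + w / 2 \<le> x (Suc i)" if "Suc i < 2 ^ m" for i
    proof -
      have "mid (Suc i) = mid i + w" by (simp add: mid_def algebra_simps)
      then show ?thesis using x[of i] x[of "Suc i"] that w by (auto simp: abs_le_iff)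
    qed
  qed (use D cD y in auto)
  then have "\<bar>D 0 y\<bar> \<le> S * (A + (d - c) ^ m * J)" by (simp add: S_def J_def)
  then have "(D 0 y)\<^sup>2 \<le> (S * (A + (d - c) ^ m * J))\<^sup>2" by (rule abs_le_square_iff[THEN iffD1, OF order_trans[OF _ abs_ge_self]])
  also have "\<dots> = S\<^sup>2 * (A + (d - c) ^ m * J)\<^sup>2" by (simp add: power_mult_distrib)
  also have "\<dots> \<le> S\<^sup>2 * (2 * (A\<^sup>2 + ((d - c) ^ m * J)\<^sup>2))"
  proof (rule mult_left_mono)
    show "(A + (d - c) ^ m * J)\<^sup>2 \<le> 2 * (A\<^sup>2 + ((d - c) ^ m * J)\<^sup>2)"
      using sum_squares_bound[of A "(d - c) ^ m * J"] by (simp add: power2_sum)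
  qed simp
  also have "\<dots> \<le> S\<^sup>2 * (2 * (A\<^sup>2 + (d - c) ^ (2 * m + 1) * integral {c..d} (\<lambda>t. (D (Suc m) t)\<^sup>2)))"
  proof -
    have "((d - c) ^ m * J)\<^sup>2 = (d - c) ^ (2 * m) * J\<^sup>2" by (simp add: power_mult_distrib power_mult[symmetric] mult.commute)
    also have "\<dots> \<le> (d - c) ^ (2 * m) * ((d - c) * integral {c..d} (\<lambda>t. (D (Suc m) t)\<^sup>2))"
      unfolding J_def using cd by (intro mult_left_mono integral_abs_square_le cD) auto
    finally show ?thesis by (intro mult_left_mono add_left_mono) (auto simp: mult_ac)
  qed
  also have "A\<^sup>2 = (\<Sum>x\<in>X \<inter> {c<..<d}. (D 0 x)\<^sup>2)"
    unfolding A_def by (rule real_sqrt_pow2) (auto intro: sum_nonneg)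
  finally show ?thesis unfolding S_def by (simp only: mult_ac)
qed

lemma integral_partition:
  fixes g :: "real \<Rightarrow> real"
  assumes "H > 0" "continuous_on {a..a + real n * H} g"
  shows "integral {a..a + real n * H} g = (\<Sum>i<n. integral {a + real i * H..a + real (Suc i) * H} g)"
  using assms(2)
proof (induction n)
  case (Suc n)
  have le: "a + real n * H \<le> a + real (Suc n) * H" "a \<le> a + real n * H" using assms(1) by (auto simp: algebra_simps)
  have "integral {a..a + real (Suc n) * H} g = integral {a..a + real n * H} g + integral {a + real n * H..a + real (Suc n) * H} g"
    by (rule Henstock_Kurzweil_Integration.integral_combine[symmetric])
      (use le Suc.prems in \<open>auto intro: integrable_continuous_real\<close>)
  moreover have "continuous_on {a..a + real n * H} g" by (rule continuous_on_subset[OF Suc.prems]) (use le in auto)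
  ultimately show ?case using Suc.IH by simp
qed simp

lemma partition_cell:
  assumes "H > 0" "y \<in> {a..a + real (Suc n) * H}"
  obtains i where "i \<le> n" "y \<in> {a + real i * H..a + real (Suc i) * H}"
  using assms(2)
proof (induction n arbitrary: thesis)
  case 0 then show ?case by auto
next
  case (Suc n)
  show ?case
  proof (cases "y \<le> a + real (Suc n) * H")
    case True
    then show ?thesis using Suc.IH Suc.prems by (metis atLeastAtMost_iff le_Suc_eq)
  next
    case False then show ?thesis using Suc.prems(1)[of "Suc n"] Suc.prems(2) by simp
  qed
qed

text \<open>The interval is cut into equal cells of length between \<open>2 ^ m * (4 * h)\<close>
  and twice that. One cell suffices for the pointwise bound; in the mean square bound each cell
  contributes its length, which yields the extra factor \<open>h\<close>.\<close>

lemma sampling_fine: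
  "\<exists>C>0. \<forall>(a::real) b h X (D :: nat \<Rightarrow> real \<Rightarrow> real).
     a < b \<longrightarrow> h > 0 \<longrightarrow> 2 ^ m * (4 * h) \<le> b - a \<longrightarrow> finite X \<longrightarrow>
     (\<forall>y\<in>{a<..<b}. \<exists>x\<in>X. \<bar>y - x\<bar> \<le> h) \<longrightarrow>
     (\<forall>j\<le>m. \<forall>y\<in>{a..b}. (D j has_real_derivative D (Suc j) y) (at y within {a..b})) \<longrightarrow>
     continuous_on {a..b} (D (Suc m)) \<longrightarrow>
     (\<forall>y\<in>{a..b}. (D 0 y)\<^sup>2 \<le> C * ((\<Sum>x\<in>X. (D 0 x)\<^sup>2) + h ^ (2 * m + 1) * integral {a..b} (\<lambda>t. (D (Suc m) t)\<^sup>2))) \<and>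
     integral {a..b} (\<lambda>t. (D 0 t)\<^sup>2) \<le> C * (h * ((\<Sum>x\<in>X. (D 0 x)\<^sup>2) + h ^ (2 * m + 1) * integral {a..b} (\<lambda>t. (D (Suc m) t)\<^sup>2)))"
proof -
  define S where "S = 2 * (sampling_const (2 ^ Suc m) m)\<^sup>2"
  define \<kappa> where "\<kappa> = 2 * (2 ^ m * 4 :: real)"
  \<comment> \<open>The power \<open>2 * m + 1\<close> of \<open>\<kappa>\<close> replaces
    \<open>H ^ (2 * m + 1)\<close> by the same power of \<open>h\<close>; one more replaces the cell
    length \<open>H\<close> in the mean square bound.\<close>
  define C where "C = S * \<kappa> ^ (2 * m + 2)"
  have "(sampling_const (2 ^ Suc m) m)\<^sup>2 \<ge> 1" by (intro one_le_power sampling_const_ge_1) simp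
  then have S: "S \<ge> 1" unfolding S_def by linarith
  have "(1::real) \<le> 2 ^ m" by simp
  then have \<kappa>: "\<kappa> \<ge> 1" unfolding \<kappa>_def by linarith
  have C: "C > 0" using S \<kappa> by (simp add: C_def)
  show ?thesis
  proof (intro exI[of _ C] conjI allI impI C)
    fix a b h :: real and X and D :: "nat \<Rightarrow> real \<Rightarrow> real"
    assume ab: "a < b" and h: "h > 0" "2 ^ m * (4 * h) \<le> b - a" and X: "finite X"
      and cover: "\<forall>y\<in>{a<..<b}. \<exists>x\<in>X. \<bar>y - x\<bar> \<le> h"
      and D: "\<forall>j\<le>m. \<forall>y\<in>{a..b}. (D j has_real_derivative D (Suc j) y) (at y within {a..b})"
      and cD: "continuous_on {a..b} (D (Suc m))"
    \<comment> \<open>One less than the number of cells, which are indexed from 0 to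
      \<open>n\<close>. The quotient \<open>q\<close> is at least 1, so its floor lies between
      \<open>q / 2\<close> and \<open>q\<close>; this fixes the cell length up to a factor
      2.\<close>
    define n where "n = nat \<lfloor>(b - a) / (2 ^ m * (4 * h))\<rfloor> - 1"
    define H where "H = (b - a) / real (Suc n)"
    define I where "I = integral {a..b} (\<lambda>t. (D (Suc m) t)\<^sup>2)"
    define V where "V = (\<Sum>x\<in>X. (D 0 x)\<^sup>2)"
    define c where "c i = a + real i * H" for i
    define q where "q = (b - a) / (2 ^ m * (4 * h))"
    have q: "q \<ge> 1" using h by (simp add: q_def field_simps)
    then have "nat \<lfloor>q\<rfloor> \<ge> 1" by linarith
    then have n: "real (Suc n) = of_int \<lfloor>q\<rfloor>" unfolding n_def q_def[symmetric] by linarith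
    have "(1::real) \<le> of_int \<lfloor>q\<rfloor>" using q by simp
    then have n1: "real (Suc n) \<le> q" "q \<le> 2 * real (Suc n)" unfolding n by linarith+
    have ba: "b - a = q * (2 ^ m * (4 * h))" using h by (simp add: q_def)
    have H0: "H > 0" using ab by (simp add: H_def)
    have H1: "2 ^ m * (4 * h) \<le> H"
      using n1(1) h unfolding H_def ba by (simp add: pos_le_divide_eq mult.commute mult_left_mono del: of_nat_Suc)
    have H2: "H \<le> \<kappa> * h"
    proof -
      have "H * real (Suc n) = q * (2 ^ m * (4 * h))" by (simp add: H_def ba[symmetric])
      also have "\<dots> \<le> 2 * real (Suc n) * (2 ^ m * (4 * h))" using n1(2) h by (intro mult_right_mono) auto
      also have "\<dots> = \<kappa> * h * real (Suc n)" by (simp add: \<kappa>_def)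
      finally show ?thesis by (simp del: of_nat_Suc)
    qed
    have b: "b = a + real (Suc n) * H" by (simp add: H_def)
    have sub: "{c i..c (Suc i)} \<subseteq> {a..b}" if "i \<le> n" for i
    proof -
      have "real (Suc i) * H \<le> real (Suc n) * H" using that H0 by (intro mult_right_mono) auto
      moreover have "0 \<le> real i * H" using H0 by simp
      ultimately show ?thesis unfolding b c_def by auto
    qed
    have cH: "c (Suc i) - c i = H" for i by (simp add: c_def algebra_simps)
    define B where "B i = (\<Sum>x\<in>X \<inter> {c i<..<c (Suc i)}. (D 0 x)\<^sup>2) + H ^ (2 * m + 1) * integral {c i..c (Suc i)} (\<lambda>t. (D (Suc m) t)\<^sup>2)" for i
    have cont2: "continuous_on {a..b} (\<lambda>t. (D (Suc m) t)\<^sup>2)" using cD by (intro continuous_intros)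
    have cont0: "continuous_on {a..b} (D 0)" using D by (intro DERIV_continuous_on[where D = "D (Suc 0)"]) auto
    then have cont0: "continuous_on {a..b} (\<lambda>t. (D 0 t)\<^sup>2)" by (intro continuous_intros)
    have B0: "B i \<ge> 0" if "i \<le> n" for i
      unfolding B_def using H0 continuous_on_subset[OF cont2 sub[OF that]]
      by (intro add_nonneg_nonneg sum_nonneg mult_nonneg_nonneg integral_nonneg integrable_continuous_real) auto
    have cell: "(D 0 y)\<^sup>2 \<le> S * B i" if i: "i \<le> n" and y: "y \<in> {c i..c (Suc i)}" for i y
    proof -
      have "(D 0 y)\<^sup>2 \<le> 2 * (sampling_const (2 ^ Suc m) m)\<^sup>2 *
        ((\<Sum>x\<in>X \<inter> {c i<..<c (Suc i)}. (D 0 x)\<^sup>2) + (c (Suc i) - c i) ^ (2 * m + 1) * integral {c i..c (Suc i)} (\<lambda>t. (D (Suc m) t)\<^sup>2))"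
      proof (rule sampling_cell[where h = h])
        show "c i < c (Suc i)" using cH[of i] H0 by linarith
        show "2 ^ m * (4 * h) \<le> c (Suc i) - c i" using H1 cH by simp
        show "\<exists>x\<in>X. \<bar>y - x\<bar> \<le> h" if "y \<in> {c i<..<c (Suc i)}" for y
        proof -
          have "{c i..c (Suc i)} \<subseteq> {a..b}" by (rule sub[OF i])
          then have "a \<le> c i" "c (Suc i) \<le> b" using \<open>c i < c (Suc i)\<close> by auto
          then show ?thesis using cover that by auto
        qed
        show "(D j has_real_derivative D (Suc j) y) (at y within {c i..c (Suc i)})" if "j \<le> m" "y \<in> {c i..c (Suc i)}" for j y
          using D that sub[OF i] by (blast intro: DERIV_subset)
        show "continuous_on {c i..c (Suc i)} (D (Suc m))" by (rule continuous_on_subset[OF cD sub[OF i]])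
      qed (use h X y in auto)
      then show ?thesis unfolding cH S_def B_def .
    qed
    \<comment> \<open>Open cells are disjoint, so no design point is counted twice.\<close>
    have sumB: "(\<Sum>i<Suc n. B i) \<le> V + H ^ (2 * m + 1) * I"
    proof -
      have mono: "c i \<le> c j" if "i \<le> j" for i j using that H0 by (simp add: c_def)
      have "(\<Sum>i<Suc n. \<Sum>x\<in>X \<inter> {c i<..<c (Suc i)}. (D 0 x)\<^sup>2) = (\<Sum>x\<in>(\<Union>i<Suc n. X \<inter> {c i<..<c (Suc i)}). (D 0 x)\<^sup>2)"
      proof (rule sum.UNION_disjoint[symmetric])
        have "(X \<inter> {c i<..<c (Suc i)}) \<inter> (X \<inter> {c j<..<c (Suc j)}) = {}" if "i < j" for i j
          using mono[of "Suc i" j] that by auto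
        then show "\<forall>i\<in>{..<Suc n}. \<forall>j\<in>{..<Suc n}. i \<noteq> j \<longrightarrow> (X \<inter> {c i<..<c (Suc i)}) \<inter> (X \<inter> {c j<..<c (Suc j)}) = {}"
          by (metis inf_commute linorder_less_linear)
      qed (use X in auto)
      also have "\<dots> \<le> V" unfolding V_def using X by (intro sum_mono2) auto
      finally have 1: "(\<Sum>i<Suc n. \<Sum>x\<in>X \<inter> {c i<..<c (Suc i)}. (D 0 x)\<^sup>2) \<le> V" .
      have "I = (\<Sum>i<Suc n. integral {c i..c (Suc i)} (\<lambda>t. (D (Suc m) t)\<^sup>2))"
        unfolding I_def b c_def by (rule integral_partition[OF H0]) (use cont2 b in simp)
      then show ?thesis unfolding B_def sum.distrib sum_distrib_left[symmetric] using 1 by simp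
    qed
    have I0: "I \<ge> 0" unfolding I_def by (intro integral_nonneg integrable_continuous_real cont2) auto
    have V0: "V \<ge> 0" unfolding V_def by (intro sum_nonneg) auto
    have HI: "V + H ^ (2 * m + 1) * I \<le> \<kappa> ^ (2 * m + 1) * (V + h ^ (2 * m + 1) * I)"
    proof -
      have "H ^ (2 * m + 1) \<le> (\<kappa> * h) ^ (2 * m + 1)" using H0 H2 by (intro power_mono) auto
      then have "H ^ (2 * m + 1) * I \<le> (\<kappa> * h) ^ (2 * m + 1) * I" using I0 by (rule mult_right_mono)
      moreover have "1 * V \<le> \<kappa> ^ (2 * m + 1) * V" by (rule mult_right_mono[OF one_le_power[OF \<kappa>] V0])
      ultimately show ?thesis by (simp only: power_mult_distrib distrib_left mult.assoc mult_1)
    qed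
    have W0: "V + h ^ (2 * m + 1) * I \<ge> 0" using V0 I0 h by simp
    have sup: "(D 0 y)\<^sup>2 \<le> C * (V + h ^ (2 * m + 1) * I)" if y: "y \<in> {a..b}" for y
    proof -
      obtain i where i: "i \<le> n" "y \<in> {c i..c (Suc i)}"
        using partition_cell[OF H0, of y a n] y unfolding b c_def by blast
      have "(D 0 y)\<^sup>2 \<le> S * B i" by (rule cell[OF i])
      also have "B i \<le> (\<Sum>i<Suc n. B i)" by (rule member_le_sum) (use i B0 in auto)
      also have "\<dots> \<le> V + H ^ (2 * m + 1) * I" by (rule sumB)
      also have "\<dots> \<le> \<kappa> ^ (2 * m + 1) * (V + h ^ (2 * m + 1) * I)" by (rule HI)
      also have "\<dots> \<le> \<kappa> ^ (2 * m + 2) * (V + h ^ (2 * m + 1) * I)"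
        using \<kappa> W0 by (intro mult_right_mono power_increasing) auto
      finally show ?thesis using S by (simp add: C_def mult.assoc)
    qed
    have "integral {a..b} (\<lambda>t. (D 0 t)\<^sup>2) = (\<Sum>i<Suc n. integral {c i..c (Suc i)} (\<lambda>t. (D 0 t)\<^sup>2))"
      unfolding b c_def by (rule integral_partition[OF H0]) (use cont0 b in simp)
    also have "\<dots> \<le> (\<Sum>i<Suc n. S * H * B i)"
    proof (rule sum_mono)
      fix i assume "i \<in> {..<Suc n}"
      then have i: "i \<le> n" by simp
      have "norm (integral {c i..c (Suc i)} (\<lambda>t. (D 0 t)\<^sup>2)) \<le> S * B i * (c (Suc i) - c i)"
        by (rule integral_bound)
          (use continuous_on_subset[OF cont0 sub[OF i]] cell[OF i] cH[of i] H0 in auto)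
      then show "integral {c i..c (Suc i)} (\<lambda>t. (D 0 t)\<^sup>2) \<le> S * H * B i" using cH[of i] by (simp add: mult_ac)
    qed
    also have "\<dots> = S * H * (\<Sum>i<Suc n. B i)" by (simp only: sum_distrib_left)
    also have "\<dots> \<le> S * H * (\<kappa> ^ (2 * m + 1) * (V + h ^ (2 * m + 1) * I))"
      using S H0 sumB HI by (intro mult_left_mono) auto
    also have "\<dots> \<le> S * (\<kappa> * h) * (\<kappa> ^ (2 * m + 1) * (V + h ^ (2 * m + 1) * I))"
      using S H2 W0 \<kappa> by (intro mult_right_mono mult_left_mono) auto
    also have "\<dots> = C * (h * (V + h ^ (2 * m + 1) * I))" by (simp add: C_def mult_ac)
    finally have L2: "integral {a..b} (\<lambda>t. (D 0 t)\<^sup>2) \<le> C * (h * (V + h ^ (2 * m + 1) * I))" .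
    show "\<forall>y\<in>{a..b}. (D 0 y)\<^sup>2 \<le> C * ((\<Sum>x\<in>X. (D 0 x)\<^sup>2) + h ^ (2 * m + 1) * integral {a..b} (\<lambda>t. (D (Suc m) t)\<^sup>2))"
      using sup unfolding V_def I_def by blast
    show "integral {a..b} (\<lambda>t. (D 0 t)\<^sup>2) \<le> C * (h * ((\<Sum>x\<in>X. (D 0 x)\<^sup>2) + h ^ (2 * m + 1) * integral {a..b} (\<lambda>t. (D (Suc m) t)\<^sup>2)))"
      using L2 unfolding V_def I_def .
  qed
qed

section \<open>Derivatives and Sobolev norms of trigonometric sums\<close>

fun trig_deriv_cos trig_deriv_sin :: "nat \<Rightarrow> (nat \<Rightarrow> real) \<Rightarrow> (nat \<Rightarrow> real) \<Rightarrow> nat \<Rightarrow> real" where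
  "trig_deriv_cos 0 c d k = c k"
| "trig_deriv_sin 0 c d k = d k"
| "trig_deriv_cos (Suc j) c d k = 2 * pi * real k * trig_deriv_sin j c d k"
| "trig_deriv_sin (Suc j) c d k = - (2 * pi * real k) * trig_deriv_cos j c d k"

definition trigderiv :: "nat \<Rightarrow> (nat \<Rightarrow> real) \<Rightarrow> (nat \<Rightarrow> real) \<Rightarrow> nat \<Rightarrow> real \<Rightarrow> real" where
  "trigderiv N c d j = trigsum N (trig_deriv_cos j c d) (trig_deriv_sin j c d)"

lemma trigderiv_0: "trigderiv N c d 0 = trigsum N c d"
  by (simp add: trigderiv_def trigsum_def fun_eq_iff)

lemma trigderiv_deriv: "(trigderiv N c d j has_real_derivative trigderiv N c d (Suc j) x) (at x)"
  unfolding trigderiv_def trigsum_def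
  by (auto intro!: derivative_eq_intros DERIV_sum sum.cong simp: algebra_simps)

lemma continuous_on_trigderiv: "continuous_on S (trigderiv N c d j)"
  by (rule DERIV_continuous_on[OF has_field_derivative_at_within[OF trigderiv_deriv]])

lemma trig_deriv_sq:
  "(trig_deriv_cos j c d k)\<^sup>2 + (trig_deriv_sin j c d k)\<^sup>2 = (2 * pi * real k) ^ (2 * j) * ((c k)\<^sup>2 + (d k)\<^sup>2)"
proof (induction j)
  case (Suc j)
  have "(trig_deriv_cos (Suc j) c d k)\<^sup>2 + (trig_deriv_sin (Suc j) c d k)\<^sup>2 =
    (2 * pi * real k)\<^sup>2 * ((trig_deriv_cos j c d k)\<^sup>2 + (trig_deriv_sin j c d k)\<^sup>2)"
    by (simp add: power_mult_distrib algebra_simps)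
  then show ?case unfolding Suc.IH by (simp add: power2_eq_square mult_ac)
qed simp

lemma integral_cos_sin_int:
  "((\<lambda>y. cos (2 * pi * of_int k * y)) has_integral (if k = 0 then 1 else 0)) {0..1}"
  "((\<lambda>y. sin (2 * pi * of_int k * y)) has_integral 0) {0..1}"
proof -
  show "((\<lambda>y. cos (2 * pi * of_int k * y)) has_integral (if k = 0 then 1 else 0)) {0..1}"
    using integral_cos_period[of k 0] by simp
  show "((\<lambda>y. sin (2 * pi * of_int k * y)) has_integral 0) {0..1}"
  proof (cases "k = 0")
    case False
    \<comment> \<open>A shift by a quarter of the period turns the cosine of
      \<open>integral_cos_period\<close> into a sine.\<close>
    then have "2 * pi * of_int k * (1 / (4 * of_int k) - y) = pi / 2 - 2 * pi * of_int k * y" for y :: real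
      by (simp add: field_simps)
    then show ?thesis using integral_cos_period[of k "1 / (4 * of_int k)"] False by (simp add: cos_diff)
  qed simp
qed

text \<open>Frequencies \<open>k \<ge> 1\<close> have weight 1/2, the constant \<open>c 0\<close>
  has weight 1, and \<open>d 0\<close>, which multiplies \<open>sin 0\<close>, has weight 0. The
  terms \<open>(c 0)\<^sup>2 - (d 0)\<^sup>2\<close> correct the uniform 1/2.\<close>

lemma parseval:
  "((\<lambda>x. (trigsum N c d x)\<^sup>2) has_integral ((\<Sum>k\<le>N. (c k)\<^sup>2 + (d k)\<^sup>2) + (c 0)\<^sup>2 - (d 0)\<^sup>2) / 2) {0..1}"
proof -
  define e :: "int \<Rightarrow> real" where "e m = (if m = 0 then 1 else 0)" for m
  define P where "P j k x = ((c j * c k + d j * d k) * cos (2 * pi * of_int (int j - int k) * x)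
      + (c j * c k - d j * d k) * cos (2 * pi * of_int (int j + int k) * x)
      + (c j * d k + d j * c k) * sin (2 * pi * of_int (int j + int k) * x)
      + (d j * c k - c j * d k) * sin (2 * pi * of_int (int j - int k) * x)) / 2" for j k x
  have "(c j * cos (2 * pi * real j * x) + d j * sin (2 * pi * real j * x)) *
        (c k * cos (2 * pi * real k * x) + d k * sin (2 * pi * real k * x)) = P j k x" for j k x
  proof -
    have 1: "2 * pi * of_int (int j - int k) * x = 2 * pi * real j * x - 2 * pi * real k * x"
      "2 * pi * of_int (int j + int k) * x = 2 * pi * real j * x + 2 * pi * real k * x"
      by (simp_all add: algebra_simps)
    show ?thesis unfolding P_def 1 cos_add cos_diff sin_add sin_diff by (simp add: field_simps)
  qed
  then have sq: "(trigsum N c d x)\<^sup>2 = (\<Sum>j\<le>N. \<Sum>k\<le>N. P j k x)" for x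
    by (simp add: trigsum_def power2_eq_square sum_product)
  define Q where "Q j k = ((c j * c k + d j * d k) * e (int j - int k) + (c j * c k - d j * d k) * e (int j + int k)
     + (c j * d k + d j * c k) * 0 + (d j * c k - c j * d k) * 0) / 2" for j k
  have "((\<lambda>x. \<Sum>j\<le>N. \<Sum>k\<le>N. P j k x) has_integral (\<Sum>j\<le>N. \<Sum>k\<le>N. Q j k)) {0..1}"
    unfolding P_def Q_def e_def
    by (intro has_integral_sum has_integral_divide has_integral_add has_integral_mult_right integral_cos_sin_int) auto
  moreover have "(\<Sum>k\<le>N. Q j k) = ((c j)\<^sup>2 + (d j)\<^sup>2) / 2 + (if j = 0 then ((c 0)\<^sup>2 - (d 0)\<^sup>2) / 2 else 0)" if "j \<le> N" for j
  proof -
    have "(\<Sum>k\<le>N. Q j k) = (\<Sum>k\<le>N. (if k = j then ((c j)\<^sup>2 + (d j)\<^sup>2) / 2 else 0) + (if k = 0 then if j = 0 then ((c 0)\<^sup>2 - (d 0)\<^sup>2) / 2 else 0 else 0))"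
      unfolding Q_def e_def by (intro sum.cong) (auto simp: power2_eq_square field_simps)
    then show ?thesis using that by (simp add: sum.distrib)
  qed
  then have "(\<Sum>j\<le>N. \<Sum>k\<le>N. Q j k) = (\<Sum>j\<le>N. ((c j)\<^sup>2 + (d j)\<^sup>2) / 2 + (if j = 0 then ((c 0)\<^sup>2 - (d 0)\<^sup>2) / 2 else 0))"
    by (intro sum.cong) auto
  then have "(\<Sum>j\<le>N. \<Sum>k\<le>N. Q j k) = ((\<Sum>k\<le>N. (c k)\<^sup>2 + (d k)\<^sup>2) + (c 0)\<^sup>2 - (d 0)\<^sup>2) / 2"
    by (simp add: sum.distrib sum_divide_distrib add_divide_distrib diff_divide_distrib)
  ultimately show ?thesis unfolding sq by simp
qed

text \<open>The weights are the reciprocals of those in \<open>fourier_kernel\<close>, as a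
  reproducing norm requires. This is a function of the coefficients and not of the trigonometric
  sum: \<open>d 0\<close> counts, although the sum does not see it.\<close>

definition sobolev_sq :: "nat \<Rightarrow> nat \<Rightarrow> (nat \<Rightarrow> real) \<Rightarrow> (nat \<Rightarrow> real) \<Rightarrow> real" where
  "sobolev_sq s N c d = (\<Sum>k\<le>N. (1 + 4 * pi\<^sup>2 * (real k)\<^sup>2) ^ s * ((c k)\<^sup>2 + (d k)\<^sup>2))"

lemma sobolev_sq_nonneg: "sobolev_sq s N c d \<ge> 0"
  unfolding sobolev_sq_def by (intro sum_nonneg mult_nonneg_nonneg) auto

lemma integral_trigderiv_le:
  assumes "j \<le> s"
  shows "integral {0..1} (\<lambda>x. (trigderiv N c d j x)\<^sup>2) \<le> sobolev_sq s N c d"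
proof -
  define c' d' where "c' = trig_deriv_cos j c d" and "d' = trig_deriv_sin j c d"
  have "integral {0..1} (\<lambda>x. (trigderiv N c d j x)\<^sup>2) = ((\<Sum>k\<le>N. (c' k)\<^sup>2 + (d' k)\<^sup>2) + (c' 0)\<^sup>2 - (d' 0)\<^sup>2) / 2"
    using parseval[of N c' d'] by (simp add: trigderiv_def c'_def d'_def integral_unique)
  also have "\<dots> \<le> (\<Sum>k\<le>N. (c' k)\<^sup>2 + (d' k)\<^sup>2)"
  proof -
    have "(c' 0)\<^sup>2 + (d' 0)\<^sup>2 \<le> (\<Sum>k\<le>N. (c' k)\<^sup>2 + (d' k)\<^sup>2)"
      by (rule member_le_sum[of 0 "{..N}" "\<lambda>k. (c' k)\<^sup>2 + (d' k)\<^sup>2"]) auto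
    moreover
    have "(S + A - B) / 2 \<le> S" if "A + B \<le> S" "B \<ge> 0" for A B S :: real
    proof -
      have "S + A - B \<le> S * 2" using that by linarith
      then show ?thesis by (simp only: pos_divide_le_eq[of 2 "S + A - B" S, OF zero_less_numeral])
    qed
    from this[OF calculation zero_le_power2] show ?thesis .
  qed
  also have "\<dots> \<le> sobolev_sq s N c d"
    unfolding sobolev_sq_def c'_def d'_def trig_deriv_sq
  proof (intro sum_mono mult_right_mono)
    fix k
    define w where "w = 4 * pi\<^sup>2 * (real k)\<^sup>2"
    have w: "w \<ge> 0" by (simp add: w_def)
    have "(2 * pi * real k) ^ (2 * j) = w ^ j" by (simp add: w_def power_mult power_mult_distrib)
    also have "\<dots> \<le> (1 + w) ^ j" using w by (intro power_mono) auto
    also have "\<dots> \<le> (1 + w) ^ s" using w assms by (intro power_increasing) auto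
    finally show "(2 * pi * real k) ^ (2 * j) \<le> (1 + 4 * pi\<^sup>2 * (real k)\<^sup>2) ^ s" by (simp add: w_def)
  qed auto
  finally show ?thesis .
qed

text \<open>Sobolev embedding in dimension one. Where the square of the sum is minimal it is at most
  its mean, and from there the sum changes by at most the integral of the absolute derivative; both
  squares are bounded by the energy.\<close>

lemma trigsum_sup_le:
  assumes "s \<ge> 1" "x \<in> {0..1}"
  shows "(trigsum N c d x)\<^sup>2 \<le> 4 * sobolev_sq s N c d"
proof -
  define E where "E = sobolev_sq s N c d"
  let ?u = "trigderiv N c d 0" and ?u' = "trigderiv N c d 1"
  have c: "continuous_on {0..1} (\<lambda>y. (?u y)\<^sup>2)" by (intro continuous_intros continuous_on_trigderiv)
  obtain y where y: "y \<in> {0..1}" "\<And>z. z \<in> {0..1} \<Longrightarrow> (?u y)\<^sup>2 \<le> (?u z)\<^sup>2"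
    using continuous_attains_inf[OF compact_Icc _ c] by auto
  have "((\<lambda>z::real. (?u y)\<^sup>2) has_integral (?u y)\<^sup>2) {0..1}"
    using has_integral_const_real[of "(?u y)\<^sup>2" 0 1] by simp
  then have "(?u y)\<^sup>2 \<le> integral {0..1} (\<lambda>z. (?u z)\<^sup>2)"
    by (rule has_integral_le[where f = "\<lambda>z. (?u y)\<^sup>2" and g = "\<lambda>z. (?u z)\<^sup>2" and S = "{0..1}",
          OF _ integrable_integral[OF integrable_continuous_real[OF c]] y(2)])
  also have "\<dots> \<le> E" unfolding E_def by (rule integral_trigderiv_le) simp
  finally have 1: "(?u y)\<^sup>2 \<le> E" .
  have "\<bar>?u x - ?u y\<bar> \<le> integral {0..1} (\<lambda>t. \<bar>?u' t\<bar>)"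
  proof (rule integral_deriv_bound[where f = ?u and g = ?u'])
    show "(?u has_real_derivative ?u' z) (at z within {0..1})" for z
      using trigderiv_deriv[of N c d 0 z] by (simp add: has_field_derivative_at_within)
  qed (use assms(2) y(1) continuous_on_trigderiv in auto)
  then have "(?u x - ?u y)\<^sup>2 \<le> (integral {0..1} (\<lambda>t. \<bar>?u' t\<bar>))\<^sup>2"
    using power_mono[of "\<bar>?u x - ?u y\<bar>" "integral {0..1} (\<lambda>t. \<bar>?u' t\<bar>)" 2] by simp
  also have "\<dots> \<le> (1 - 0) * integral {0..1} (\<lambda>t. (?u' t)\<^sup>2)"
    by (rule integral_abs_square_le) (auto intro: continuous_on_trigderiv)
  also have "\<dots> \<le> E" unfolding E_def using integral_trigderiv_le[OF assms(1)] by simp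
  finally have 2: "(?u x - ?u y)\<^sup>2 \<le> E" .
  have "(?u x)\<^sup>2 \<le> 2 * ((?u x - ?u y)\<^sup>2 + (?u y)\<^sup>2)"
  proof -
    have "0 \<le> ((?u x - ?u y) - ?u y)\<^sup>2" by simp
    then show ?thesis by (simp add: power2_eq_square algebra_simps)
  qed
  then show ?thesis using 1 2 by (simp add: E_def trigderiv_0)
qed

text \<open>\<open>Cper\<close> provides derivatives only existentially; uniqueness of derivatives
  identifies them with \<open>trigderiv\<close>.\<close>

lemma Cper_trigderiv_bound:
  assumes "Cper m M (trigderiv N c d j)" "i \<le> m"
  shows "\<bar>trigderiv N c d (j + i) x\<bar> \<le> M"
  using assms
proof (induction m arbitrary: i j)
  case 0 then show ?case by simp
next
  case (Suc m)
  show ?case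
  proof (cases i)
    case 0 then show ?thesis using CperD(2)[OF Suc.prems(1)] by simp
  next
    case (Suc i')
    obtain G where G: "Cper m M G" "\<And>x. (trigderiv N c d j has_real_derivative G x) (at x)" using Suc.prems(1) by auto
    have "G x = trigderiv N c d (Suc j) x" for x by (rule DERIV_unique[OF G(2) trigderiv_deriv])
    then have "G = trigderiv N c d (Suc j)" by auto
    then show ?thesis using Suc.IH[of "Suc j" i'] G(1) Suc.prems(2) Suc by simp
  qed
qed

text \<open>With \<open>w = (2 * pi * k)\<^sup>2\<close>, Parseval bounds the sums with weights 1
  and \<open>w ^ m\<close> through the function and its \<open>m\<close>-th derivative, hence also
  the one with weight \<open>(1 + w) ^ m \<le> 2 ^ m * (1 + w ^ m)\<close>. The remaining factor
  \<open>(1 + w) ^ (s - m)\<close> is of order \<open>N ^ (2 * (s - m))\<close> as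
  \<open>k \<le> N\<close>. Parseval does not see \<open>d 0\<close>, which is therefore set to
  0.\<close>

lemma sobolev_sq_Cper_le:
  assumes p: "Cper m M (trigsum N c d)" and d0: "d 0 = 0" and N: "N \<ge> 1" and ms: "m \<le> s"
  shows "sobolev_sq s N c d \<le> (1 + 4 * pi\<^sup>2) ^ (s - m) * 2 ^ m * 4 * (real N ^ (s - m) * M)\<^sup>2"
proof -
  have low: "(\<Sum>k\<le>N. (2 * pi * real k) ^ (2 * j) * ((c k)\<^sup>2 + (d k)\<^sup>2)) \<le> 2 * M\<^sup>2" if j: "j \<le> m" for j
  proof -
    define c' d' where "c' = trig_deriv_cos j c d" and "d' = trig_deriv_sin j c d"
    have "d' 0 = 0" unfolding d'_def using d0 by (cases j) auto
    have hi: "((\<lambda>x. (trigderiv N c d j x)\<^sup>2) has_integral ((\<Sum>k\<le>N. (c' k)\<^sup>2 + (d' k)\<^sup>2) + (c' 0)\<^sup>2 - (d' 0)\<^sup>2) / 2) {0..1}"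
      unfolding trigderiv_def c'_def d'_def by (rule parseval)
    have cM: "((\<lambda>x::real. M\<^sup>2) has_integral M\<^sup>2) {0..1}" using has_integral_const_real[of "M\<^sup>2" 0 1] by simp
    have le: "(trigderiv N c d j x)\<^sup>2 \<le> M\<^sup>2" for x
    proof -
      have "\<bar>trigderiv N c d (0 + j) x\<bar> \<le> M"
        by (rule Cper_trigderiv_bound[OF _ j]) (use p in \<open>simp add: trigderiv_0\<close>)
      then show ?thesis using power_mono[of "\<bar>trigderiv N c d j x\<bar>" M 2] by simp
    qed
    have "((\<Sum>k\<le>N. (c' k)\<^sup>2 + (d' k)\<^sup>2) + (c' 0)\<^sup>2 - (d' 0)\<^sup>2) / 2 \<le> M\<^sup>2"
      by (rule has_integral_le[OF hi cM le])
    then have "(\<Sum>k\<le>N. (c' k)\<^sup>2 + (d' k)\<^sup>2) + (c' 0)\<^sup>2 - (d' 0)\<^sup>2 \<le> 2 * M\<^sup>2" by simp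
    moreover have "(c' 0)\<^sup>2 \<ge> 0" by simp
    moreover have "(d' 0)\<^sup>2 = 0" using \<open>d' 0 = 0\<close> by simp
    ultimately have "(\<Sum>k\<le>N. (c' k)\<^sup>2 + (d' k)\<^sup>2) \<le> 2 * M\<^sup>2" by linarith
    then show ?thesis unfolding trig_deriv_sq[symmetric] c'_def d'_def .
  qed
  define K where "K = (1 + 4 * pi\<^sup>2) ^ (s - m) * (real N)\<^sup>2 ^ (s - m) * 2 ^ m"
  have K0: "K \<ge> 0" by (simp add: K_def)
  have "sobolev_sq s N c d \<le> (\<Sum>k\<le>N. K * (((2 * pi * real k) ^ (2 * 0) + (2 * pi * real k) ^ (2 * m)) * ((c k)\<^sup>2 + (d k)\<^sup>2)))"
    unfolding sobolev_sq_def mult.assoc[symmetric]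
  proof (intro sum_mono mult_right_mono)
    fix k assume k: "k \<in> {..N}"
    define w where "w = 4 * pi\<^sup>2 * (real k)\<^sup>2"
    have w: "w \<ge> 0" by (simp add: w_def)
    have "(real k)\<^sup>2 \<le> (real N)\<^sup>2" using k by (intro power_mono) auto
    then have "w \<le> 4 * pi\<^sup>2 * (real N)\<^sup>2" unfolding w_def by (intro mult_left_mono) auto
    moreover have "1 \<le> (real N)\<^sup>2" using N by simp
    ultimately have wN: "1 + w \<le> (1 + 4 * pi\<^sup>2) * (real N)\<^sup>2" by (simp add: algebra_simps)
    have "(1 + w) ^ m \<le> 2 ^ m * (1 + w ^ m)"
    proof (cases "w \<le> 1")
      case True
      then have "(1 + w) ^ m \<le> 2 ^ m" using w by (intro power_mono) auto
      also have "\<dots> \<le> 2 ^ m * (1 + w ^ m)" using w by simp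
      finally show ?thesis .
    next
      case False
      then have "(1 + w) ^ m \<le> (2 * w) ^ m" using w by (intro power_mono) auto
      also have "\<dots> \<le> 2 ^ m * (1 + w ^ m)" by (simp add: power_mult_distrib)
      finally show ?thesis .
    qed
    moreover have "(1 + w) ^ (s - m) \<le> ((1 + 4 * pi\<^sup>2) * (real N)\<^sup>2) ^ (s - m)" using w wN by (intro power_mono) auto
    ultimately have "(1 + w) ^ (s - m) * (1 + w) ^ m \<le> ((1 + 4 * pi\<^sup>2) * (real N)\<^sup>2) ^ (s - m) * (2 ^ m * (1 + w ^ m))"
      using w by (intro mult_mono) auto
    moreover have "(1 + w) ^ (s - m) * (1 + w) ^ m = (1 + w) ^ s" using ms by (simp add: power_add[symmetric])
    moreover have "(2 * pi * real k) ^ (2 * m) = w ^ m" by (simp add: w_def power_mult power_mult_distrib)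
    ultimately show "(1 + 4 * pi\<^sup>2 * (real k)\<^sup>2) ^ s \<le> K * ((2 * pi * real k) ^ (2 * 0) + (2 * pi * real k) ^ (2 * m))"
      unfolding K_def w_def[symmetric] by (simp add: power_mult_distrib mult_ac)
  qed auto
  also have "\<dots> = K * ((\<Sum>k\<le>N. (2 * pi * real k) ^ (2 * 0) * ((c k)\<^sup>2 + (d k)\<^sup>2)) + (\<Sum>k\<le>N. (2 * pi * real k) ^ (2 * m) * ((c k)\<^sup>2 + (d k)\<^sup>2)))"
    by (simp only: sum_distrib_left[symmetric] sum.distrib distrib_right)
  also have "\<dots> \<le> K * (2 * M\<^sup>2 + 2 * M\<^sup>2)" using low[of 0] low[of m] K0 by (intro mult_left_mono add_mono) auto
  also have "\<dots> = (1 + 4 * pi\<^sup>2) ^ (s - m) * 2 ^ m * 4 * (real N ^ (s - m) * M)\<^sup>2"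
    by (simp add: K_def power_mult_distrib power_mult[symmetric] mult.commute)
  finally show ?thesis .
qed

text \<open>Removes the restriction on \<open>h\<close>. Up to \<open>\<eta>\<close> this is
  \<open>sampling_fine\<close>, with the integral of the top derivative enlarged to a full period.
  Beyond \<open>\<eta>\<close> the Sobolev embedding bounds both left-hand sides by
  \<open>4 * E\<close>, and \<open>h ^ (2 * s - 1) * E\<close> is no longer small compared with
  \<open>E\<close>.\<close>

lemma trigsum_sampling:
  assumes ab: "0 < a" "a < b" "b < 1" and s: "s \<ge> 1"
  shows "\<exists>C>0. \<forall>N c d X h. finite X \<longrightarrow> h > 0 \<longrightarrow> (\<forall>y\<in>{a<..<b}. \<exists>x\<in>X. \<bar>y - x\<bar> \<le> h) \<longrightarrow>
     (\<forall>y\<in>{a..b}. (trigsum N c d y)\<^sup>2 \<le> C * ((\<Sum>x\<in>X. (trigsum N c d x)\<^sup>2) + h ^ (2 * s - 1) * sobolev_sq s N c d)) \<and>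
     integral {a..b} (\<lambda>y. (trigsum N c d y)\<^sup>2) \<le> C * (h * ((\<Sum>x\<in>X. (trigsum N c d x)\<^sup>2) + h ^ (2 * s - 1) * sobolev_sq s N c d))"
proof -
  obtain m where m: "s = Suc m" using s by (cases s) auto
  have e: "2 * s - 1 = 2 * m + 1" using m by simp
  obtain C0 where C0: "C0 > 0" and fine: "\<And>a b h X (D :: nat \<Rightarrow> real \<Rightarrow> real).
     a < b \<Longrightarrow> h > 0 \<Longrightarrow> 2 ^ m * (4 * h) \<le> b - a \<Longrightarrow> finite X \<Longrightarrow>
     (\<forall>y\<in>{a<..<b}. \<exists>x\<in>X. \<bar>y - x\<bar> \<le> h) \<Longrightarrow>
     (\<forall>j\<le>m. \<forall>y\<in>{a..b}. (D j has_real_derivative D (Suc j) y) (at y within {a..b})) \<Longrightarrow>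
     continuous_on {a..b} (D (Suc m)) \<Longrightarrow>
     (\<forall>y\<in>{a..b}. (D 0 y)\<^sup>2 \<le> C0 * ((\<Sum>x\<in>X. (D 0 x)\<^sup>2) + h ^ (2 * m + 1) * integral {a..b} (\<lambda>t. (D (Suc m) t)\<^sup>2))) \<and>
     integral {a..b} (\<lambda>t. (D 0 t)\<^sup>2) \<le> C0 * (h * ((\<Sum>x\<in>X. (D 0 x)\<^sup>2) + h ^ (2 * m + 1) * integral {a..b} (\<lambda>t. (D (Suc m) t)\<^sup>2)))"
    using sampling_fine[of m] by auto
  define \<eta> where "\<eta> = (b - a) / (2 ^ m * 4)"
  \<comment> \<open>The last two entries serve \<open>h > \<eta>\<close>: one for the pointwise
    bound and one, with an additional power for the factor \<open>h\<close>, for the mean square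
    bound.\<close>
  define C where "C = max C0 (max (4 / \<eta> ^ (2 * m + 1)) (4 / \<eta> ^ (2 * m + 2)))"
  have \<eta>: "\<eta> > 0" using ab by (simp add: \<eta>_def)
  show ?thesis unfolding e
  proof (intro exI[of _ C] conjI allI impI)
    show "C > 0" using C0 by (simp add: C_def)
    fix N c d X and h :: real
    assume X: "finite X" and h: "h > 0" and cover: "\<forall>y\<in>{a<..<b}. \<exists>x\<in>X. \<bar>y - x\<bar> \<le> h"
    define V where "V = (\<Sum>x\<in>X. (trigsum N c d x)\<^sup>2)"
    define E where "E = sobolev_sq s N c d"
    have V: "V \<ge> 0" unfolding V_def by (intro sum_nonneg) auto
    have E: "E \<ge> 0" unfolding E_def by (rule sobolev_sq_nonneg)
    define R where "R = V + h ^ (2 * m + 1) * E"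
    have R: "R \<ge> 0" using V E h by (simp add: R_def)
    have "(\<forall>y\<in>{a..b}. (trigsum N c d y)\<^sup>2 \<le> C * R) \<and> integral {a..b} (\<lambda>y. (trigsum N c d y)\<^sup>2) \<le> C * (h * R)"
    proof (cases "h \<le> \<eta>")
      case True
      define I where "I = integral {a..b} (\<lambda>t. (trigderiv N c d (Suc m) t)\<^sup>2)"
      have cont: "continuous_on S (\<lambda>t. (trigderiv N c d (Suc m) t)\<^sup>2)" for S
        by (intro continuous_intros continuous_on_trigderiv)
      have "I \<le> integral {0..1} (\<lambda>t. (trigderiv N c d (Suc m) t)\<^sup>2)"
        unfolding I_def using ab by (intro integral_subset_le integrable_continuous_real cont) auto
      also have "\<dots> \<le> E" unfolding E_def using m by (intro integral_trigderiv_le) simp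
      finally have I: "V + h ^ (2 * m + 1) * I \<le> R" unfolding R_def using h by (intro add_left_mono mult_left_mono) auto
      have "2 ^ m * (4 * h) \<le> b - a" using True unfolding \<eta>_def by (simp add: field_simps)
      from fine[OF ab(2) h this X cover, of "trigderiv N c d"]
      have f: "\<forall>y\<in>{a..b}. (trigsum N c d y)\<^sup>2 \<le> C0 * (V + h ^ (2 * m + 1) * I)"
        "integral {a..b} (\<lambda>y. (trigsum N c d y)\<^sup>2) \<le> C0 * (h * (V + h ^ (2 * m + 1) * I))"
        unfolding trigderiv_0 V_def I_def
        by (auto intro: has_field_derivative_at_within trigderiv_deriv continuous_on_trigderiv)
      have "C0 * (V + h ^ (2 * m + 1) * I) \<le> C * R"
      proof -
        have "C0 * (V + h ^ (2 * m + 1) * I) \<le> C0 * R" using I C0 by (intro mult_left_mono) auto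
        also have "\<dots> \<le> C * R" using R by (intro mult_right_mono) (auto simp: C_def)
        finally show ?thesis .
      qed
      moreover have "C0 * (h * (V + h ^ (2 * m + 1) * I)) \<le> C * (h * R)"
      proof -
        have "C0 * (h * (V + h ^ (2 * m + 1) * I)) \<le> C0 * (h * R)" using I C0 h by (intro mult_left_mono) auto
        also have "\<dots> \<le> C * (h * R)" using h R by (intro mult_right_mono) (auto simp: C_def)
        finally show ?thesis .
      qed
      ultimately show ?thesis using f by (meson order_trans)
    next
      case False
      then have h\<eta>: "1 \<le> h ^ k / \<eta> ^ k" for k
        using \<eta> power_mono[of \<eta> h k] by (simp add: le_divide_eq)
      have sup: "(trigsum N c d y)\<^sup>2 \<le> 4 * E" if "y \<in> {a..b}" for y
        unfolding E_def using that ab by (intro trigsum_sup_le s) auto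
      have HE: "h ^ (2 * m + 1) * E \<le> R" using V by (simp add: R_def)
      have 1: "4 * E \<le> C * R"
      proof -
        have "4 * E \<le> 4 * (h ^ (2 * m + 1) / \<eta> ^ (2 * m + 1)) * E"
          using mult_right_mono[OF mult_left_mono[OF h\<eta>[of "2 * m + 1"], of 4] E] by simp
        also have "\<dots> = 4 / \<eta> ^ (2 * m + 1) * (h ^ (2 * m + 1) * E)" by simp
        also have "\<dots> \<le> C * R" using HE h E R C0 \<eta> by (intro mult_mono) (auto simp: C_def)
        finally show ?thesis .
      qed
      have 2: "4 * E \<le> C * (h * R)"
      proof -
        have "4 * E \<le> 4 * (h ^ (2 * m + 2) / \<eta> ^ (2 * m + 2)) * E"
          using mult_right_mono[OF mult_left_mono[OF h\<eta>[of "2 * m + 2"], of 4] E] by simp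
        also have "\<dots> = 4 / \<eta> ^ (2 * m + 2) * (h * (h ^ (2 * m + 1) * E))" by simp
        also have "\<dots> \<le> C * (h * R)"
        proof (rule mult_mono)
          show "h * (h ^ (2 * m + 1) * E) \<le> h * R" using HE h by (intro mult_left_mono) auto
          show "4 / \<eta> ^ (2 * m + 2) \<le> C" by (simp add: C_def)
        qed (use h E R C0 in \<open>auto simp: C_def\<close>)
        finally show ?thesis .
      qed
      have ci: "continuous_on {a..b} (\<lambda>y. (trigsum N c d y)\<^sup>2)"
        using continuous_on_trigderiv[of "{a..b}" N c d 0] by (auto simp: trigderiv_0 intro: continuous_intros)
      have "norm (integral {a..b} (\<lambda>y. (trigsum N c d y)\<^sup>2)) \<le> 4 * E * (b - a)"
        by (rule integral_bound) (use ab sup ci in auto)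
      also have "\<dots> \<le> 4 * E * 1" using E ab by (intro mult_left_mono) auto
      finally have "integral {a..b} (\<lambda>y. (trigsum N c d y)\<^sup>2) \<le> 4 * E" by simp
      then show ?thesis using sup 1 2 by (meson order_trans)
    qed
    then show "\<forall>y\<in>{a..b}. (trigsum N c d y)\<^sup>2 \<le> C * ((\<Sum>x\<in>X. (trigsum N c d x)\<^sup>2) + h ^ (2 * m + 1) * sobolev_sq s N c d)"
      "integral {a..b} (\<lambda>y. (trigsum N c d y)\<^sup>2) \<le> C * (h * ((\<Sum>x\<in>X. (trigsum N c d x)\<^sup>2) + h ^ (2 * m + 1) * sobolev_sq s N c d))"
      unfolding R_def V_def E_def by blast+
  qed
qed

section \<open>The truncated kernel as a reproducing kernel\<close>

definition kernel_cos :: "nat \<Rightarrow> (nat \<Rightarrow> real) \<Rightarrow> real list \<Rightarrow> nat \<Rightarrow> real" where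
  "kernel_cos s \<alpha> X k = (\<Sum>i<length X. \<alpha> i * cos (2 * pi * real k * X ! i)) / (1 + 4 * pi\<^sup>2 * (real k)\<^sup>2) ^ s"

definition kernel_sin :: "nat \<Rightarrow> (nat \<Rightarrow> real) \<Rightarrow> real list \<Rightarrow> nat \<Rightarrow> real" where
  "kernel_sin s \<alpha> X k = (\<Sum>i<length X. \<alpha> i * sin (2 * pi * real k * X ! i)) / (1 + 4 * pi\<^sup>2 * (real k)\<^sup>2) ^ s"

lemma weight_pos: "(1 + 4 * pi\<^sup>2 * (real k)\<^sup>2) > 0"
  by (simp add: add_pos_nonneg)

text \<open>The leading 1 of the kernel is the term \<open>k = 0\<close>, with weight 1 and a
  vanishing sine product.\<close>

lemma fourier_kernel_eq:
  "fourier_kernel s N x y = (\<Sum>k\<le>N. (cos (2 * pi * real k * x) * cos (2 * pi * real k * y)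
      + sin (2 * pi * real k * x) * sin (2 * pi * real k * y)) / (1 + 4 * pi\<^sup>2 * (real k)\<^sup>2) ^ s)"
proof -
  have w: "(1 + 4 * pi\<^sup>2 * (real k)\<^sup>2) powr (- real s) = 1 / (1 + 4 * pi\<^sup>2 * (real k)\<^sup>2) ^ s" for k
    using weight_pos[of k] by (simp add: powr_minus powr_realpow divide_inverse)
  have "{..N} = insert 0 {1..N}" by auto
  then show ?thesis unfolding fourier_kernel_def w
    by (simp add: sum.distrib add_divide_distrib)
qed

text \<open>Explains \<open>kernel_cos\<close> and \<open>kernel_sin\<close>: they are the Fourier
  coefficients of a combination of kernel sections at the design points.\<close>

lemma kernel_expansion:
  "(\<Sum>i<length X. fourier_kernel s N x (X ! i) * \<alpha> i) = trigsum N (kernel_cos s \<alpha> X) (kernel_sin s \<alpha> X) x"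
proof -
  have "(\<Sum>i<length X. fourier_kernel s N x (X ! i) * \<alpha> i) = (\<Sum>k\<le>N. \<Sum>i<length X.
      (cos (2 * pi * real k * x) * cos (2 * pi * real k * X ! i)
      + sin (2 * pi * real k * x) * sin (2 * pi * real k * X ! i)) / (1 + 4 * pi\<^sup>2 * (real k)\<^sup>2) ^ s * \<alpha> i)"
    unfolding fourier_kernel_eq sum_distrib_right by (rule sum.swap)
  also have "\<dots> = trigsum N (kernel_cos s \<alpha> X) (kernel_sin s \<alpha> X) x"
    unfolding trigsum_def kernel_cos_def kernel_sin_def sum_divide_distrib sum_distrib_right sum.distrib[symmetric]
    by (intro sum.cong refl) (simp add: add_divide_distrib algebra_simps)
  finally show ?thesis .
qed

text \<open>The reproducing property, extended linearly: the weights of the native inner product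
  cancel the divisors in \<open>kernel_cos\<close> and \<open>kernel_sin\<close>, and point
  evaluations remain.\<close>

lemma kernel_reproducing:
  "(\<Sum>k\<le>N. (1 + 4 * pi\<^sup>2 * (real k)\<^sup>2) ^ s * (kernel_cos s \<alpha> X k * c k + kernel_sin s \<alpha> X k * d k))
    = (\<Sum>i<length X. \<alpha> i * trigsum N c d (X ! i))"
proof -
  have "(1 + 4 * pi\<^sup>2 * (real k)\<^sup>2) ^ s * (kernel_cos s \<alpha> X k * c k + kernel_sin s \<alpha> X k * d k)
     = (\<Sum>i<length X. \<alpha> i * (c k * cos (2 * pi * real k * X ! i) + d k * sin (2 * pi * real k * X ! i)))" for k
  proof -
    define W where "W = (1 + 4 * pi\<^sup>2 * (real k)\<^sup>2) ^ s"
    have W: "W \<noteq> 0" unfolding W_def using weight_pos[of k] by simp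
    define P Q where "P = (\<Sum>i<length X. \<alpha> i * cos (2 * pi * real k * X ! i))"
      and "Q = (\<Sum>i<length X. \<alpha> i * sin (2 * pi * real k * X ! i))"
    have "W * (P / W * c k + Q / W * d k) = P * c k + Q * d k" using W by (simp add: field_simps)
    also have "\<dots> = (\<Sum>i<length X. \<alpha> i * (c k * cos (2 * pi * real k * X ! i) + d k * sin (2 * pi * real k * X ! i)))"
      unfolding P_def Q_def sum_distrib_right sum.distrib[symmetric] by (intro sum.cong refl) (simp add: algebra_simps)
    finally show ?thesis unfolding kernel_cos_def kernel_sin_def W_def P_def Q_def .
  qed
  then have "(\<Sum>k\<le>N. (1 + 4 * pi\<^sup>2 * (real k)\<^sup>2) ^ s * (kernel_cos s \<alpha> X k * c k + kernel_sin s \<alpha> X k * d k))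
    = (\<Sum>k\<le>N. \<Sum>i<length X. \<alpha> i * (c k * cos (2 * pi * real k * X ! i) + d k * sin (2 * pi * real k * X ! i)))" by simp
  also have "\<dots> = (\<Sum>i<length X. \<alpha> i * trigsum N c d (X ! i))"
    unfolding trigsum_def sum_distrib_left by (rule sum.swap)
  finally show ?thesis .
qed

text \<open>Minimality of the regularized interpolant \<open>g\<close> in energy form: expand \<open>p = u + g\<close> and use
  \<open>\<langle>u, g\<rangle> = \<Sum> \<alpha>\<^sub>i u (x\<^sub>i)\<close> together with \<open>lam \<alpha>\<^sub>i = u (x\<^sub>i) + y\<^sub>i - p (x\<^sub>i)\<close>.\<close>

lemma interpolant_energy:
  fixes c d :: "nat \<Rightarrow> real"
  assumes lam: "lam > 0"
    and eq: "\<And>i. i < length X \<Longrightarrow> trigsum N (kernel_cos s \<alpha> X) (kernel_sin s \<alpha> X) (X ! i) + lam * \<alpha> i = y i"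
  defines "c' \<equiv> \<lambda>k. c k - kernel_cos s \<alpha> X k" and "d' \<equiv> \<lambda>k. d k - kernel_sin s \<alpha> X k"
  shows "sobolev_sq s N c' d' + (\<Sum>i<length X. (trigsum N c' d' (X ! i))\<^sup>2) / lam
    \<le> sobolev_sq s N c d + (\<Sum>i<length X. (y i - trigsum N c d (X ! i))\<^sup>2) / lam"
proof -
  define u where "u i = trigsum N c' d' (X ! i)" for i
  define e where "e i = y i - trigsum N c d (X ! i)" for i
  have u: "trigsum N c' d' x = trigsum N c d x - trigsum N (kernel_cos s \<alpha> X) (kernel_sin s \<alpha> X) x" for x
    unfolding trigsum_def c'_def d'_def by (simp add: sum_subtractf[symmetric] algebra_simps)
  have la: "lam * \<alpha> i = e i + u i" if "i < length X" for i
    using eq[OF that] by (simp add: e_def u_def u)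
  have "sobolev_sq s N c d = sobolev_sq s N c' d' + 2 * (\<Sum>k\<le>N. (1 + 4 * pi\<^sup>2 * (real k)\<^sup>2) ^ s * (kernel_cos s \<alpha> X k * c' k + kernel_sin s \<alpha> X k * d' k))
      + sobolev_sq s N (kernel_cos s \<alpha> X) (kernel_sin s \<alpha> X)"
    unfolding sobolev_sq_def sum_distrib_left sum.distrib[symmetric] c'_def d'_def
    by (intro sum.cong refl) (simp add: power2_eq_square algebra_simps)
  then have 1: "sobolev_sq s N c d \<ge> sobolev_sq s N c' d' + 2 * (\<Sum>i<length X. \<alpha> i * u i)"
    unfolding kernel_reproducing u_def using sobolev_sq_nonneg by (metis le_add_same_cancel1)
  \<comment> \<open>After substituting \<open>\<alpha> i = (e i + u i) / lam\<close>, each numerator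
    is \<open>2 * (e + u) * u + e\<^sup>2 = u\<^sup>2 + (u + e)\<^sup>2\<close>; the second square
    is then dropped.\<close>
  have "2 * (\<Sum>i<length X. \<alpha> i * u i) + (\<Sum>i<length X. (e i)\<^sup>2) / lam = (\<Sum>i<length X. ((u i)\<^sup>2 + (u i + e i)\<^sup>2) / lam)"
    unfolding sum_distrib_left sum_divide_distrib sum.distrib[symmetric]
  proof (intro sum.cong refl)
    fix i assume "i \<in> {..<length X}"
    then have ai: "\<alpha> i = (e i + u i) / lam" using la[of i] lam by (simp add: field_simps)
    show "2 * (\<alpha> i * u i) + (e i)\<^sup>2 / lam = ((u i)\<^sup>2 + (u i + e i)\<^sup>2) / lam"
      unfolding ai using lam by (simp add: field_simps power2_eq_square)
  qed
  also have "\<dots> \<ge> (\<Sum>i<length X. (u i)\<^sup>2 / lam)"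
    using lam by (intro sum_mono divide_right_mono) auto
  finally have "(\<Sum>i<length X. (u i)\<^sup>2) / lam \<le> 2 * (\<Sum>i<length X. \<alpha> i * u i) + (\<Sum>i<length X. (e i)\<^sup>2) / lam"
    unfolding sum_divide_distrib[symmetric] .
  with 1 show ?thesis unfolding u_def e_def by linarith
qed

section \<open>Kernel matrices\<close>

lemma regularized_matrix_mult_vec:
  assumes "v \<in> carrier_vec (length X)" "i < length X"
  shows "((kernel_matrix \<Psi> X + lam \<cdot>\<^sub>m 1\<^sub>m (length X)) *\<^sub>v v) $ i
    = (\<Sum>j<length X. \<Psi> (X ! i) (X ! j) * v $ j) + lam * v $ i"
proof -
  have "((kernel_matrix \<Psi> X + lam \<cdot>\<^sub>m 1\<^sub>m (length X)) *\<^sub>v v) $ i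
     = (\<Sum>j<length X. (\<Psi> (X ! i) (X ! j) + lam * (if i = j then 1 else 0)) * v $ j)"
    using assms by (simp add: scalar_prod_def kernel_matrix_def lessThan_atLeast0) (intro sum.cong, auto)
  also have "\<dots> = (\<Sum>j<length X. \<Psi> (X ! i) (X ! j) * v $ j) + (\<Sum>j<length X. if j = i then lam * v $ i else 0)"
    unfolding sum.distrib[symmetric] by (intro sum.cong) (auto simp: algebra_simps)
  finally show ?thesis using assms by simp
qed

lemma injective_matrix_inverse:
  fixes A :: "real Matrix.mat"
  assumes A: "A \<in> carrier_mat n n"
    and inj: "\<And>v. v \<in> carrier_vec n \<Longrightarrow> (\<And>i. i < n \<Longrightarrow> (A *\<^sub>v v) $ i = 0) \<Longrightarrow> \<forall>i<n. v $ i = 0"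
  obtains B where "mat_inverse A = Some B" "A * B = 1\<^sub>m n" "B * A = 1\<^sub>m n" "B \<in> carrier_mat n n"
proof -
  have "Determinant.det A \<noteq> 0"
  proof
    assume "Determinant.det A = 0"
    then obtain v where v: "v \<in> carrier_vec n" "v \<noteq> 0\<^sub>v n" "A *\<^sub>v v = 0\<^sub>v n"
      using det_0_iff_vec_prod_zero_field[OF A] by blast
    have "\<forall>i<n. v $ i = 0" by (rule inj[OF v(1)]) (simp add: v(3))
    then have "v = 0\<^sub>v n" using v(1) by (intro eq_vecI) auto
    with v(2) show False by simp
  qed
  from det_non_zero_imp_unit[OF A this] have "A \<in> Units (ring_mat TYPE(real) n ())" .
  with mat_inverse(1)[OF A, of "()"] obtain B where B: "mat_inverse A = Some B" by (cases "mat_inverse A") auto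
  with mat_inverse(2)[OF A B] that show thesis by blast
qed

text \<open>\<open>kernel_reproducing\<close> applied to the combination itself. It gives positive
  semidefiniteness, and it shows that a null vector has vanishing Fourier coefficients up to
  \<open>N\<close>.\<close>

lemma kernel_quadratic_form:
  "(\<Sum>i<length X. \<alpha> i * (\<Sum>j<length X. fourier_kernel s N (X ! i) (X ! j) * \<alpha> j))
     = sobolev_sq s N (kernel_cos s \<alpha> X) (kernel_sin s \<alpha> X)"
  unfolding kernel_expansion
    kernel_reproducing[where s = s and c = "kernel_cos s \<alpha> X" and d = "kernel_sin s \<alpha> X", symmetric]
    sobolev_sq_def
  by (intro sum.cong refl) (simp add: power2_eq_square)

text \<open>Unpacks the matrix formula into coefficients and one equation per design point, the form
  that \<open>interpolant_energy\<close> takes.\<close>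

lemma regularized_interpolant_trigsum:
  assumes lam: "lam > 0"
  obtains \<alpha> where "regularized_interpolant (fourier_kernel s N) X lam f = trigsum N (kernel_cos s \<alpha> X) (kernel_sin s \<alpha> X)"
    "\<And>i. i < length X \<Longrightarrow> trigsum N (kernel_cos s \<alpha> X) (kernel_sin s \<alpha> X) (X ! i) + lam * \<alpha> i = f (X ! i)"
proof -
  define n where "n = length X"
  define A where "A = kernel_matrix (fourier_kernel s N) X + lam \<cdot>\<^sub>m 1\<^sub>m n"
  have A: "A \<in> carrier_mat n n" by (simp add: A_def kernel_matrix_def n_def)
  \<comment> \<open>Pairing a null vector with itself makes the nonnegative quadratic form of the
    kernel equal to \<open>- lam\<close> times a sum of squares.\<close>
  have inj: "\<forall>i<n. v $ i = 0" if v: "v \<in> carrier_vec n" and z: "\<And>i. i < n \<Longrightarrow> (A *\<^sub>v v) $ i = 0" for v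
  proof -
    define \<alpha> where "\<alpha> i = v $ i" for i
    have "(\<Sum>j<n. fourier_kernel s N (X ! i) (X ! j) * \<alpha> j) = - lam * \<alpha> i" if "i < n" for i
      using z[OF that] regularized_matrix_mult_vec[of v X i "fourier_kernel s N" lam] v that
      unfolding A_def n_def \<alpha>_def by simp
    then have "(\<Sum>i<n. \<alpha> i * (\<Sum>j<n. fourier_kernel s N (X ! i) (X ! j) * \<alpha> j)) = (\<Sum>i<n. - lam * (\<alpha> i)\<^sup>2)"
      by (intro sum.cong) (auto simp: power2_eq_square)
    then have "(\<Sum>i<n. - lam * (\<alpha> i)\<^sup>2) \<ge> 0"
      unfolding n_def kernel_quadratic_form using sobolev_sq_nonneg by metis
    then have "lam * (\<Sum>i<n. (\<alpha> i)\<^sup>2) \<le> 0" by (simp add: sum_distrib_left sum_negf)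
    then have "(\<Sum>i<n. (\<alpha> i)\<^sup>2) \<le> 0" using lam by (simp add: mult_le_0_iff)
    moreover have "(\<Sum>i<n. (\<alpha> i)\<^sup>2) \<ge> 0" by (intro sum_nonneg) auto
    ultimately have "(\<Sum>i<n. (\<alpha> i)\<^sup>2) = 0" by simp
    then show ?thesis by (subst (asm) sum_nonneg_eq_0_iff) (auto simp: \<alpha>_def)
  qed
  obtain B where B: "mat_inverse A = Some B" "A * B = 1\<^sub>m n" "B * A = 1\<^sub>m n" "B \<in> carrier_mat n n"
    by (rule injective_matrix_inverse[OF A inj])
  define y where "y = data_vec X f"
  have y: "y \<in> carrier_vec n" by (simp add: y_def data_vec_def n_def)
  define v where "v = B *\<^sub>v y"
  have v: "v \<in> carrier_vec n" using B(4) y by (simp add: v_def)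
  have Av: "A *\<^sub>v v = y" unfolding v_def using A B(2,4) y by (simp flip: assoc_mult_mat_vec)
  show thesis
  proof (rule that[of "\<lambda>i. v $ i"])
    show "regularized_interpolant (fourier_kernel s N) X lam f = trigsum N (kernel_cos s (\<lambda>i. v $ i) X) (kernel_sin s (\<lambda>i. v $ i) X)"
    proof
      fix x
      have "regularized_interpolant (fourier_kernel s N) X lam f x = scalar_prod (kernel_vec (fourier_kernel s N) X x) v"
        unfolding regularized_interpolant_def n_def[symmetric] A_def[symmetric] B(1) v_def y_def by simp
      also have "\<dots> = (\<Sum>j<length X. fourier_kernel s N x (X ! j) * v $ j)"
        using v by (auto simp: scalar_prod_def kernel_vec_def n_def lessThan_atLeast0 intro!: sum.cong)
      finally show "regularized_interpolant (fourier_kernel s N) X lam f x = trigsum N (kernel_cos s (\<lambda>i. v $ i) X) (kernel_sin s (\<lambda>i. v $ i) X) x"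
        unfolding kernel_expansion .
    qed
    fix i assume i: "i < length X"
    have "(\<Sum>j<length X. fourier_kernel s N (X ! i) (X ! j) * v $ j) + lam * v $ i = (A *\<^sub>v v) $ i"
      unfolding A_def n_def using i v by (subst regularized_matrix_mult_vec) (auto simp: n_def)
    also have "\<dots> = f (X ! i)" unfolding Av using i by (simp add: y_def data_vec_def)
    finally show "trigsum N (kernel_cos s (\<lambda>i. v $ i) X) (kernel_sin s (\<lambda>i. v $ i) X) (X ! i) + lam * v $ i = f (X ! i)"
      unfolding kernel_expansion .
  qed
qed

lemma kernel_matrix_mult_vec:
  assumes "v \<in> carrier_vec (length X)" "i < length X"
  shows "(kernel_matrix \<Psi> X *\<^sub>v v) $ i = (\<Sum>j<length X. \<Psi> (X ! i) (X ! j) * v $ j)"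
  using assms by (simp add: scalar_prod_def kernel_matrix_def lessThan_atLeast0)

lemma cis_inj_unit_interval:
  assumes "x \<in> {0<..<1}" "y \<in> {0<..<1}" "cis (2 * pi * x) = cis (2 * pi * y)"
  shows "x = y"
proof -
  have "cis (2 * pi * (x - y)) = 1"
    using assms(3) by (simp add: right_diff_distrib cis_divide[symmetric])
  then have "cos (2 * pi * (x - y)) = 1" by (metis cis.simps(1) one_complex.simps(1))
  then obtain k :: int where "2 * pi * (x - y) = of_int k * (2 * pi)" using cos_one_2pi_int by auto
  then have k: "x - y = of_int k" by simp
  have "\<bar>x - y\<bar> < 1" using assms by auto
  with k have "k = 0" by linarith
  with k show ?thesis by simp
qed

text \<open>A trigonometric polynomial of degree \<open>N\<close> is \<open>z\<^sup>-\<^sup>N\<close> times a polynomial of degree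
  \<open>2 N\<close> in \<open>z = e\<^sup>2\<^sup>\<pi>\<^sup>i\<^sup>x\<close>, so point evaluations at \<open>2 N + 1\<close> points are independent.\<close>

lemma invertible_kernel_matrix:
  assumes len: "length X = 2 * N + 1" and dist: "distinct X" and X: "set X \<subseteq> {0<..<1}"
  shows "invertible_mat (kernel_matrix (fourier_kernel s N) X)"
proof -
  define n where "n = length X"
  define K where "K = kernel_matrix (fourier_kernel s N) X"
  have K: "K \<in> carrier_mat n n" by (simp add: K_def kernel_matrix_def n_def)
  define z where "z i = cis (2 * pi * X ! i)" for i
  have z0: "z i \<noteq> 0" for i by (simp add: z_def)
  have zinj: "z i \<noteq> z j" if "i < n" "j < n" "i \<noteq> j" for i j
  proof
    assume "z i = z j"
    then have "X ! i = X ! j" unfolding z_def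
      using that X by (intro cis_inj_unit_interval subsetD[OF X]) (auto simp: n_def)
    then show False using that dist by (simp add: nth_eq_iff_index_eq n_def)
  qed
  have inj: "\<forall>i<n. v $ i = 0" if v: "v \<in> carrier_vec n" and z: "\<And>i. i < n \<Longrightarrow> (K *\<^sub>v v) $ i = 0" for v
  proof -
    define \<alpha> where "\<alpha> i = v $ i" for i
    have "(\<Sum>j<length X. fourier_kernel s N (X ! i) (X ! j) * \<alpha> j) = 0" if "i < length X" for i
      using z[of i] kernel_matrix_mult_vec[of v X i "fourier_kernel s N"] v that
      unfolding K_def n_def \<alpha>_def by simp
    then have "sobolev_sq s N (kernel_cos s \<alpha> X) (kernel_sin s \<alpha> X) = 0"
      unfolding kernel_quadratic_form[symmetric] by simp
    then have wz: "(1 + 4 * pi\<^sup>2 * (real k)\<^sup>2) ^ s * ((kernel_cos s \<alpha> X k)\<^sup>2 + (kernel_sin s \<alpha> X k)\<^sup>2) = 0" if "k \<le> N" for k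
      unfolding sobolev_sq_def using that
      by (subst (asm) sum_nonneg_eq_0_iff) (auto intro!: mult_nonneg_nonneg simp del: mult_eq_0_iff)
    have ks0: "kernel_cos s \<alpha> X k = 0 \<and> kernel_sin s \<alpha> X k = 0" if "k \<le> N" for k
    proof -
      have "(1 + 4 * pi\<^sup>2 * (real k)\<^sup>2) ^ s \<noteq> 0" using weight_pos[of k] by simp
      then have "(kernel_cos s \<alpha> X k)\<^sup>2 + (kernel_sin s \<alpha> X k)\<^sup>2 = 0"
        using wz[OF that] by (simp only: mult_eq_0_iff) simp
      then show ?thesis by (simp only: sum_power2_eq_zero_iff)
    qed
    have cs: "(\<Sum>i<n. \<alpha> i * cos (2 * pi * real k * X ! i)) = 0" "(\<Sum>i<n. \<alpha> i * sin (2 * pi * real k * X ! i)) = 0" if "k \<le> N" for k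
    proof -
      have "(1 + 4 * pi\<^sup>2 * (real k)\<^sup>2) ^ s \<noteq> 0" using weight_pos[of k] by simp
      moreover have "kernel_cos s \<alpha> X k = 0" "kernel_sin s \<alpha> X k = 0" using that ks0 by auto
      ultimately show "(\<Sum>i<n. \<alpha> i * cos (2 * pi * real k * X ! i)) = 0" "(\<Sum>i<n. \<alpha> i * sin (2 * pi * real k * X ! i)) = 0"
        unfolding kernel_cos_def kernel_sin_def n_def by (simp_all only: divide_eq_0_iff) simp_all
    qed
    have pw: "z i ^ k = Complex (cos (2 * pi * real k * X ! i)) (sin (2 * pi * real k * X ! i))" for i k
    proof -
      have "z i ^ k = cis (real k * (2 * pi * X ! i))" unfolding z_def by (rule Complex.DeMoivre)
      also have "real k * (2 * pi * X ! i) = 2 * pi * real k * X ! i" by simp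
      finally show ?thesis by (simp only: cis.code)
    qed
    have pos: "(\<Sum>i<n. of_real (\<alpha> i) * z i ^ k) = 0" "(\<Sum>i<n. of_real (\<alpha> i) * cnj (z i) ^ k) = 0" if "k \<le> N" for k
    proof -
      show "(\<Sum>i<n. of_real (\<alpha> i) * z i ^ k) = 0"
        unfolding pw using cs[OF that] by (simp add: complex_eq_iff)
      then have "cnj (\<Sum>i<n. of_real (\<alpha> i) * z i ^ k) = 0" by simp
      then show "(\<Sum>i<n. of_real (\<alpha> i) * cnj (z i) ^ k) = 0" by simp
    qed
    have zc: "z i * cnj (z i) = 1" for i by (simp add: z_def cis_cnj cis_mult)
    \<comment> \<open>The factor is \<open>z i\<close> to the power \<open>- N\<close>. It moves the
      vanishing moments from the frequencies -N to N to the exponents 0 to 2N, where they can be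
      tested against polynomials.\<close>
    define \<beta> where "\<beta> i = of_real (\<alpha> i) * cnj (z i) ^ N" for i
    have mom: "(\<Sum>i<n. \<beta> i * z i ^ k) = 0" if "k \<le> 2 * N" for k
    proof (cases "k \<le> N")
      case True
      have "cnj (z i) ^ N * z i ^ k = cnj (z i) ^ (N - k)" for i
      proof -
        have "cnj (z i) ^ N * z i ^ k = cnj (z i) ^ (N - k) * (z i * cnj (z i)) ^ k"
          using True by (simp only: power_mult_distrib) (simp add: power_add[symmetric])
        then show ?thesis by (simp add: zc)
      qed
      then show ?thesis using pos(2)[of "N - k"] by (simp add: \<beta>_def mult.assoc)
    next
      case False
      have "cnj (z i) ^ N * z i ^ k = z i ^ (k - N)" for i
      proof -
        have "cnj (z i) ^ N * z i ^ k = z i ^ (k - N) * (z i * cnj (z i)) ^ N"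
          using False by (simp only: power_mult_distrib) (simp add: power_add[symmetric])
        then show ?thesis by (simp add: zc)
      qed
      then show ?thesis using pos(1)[of "k - N"] False that by (simp add: \<beta>_def mult.assoc)
    qed
    have polyz: "(\<Sum>i<n. \<beta> i * poly p (z i)) = 0" if "degree p \<le> 2 * N" for p
    proof -
      have "(\<Sum>i<n. \<beta> i * poly p (z i)) = (\<Sum>i<n. \<Sum>k\<le>degree p. coeff p k * (\<beta> i * z i ^ k))"
        unfolding poly_altdef by (simp add: sum_distrib_left mult_ac)
      also have "\<dots> = (\<Sum>k\<le>degree p. coeff p k * (\<Sum>i<n. \<beta> i * z i ^ k))"
        unfolding sum_distrib_left by (rule sum.swap)
      also have "\<dots> = 0" using mom that by (intro sum.neutral) auto
      finally show ?thesis .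
    qed
    show ?thesis
    proof (intro allI impI)
      fix i assume i: "i < n"
      \<comment> \<open>The Lagrange factor of node \<open>i\<close>: of degree
        \<open>n - 1 = 2 * N\<close> and zero at all other nodes.\<close>
      define p where "p = (\<Prod>j\<in>{..<n} - {i}. [:- z j, 1:])"
      have "degree p = card ({..<n} - {i})" unfolding p_def by (subst degree_prod_eq_sum_degree) auto
      then have "degree p \<le> 2 * N" using i len by (simp add: n_def)
      from polyz[OF this] have "(\<Sum>j<n. \<beta> j * poly p (z j)) = 0" .
      moreover have "(\<Sum>j<n. \<beta> j * poly p (z j)) = (\<Sum>j<n. if j = i then \<beta> i * poly p (z i) else 0)"
        by (intro sum.cong) (auto simp: p_def poly_prod)
      ultimately have "\<beta> i * poly p (z i) = 0" using i by simp
      moreover have "poly p (z i) \<noteq> 0" using zinj i by (auto simp: p_def poly_prod)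
      ultimately show "v $ i = 0" using z0 by (auto simp: \<beta>_def \<alpha>_def)
    qed
  qed
  obtain B where B: "K * B = 1\<^sub>m n" "B * K = 1\<^sub>m n" "B \<in> carrier_mat n n"
    by (rule injective_matrix_inverse[OF K inj])
  then show ?thesis unfolding invertible_mat_def inverts_mat_def K_def[symmetric] square_mat.simps
    using K by (intro conjI exI[of _ B]) auto
qed

text \<open>For \<open>N = 1\<close> the kernel factors through the features 1, cosine and sine.
  More than three points have linearly dependent feature vectors, and the coefficients of the
  dependence form a null vector.\<close>

lemma singular_kernel_matrix:
  assumes len: "length X \<ge> 4" and dist: "distinct X" and X: "set X \<subseteq> {0<..<1}"
  shows "\<not> invertible_mat (kernel_matrix (fourier_kernel s 1) X)"
proof
  define n where "n = length X"
  define K where "K = kernel_matrix (fourier_kernel s 1) X"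
  have K: "K \<in> carrier_mat n n" by (simp add: K_def kernel_matrix_def n_def)
  assume "invertible_mat (kernel_matrix (fourier_kernel s 1) X)"
  then obtain B where B: "inverts_mat K B" "inverts_mat B K" unfolding invertible_mat_def K_def by blast
  then have KB: "K * B = 1\<^sub>m n" and BKr: "B * K = 1\<^sub>m (dim_row B)"
    using K unfolding inverts_mat_def by auto
  have "dim_col B = n" using arg_cong[OF KB, of dim_col] by simp
  moreover have "dim_row B = n" using arg_cong[OF BKr, of dim_col] K by simp
  ultimately have BK: "B * K = 1\<^sub>m n" "B \<in> carrier_mat n n" using BKr by auto
  \<comment> \<open>The feature map. Its target has real dimension 3, and injectivity on the points
    keeps the image at \<open>n\<close> elements, as \<open>dependent_biggerset\<close>
    requires.\<close>
  define g :: "real \<Rightarrow> complex \<times> real" where "g x = (cis (2 * pi * x), 1)" for x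
  have ginj: "inj_on g (set X)" unfolding inj_on_def g_def using cis_inj_unit_interval X by blast
  have "card (g ` set X) = n" using ginj dist by (simp add: card_image distinct_card n_def)
  then have "dependent (g ` set X)"
    using len by (intro dependent_biggerset) (auto simp: n_def)
  then obtain c where c: "\<exists>w\<in>g ` set X. c w \<noteq> 0" "(\<Sum>w\<in>g ` set X. c w *\<^sub>R w) = 0"
    using real_vector.dependent_finite[of "g ` set X"] by auto
  define \<alpha> where "\<alpha> i = c (g (X ! i))" for i
  have "(\<Sum>i<n. \<alpha> i *\<^sub>R g (X ! i)) = (\<Sum>x\<in>set X. c (g x) *\<^sub>R g x)"
    unfolding \<alpha>_def using sum.reindex_bij_betw[OF bij_betw_nth[OF dist, of "{..<n}" "set X"], of "\<lambda>x. c (g x) *\<^sub>R g x"]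
    by (simp add: n_def)
  also have "\<dots> = 0" using c(2) ginj by (simp add: sum.reindex)
  finally have s0: "(\<Sum>i<n. \<alpha> i *\<^sub>R g (X ! i)) = 0" .
  then have "fst (\<Sum>i<n. \<alpha> i *\<^sub>R g (X ! i)) = 0" "snd (\<Sum>i<n. \<alpha> i *\<^sub>R g (X ! i)) = 0" by simp_all
  then have s1: "(\<Sum>i<n. \<alpha> i *\<^sub>R cis (2 * pi * X ! i)) = 0" "(\<Sum>i<n. \<alpha> i) = 0"
    by (simp_all add: fst_sum snd_sum g_def)
  then have "Re (\<Sum>i<n. \<alpha> i *\<^sub>R cis (2 * pi * X ! i)) = 0" "Im (\<Sum>i<n. \<alpha> i *\<^sub>R cis (2 * pi * X ! i)) = 0" by simp_all
  then have s2: "(\<Sum>i<n. \<alpha> i * cos (2 * pi * X ! i)) = 0" "(\<Sum>i<n. \<alpha> i * sin (2 * pi * X ! i)) = 0"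
    by (simp_all add: Re_sum Im_sum)
  define v where "v = Matrix.vec n \<alpha>"
  have v: "v \<in> carrier_vec n" by (simp add: v_def)
  have kz: "kernel_cos s \<alpha> X k = 0 \<and> kernel_sin s \<alpha> X k = 0" if "k \<le> 1" for k
    using that s1(2) s2 by (cases k) (auto simp: kernel_cos_def kernel_sin_def n_def)
  have "K *\<^sub>v v = 0\<^sub>v n"
  proof (rule eq_vecI)
    fix i assume "i < dim_vec (0\<^sub>v n :: real Matrix.vec)"
    then have i: "i < length X" by (simp add: n_def)
    have "(K *\<^sub>v v) $ i = (\<Sum>j<length X. fourier_kernel s 1 (X ! i) (X ! j) * v $ j)"
      unfolding K_def using v i by (intro kernel_matrix_mult_vec) (auto simp: n_def)
    also have "\<dots> = (\<Sum>j<length X. fourier_kernel s 1 (X ! i) (X ! j) * \<alpha> j)"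
      by (intro sum.cong) (auto simp: v_def n_def)
    also have "\<dots> = 0" unfolding kernel_expansion trigsum_def using kz by simp
    finally show "(K *\<^sub>v v) $ i = 0\<^sub>v n $ i" using i by (simp add: n_def)
  qed (use K in simp)
  then have "B *\<^sub>v (K *\<^sub>v v) = 0\<^sub>v n" using BK(2) by (intro eq_vecI) auto
  then have "v = 0\<^sub>v n" using BK K v by (simp flip: assoc_mult_mat_vec)
  then have "\<alpha> i = 0" if "i < n" for i using that by (metis index_vec index_zero_vec(1) v_def)
  then show False using c(1) unfolding \<alpha>_def n_def by (metis imageE in_set_conv_nth)
qed

section \<open>Error bounds\<close>

lemma Ck_spaceD:
  assumes f: "f \<in> Ck_space m {a..b}" and ab: "a < b"
  shows "\<forall>j<m. \<forall>x\<in>{a..b}. (nth_deriv_within {a..b} j f has_real_derivative nth_deriv_within {a..b} (Suc j) f x) (at x within {a..b})"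
    and "continuous_on {a..b} (nth_deriv_within {a..b} m f)"
    and "\<forall>j\<le>m. \<forall>x\<in>{a..b}. \<bar>nth_deriv_within {a..b} j f x\<bar> \<le> Ck_norm m {a..b} f"
    and "0 \<le> Ck_norm m {a..b} f"
proof -
  have c: "continuous_on {a..b} (nth_deriv_within {a..b} j f)" if "j \<le> m" for j
    using f that by (auto simp: Ck_space_def)
  show "continuous_on {a..b} (nth_deriv_within {a..b} m f)" by (rule c) simp
  show "\<forall>j<m. \<forall>x\<in>{a..b}. (nth_deriv_within {a..b} j f has_real_derivative nth_deriv_within {a..b} (Suc j) f x) (at x within {a..b})"
  proof (intro allI impI ballI)
    fix j x assume j: "j < m" and x: "x \<in> {a..b}"
    have "nth_deriv_within {a..b} j f differentiable (at x within {a..b})"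
      using f j x by (auto simp: Ck_space_def differentiable_on_def)
    then show "(nth_deriv_within {a..b} j f has_real_derivative nth_deriv_within {a..b} (Suc j) f x) (at x within {a..b})"
      by (simp add: vector_derivative_works has_real_derivative_iff_has_vector_derivative)
  qed
  have bdd: "bdd_above ((\<lambda>x. \<bar>nth_deriv_within {a..b} j f x\<bar>) ` {a..b})" if "j \<le> m" for j
    by (intro bounded_imp_bdd_above compact_imp_bounded compact_continuous_image continuous_intros c that) auto
  have le: "\<bar>nth_deriv_within {a..b} j f x\<bar> \<le> (SUP x\<in>{a..b}. \<bar>nth_deriv_within {a..b} j f x\<bar>)"
    if "j \<le> m" "x \<in> {a..b}" for j x
    by (rule cSUP_upper[OF that(2) bdd[OF that(1)]])
  have nn: "0 \<le> (SUP x\<in>{a..b}. \<bar>nth_deriv_within {a..b} j f x\<bar>)" if "j \<le> m" for j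
    using le[OF that, of a] ab by (meson abs_ge_zero atLeastAtMost_iff less_imp_le order_refl order_trans)
  show "0 \<le> Ck_norm m {a..b} f" unfolding Ck_norm_def using nn by (intro sum_nonneg) auto
  show "\<forall>j\<le>m. \<forall>x\<in>{a..b}. \<bar>nth_deriv_within {a..b} j f x\<bar> \<le> Ck_norm m {a..b} f"
  proof (intro allI impI ballI)
    fix j x assume j: "j \<le> m" and x: "x \<in> {a..b}"
    have "(SUP x\<in>{a..b}. \<bar>nth_deriv_within {a..b} j f x\<bar>) \<le> Ck_norm m {a..b} f"
      unfolding Ck_norm_def
      by (rule member_le_sum[where f = "\<lambda>j. SUP x\<in>{a..b}. \<bar>nth_deriv_within {a..b} j f x\<bar>"]) (use j nn in auto)
    with le[OF j x] show "\<bar>nth_deriv_within {a..b} j f x\<bar> \<le> Ck_norm m {a..b} f" by linarith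
  qed
qed

lemma Ck_trig_approximation:
  fixes a b :: real
  assumes ab: "0 < a" "a < b" "b < 1"
  shows "\<exists>C>0. \<forall>f\<in>Ck_space m {a..b}. \<forall>N\<ge>1. \<exists>c d.
     (\<forall>x\<in>{a..b}. \<bar>f x - trigsum N c d x\<bar> \<le> C * (real N powr (- real m) * Ck_norm m {a..b} f)) \<and>
     sobolev_sq s N c d \<le> C * (real N powr max (real s - real m) 0 * Ck_norm m {a..b} f)\<^sup>2"
proof -
  obtain C1 where C1: "C1 \<ge> 0" and ext: "\<And>D M. (\<forall>j<m. \<forall>x\<in>{a..b}. (D j has_real_derivative D (Suc j) x) (at x within {a..b})) \<Longrightarrow>
     continuous_on {a..b} (D m) \<Longrightarrow> (\<forall>j\<le>m. \<forall>x\<in>{a..b}. \<bar>D j x\<bar> \<le> M) \<Longrightarrow>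
     (\<exists>F. Cper m (C1 * M) F \<and> (\<forall>x\<in>{a..b}. F x = D 0 x))"
    using Cper_extension[OF ab, of m] by blast
  \<comment> \<open>The native norm uses \<open>s\<close> derivatives and \<open>f\<close> offers
    \<open>m\<close>; with this \<open>r\<close> the exponent \<open>s - r\<close> is
    \<open>max (s - m) 0\<close>.\<close>
  define r where "r = min s m"
  define C2 where "C2 = (1 + 4 * pi\<^sup>2) ^ (s - r) * 2 ^ r * 4 * ((1 + 2 ^ m) * C1)\<^sup>2"
  define C where "C = 1 + 5 ^ m * C1 + C2"
  have C2: "C2 \<ge> 0" unfolding C2_def by (intro mult_nonneg_nonneg) auto
  show ?thesis
  proof (intro exI[of _ C] conjI ballI allI impI)
    show "C > 0" using C1 C2 unfolding C_def by (simp add: add_pos_nonneg)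
    fix f N assume f: "f \<in> Ck_space m {a..b}" and N: "1 \<le> (N::nat)"
    define M where "M = Ck_norm m {a..b} f"
    have M: "M \<ge> 0" unfolding M_def by (rule Ck_spaceD(4)[OF f ab(2)])
    obtain F where F: "Cper m (C1 * M) F" "\<And>x. x \<in> {a..b} \<Longrightarrow> F x = f x"
      using ext[OF Ck_spaceD(1-3)[OF f ab(2)]] unfolding M_def by auto
    obtain p where p: "trigpoly N p" "\<And>x. \<bar>F x - p x\<bar> \<le> (5 / real N) ^ m * (C1 * M)" "Cper m ((1 + 2 ^ m) * (C1 * M)) p"
      by (rule jackson[OF N F(1)]) (rule that)
    obtain c d0 where p0: "p = trigsum N c d0" using p(1) by (auto simp: trigpoly_def)
    \<comment> \<open>Leaves the sum unchanged but removes \<open>d 0\<close> from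
      \<open>sobolev_sq\<close>.\<close>
    define d where "d = d0(0 := 0)"
    have pd: "p = trigsum N c d" unfolding p0 trigsum_def d_def by (intro HOL.ext sum.cong) auto
    have "sobolev_sq s N c d \<le> (1 + 4 * pi\<^sup>2) ^ (s - r) * 2 ^ r * 4 * (real N ^ (s - r) * ((1 + 2 ^ m) * (C1 * M)))\<^sup>2"
    proof (rule sobolev_sq_Cper_le)
      show "Cper r ((1 + 2 ^ m) * (C1 * M)) (trigsum N c d)"
        unfolding pd[symmetric] by (rule Cper_le[OF p(3)]) (simp add: r_def)
    qed (use N in \<open>auto simp: r_def d_def\<close>)
    also have "\<dots> = C2 * (real N ^ (s - r) * M)\<^sup>2" by (simp add: C2_def power_mult_distrib)
    also have "real N ^ (s - r) = real N powr max (real s - real m) 0"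
    proof -
      have "max (real s - real m) 0 = real (s - r)" by (auto simp: r_def min_def max_def)
      then show ?thesis using N by (simp add: powr_realpow)
    qed
    also have "C2 * (real N powr max (real s - real m) 0 * M)\<^sup>2 \<le> C * (real N powr max (real s - real m) 0 * M)\<^sup>2"
      unfolding C_def using C1 by (intro mult_right_mono) auto
    finally have 1: "sobolev_sq s N c d \<le> C * (real N powr max (real s - real m) 0 * M)\<^sup>2" .
    have 2: "\<bar>f x - trigsum N c d x\<bar> \<le> C * (real N powr (- real m) * M)" if "x \<in> {a..b}" for x
    proof -
      have "\<bar>f x - trigsum N c d x\<bar> \<le> (5 / real N) ^ m * (C1 * M)" using p(2)[of x] F(2)[OF that] pd by simp
      also have "\<dots> = 5 ^ m * C1 * (real N powr (- real m) * M)"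
        using N by (simp add: powr_minus powr_realpow power_divide field_simps)
      also have "\<dots> \<le> C * (real N powr (- real m) * M)"
        unfolding C_def using C1 C2 M by (intro mult_right_mono) auto
      finally show ?thesis .
    qed
    show "\<exists>c d. (\<forall>x\<in>{a..b}. \<bar>f x - trigsum N c d x\<bar> \<le> C * (real N powr (- real m) * Ck_norm m {a..b} f)) \<and>
     sobolev_sq s N c d \<le> C * (real N powr max (real s - real m) 0 * Ck_norm m {a..b} f)\<^sup>2"
      using 1 2 unfolding M_def by blast
  qed
qed

text \<open>Positivity holds because \<open>X\<close> is finite and the interval is not. The last
  bound compares lengths, as the intervals of radius \<open>h\<close> about the points cover
  \<open>{a<..<b}\<close>. It serves twice: to absorb the approximation error in the mean square
  norm, and to force many points when \<open>h\<close> is small.\<close>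

lemma fill_distance_facts:
  fixes a b :: real
  assumes ab: "a < b" and X: "finite X" "X \<noteq> {}" "X \<subseteq> {a<..<b}"
  defines "h \<equiv> fill_distance {a<..<b} X"
  shows "h > 0" "\<forall>y\<in>{a<..<b}. \<exists>x\<in>X. \<bar>y - x\<bar> \<le> h" "b - a \<le> 2 * h * real (card X)"
proof -
  have bdd: "bdd_above ((\<lambda>x. infdist x X) ` {a<..<b})"
  proof -
    obtain z where z: "z \<in> X" using X by auto
    have "infdist x X \<le> b - a" if "x \<in> {a<..<b}" for x
    proof -
      have "z \<in> {a<..<b}" using X(3) z by auto
      then show ?thesis using infdist_le[OF z, of x] that by (auto simp: dist_real_def)
    qed
    then show ?thesis by (rule bdd_aboveI2)
  qed
  have le: "infdist y X \<le> h" if "y \<in> {a<..<b}" for y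
    unfolding h_def fill_distance_def by (rule cSUP_upper[OF that bdd])
  have "infinite ({a<..<b} - X)" using X(1) infinite_Ioo[OF ab] by (simp add: Diff_infinite_finite)
  then obtain y where y: "y \<in> {a<..<b}" "y \<notin> X" by (metis Diff_iff ex_in_conv finite.emptyI)
  have "infdist y X > 0" using y X finite_imp_closed[OF X(1)]
    by (metis in_closed_iff_infdist_zero infdist_nonneg le_less)
  with le[OF y(1)] show h: "h > 0" by simp
  show cover: "\<forall>y\<in>{a<..<b}. \<exists>x\<in>X. \<bar>y - x\<bar> \<le> h"
  proof
    fix y assume y: "y \<in> {a<..<b}"
    obtain x where "x \<in> X" "infdist y X = dist y x"
      using infdist_attains_inf[OF finite_imp_closed[OF X(1)] X(2)] by metis
    then show "\<exists>x\<in>X. \<bar>y - x\<bar> \<le> h" using le[OF y] by (auto simp: dist_real_def)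
  qed
  have "measure lborel {a<..<b} \<le> measure lborel (\<Union>x\<in>X. {x - h..x + h})"
  proof (rule measure_mono_fmeasurable)
    show "{a<..<b} \<subseteq> (\<Union>x\<in>X. {x - h..x + h})" using cover by (force simp: abs_le_iff)
    show "(\<Union>x\<in>X. {x - h..x + h}) \<in> fmeasurable lborel"
      by (intro fmeasurable.finite_UN X(1)) (auto simp: fmeasurable_def emeasure_lborel_Icc_eq)
  qed auto
  also have "\<dots> \<le> (\<Sum>x\<in>X. measure lborel {x - h..x + h})"
    by (rule measure_UNION_le[OF X(1)]) auto
  also have "\<dots> = 2 * h * real (card X)" using h by simp
  finally show "b - a \<le> 2 * h * real (card X)" using ab by simp
qed

lemma L2_norm_le:
  fixes a b :: real
  assumes "B \<ge> 0" and q: "continuous_on {a..b} q" "\<And>x. x \<in> {a..b} \<Longrightarrow> 0 \<le> q x"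
    and le: "\<And>x. x \<in> {a<..<b} \<Longrightarrow> (r x)\<^sup>2 \<le> q x" and int: "integral {a..b} q \<le> B\<^sup>2"
  shows "L2_norm {a<..<b} r \<le> ennreal B"
proof -
  define I where "I = (\<integral>\<^sup>+ x\<in>{a<..<b}. ennreal ((r x)\<^sup>2) \<partial>lborel)"
  have "I \<le> (\<integral>\<^sup>+ x. ennreal (indicator {a..b} x * q x) \<partial>lborel)"
    unfolding I_def by (intro nn_integral_mono) (auto simp: indicator_def intro!: ennreal_leI le)
  also have "\<dots> = ennreal (integral {a..b} q)"
    by (rule nn_integral_has_integral_lebesgue)
      (use q in \<open>auto intro!: integrable_integral integrable_continuous_real\<close>)
  also have "\<dots> \<le> ennreal (B\<^sup>2)" using int by (rule ennreal_leI)
  finally have I: "I \<le> ennreal (B\<^sup>2)" .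
  then have "I \<noteq> \<infinity>" by (auto simp: top_unique)
  moreover have "sqrt (enn2real I) \<le> B"
  proof -
    have "enn2real I \<le> B\<^sup>2" using enn2real_mono[OF I] by simp
    then show ?thesis using assms(1) by (simp add: real_le_lsqrt)
  qed
  ultimately show ?thesis unfolding L2_norm_def I_def[symmetric] by (simp add: ennreal_leI)
qed

text \<open>\<open>esssup\<close> is top for functions that are not measurable; continuity rules
  this out.\<close>

lemma Linf_norm_le:
  assumes "continuous_on \<Omega> r" "\<Omega> \<in> sets borel" "\<And>x. x \<in> \<Omega> \<Longrightarrow> \<bar>r x\<bar> \<le> B"
  shows "Linf_norm \<Omega> r \<le> ennreal B"
  unfolding Linf_norm_def
proof (rule esssup_I)
  have "r \<in> borel_measurable (restrict_space lborel \<Omega>)"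
    using borel_measurable_continuous_on_restrict[OF assms(1)]
    by (simp cong: measurable_cong_sets sets_restrict_space_cong)
  then show "(\<lambda>x. ennreal \<bar>r x\<bar>) \<in> borel_measurable (restrict_space lborel \<Omega>)" by measurable
  show "AE x in restrict_space lborel \<Omega>. ennreal \<bar>r x\<bar> \<le> ennreal B"
    by (rule AE_I2) (use assms(3) in \<open>auto simp: space_restrict_space intro: ennreal_leI\<close>)
qed

text \<open>The error splits into \<open>f - p\<close>, bounded by \<open>A * \<epsilon>\<close>,
  and \<open>u\<close>, a trigonometric sum of degree \<open>N\<close> to which the energy and
  sampling inequalities apply. Without logarithm and without condition on \<open>h\<close>, the
  result serves both halves of the theorem.\<close>

lemma interpolation_error:
  fixes a b c1 c2 :: real
  assumes ab: "0 < a" "a < b" "b < 1" and s: "s \<ge> 1" and c12: "0 < c1" "0 < c2"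
  shows "\<exists>C>0. \<forall>f\<in>Ck_space s0 {a..b}. \<forall>N X h lam.
     1 \<le> N \<longrightarrow> X \<noteq> [] \<longrightarrow> distinct X \<longrightarrow> set X \<subseteq> {a<..<b} \<longrightarrow> h = fill_distance {a<..<b} (set X) \<longrightarrow>
     c1 * h powr (real s - 1 / 2) \<le> sqrt lam \<longrightarrow> sqrt lam \<le> c2 * h powr (real s - 1 / 2) \<longrightarrow>
     L2_norm {a<..<b} (\<lambda>x. f x - regularized_interpolant (fourier_kernel s N) X lam f x)
       \<le> ennreal (C * (sqrt (real (length X)) * h powr (1 / 2) * real N powr (- real s0)
                 + h ^ s * real N powr max (real s - real s0) 0) * Ck_norm s0 {a..b} f) \<and>
     Linf_norm {a<..<b} (\<lambda>x. f x - regularized_interpolant (fourier_kernel s N) X lam f x)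
       \<le> ennreal (C * (sqrt (real (length X)) * real N powr (- real s0)
                 + h powr (real s - 1 / 2) * real N powr max (real s - real s0) 0) * Ck_norm s0 {a..b} f)"
proof -
  obtain A where A: "A > 0" and approx: "\<And>f N. f \<in> Ck_space s0 {a..b} \<Longrightarrow> 1 \<le> N \<Longrightarrow> \<exists>c d.
     (\<forall>x\<in>{a..b}. \<bar>f x - trigsum N c d x\<bar> \<le> A * (real N powr (- real s0) * Ck_norm s0 {a..b} f)) \<and>
     sobolev_sq s N c d \<le> A * (real N powr max (real s - real s0) 0 * Ck_norm s0 {a..b} f)\<^sup>2"
    using Ck_trig_approximation[OF ab, of s0 s] by blast
  obtain S where S: "S > 0" and samp: "\<And>N c d X h. finite X \<Longrightarrow> h > 0 \<Longrightarrow> (\<forall>y\<in>{a<..<b}. \<exists>x\<in>X. \<bar>y - x\<bar> \<le> h) \<Longrightarrow>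
     (\<forall>y\<in>{a..b}. (trigsum N c d y)\<^sup>2 \<le> S * ((\<Sum>x\<in>X. (trigsum N c d x)\<^sup>2) + h ^ (2 * s - 1) * sobolev_sq s N c d)) \<and>
     integral {a..b} (\<lambda>y. (trigsum N c d y)\<^sup>2) \<le> S * (h * ((\<Sum>x\<in>X. (trigsum N c d x)\<^sup>2) + h ^ (2 * s - 1) * sobolev_sq s N c d))"
    using trigsum_sampling[OF ab s] by blast
  \<comment> \<open>The second factor bounds \<open>H\<^sup>2 * Q\<close> in terms of
    \<open>B\<^sup>2\<close>; the first collects \<open>E \<le> Q\<close> and
    \<open>V \<le> lam * Q\<close>. In \<open>C\<close> the first entry is for the uniform norm, the
    second for the mean square norm.\<close>
  define T where "T = (1 + c2\<^sup>2) * (A + A\<^sup>2 / c1\<^sup>2)"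
  define C where "C = max (A + sqrt (S * T)) (sqrt (4 * A\<^sup>2 + 2 * S * T))"
  have T: "T > 0" unfolding T_def using A c12 by (intro mult_pos_pos add_pos_nonneg) auto
  show ?thesis
  proof (intro exI[of _ C] conjI ballI allI impI)
    show "C > 0" unfolding C_def using A S T by (simp add: less_max_iff_disj add_pos_nonneg)
    fix f N X h lam
    assume f: "f \<in> Ck_space s0 {a..b}" and N: "1 \<le> (N::nat)" and Xne: "X \<noteq> []" and dist: "distinct X"
      and X: "set X \<subseteq> {a<..<b}" and h: "h = fill_distance {a<..<b} (set X)"
      and l1: "c1 * h powr (real s - 1 / 2) \<le> sqrt lam" and l2: "sqrt lam \<le> c2 * h powr (real s - 1 / 2)"
    define n where "n = length X"
    define M where "M = Ck_norm s0 {a..b} f"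
    define \<epsilon> where "\<epsilon> = real N powr (- real s0) * M"
    define P where "P = real N powr max (real s - real s0) 0 * M"
    define H where "H = h powr (real s - 1 / 2)"
    have M: "M \<ge> 0" unfolding M_def by (rule Ck_spaceD(4)[OF f ab(2)])
    have \<epsilon>: "\<epsilon> \<ge> 0" and P: "P \<ge> 0" using M by (auto simp: \<epsilon>_def P_def)
    have cardn: "card (set X) = n" unfolding n_def by (rule distinct_card[OF dist])
    note fd = fill_distance_facts[OF ab(2), of "set X", folded h]
    have h0: "h > 0" and cover: "\<forall>y\<in>{a<..<b}. \<exists>x\<in>set X. \<bar>y - x\<bar> \<le> h" and nh: "b - a \<le> 2 * h * real n"
      using fd X Xne cardn by auto
    have n1: "real n \<ge> 1" using Xne by (cases X) (auto simp: n_def)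
    have H0: "H > 0" using h0 by (simp add: H_def)
    have H2: "H\<^sup>2 = h ^ (2 * s - 1)"
    proof -
      have "H\<^sup>2 = h powr (2 * (real s - 1/2))" unfolding H_def using h0
        by (simp only: power2_eq_square powr_add[symmetric]) (simp add: algebra_simps)
      also have "2 * (real s - 1/2) = real (2 * s - 1)" using s by (simp add: of_nat_diff)
      also have "h powr real (2 * s - 1) = h ^ (2 * s - 1)" by (rule powr_realpow[OF h0])
      finally show ?thesis .
    qed
    have "sqrt lam > 0" using l1 c12 H0 unfolding H_def[symmetric] by (meson less_le_trans mult_pos_pos)
    then have lam: "lam > 0" by simp
    have lam1: "c1\<^sup>2 * H\<^sup>2 \<le> lam"
      using power_mono[OF l1, of 2] c12 lam H0 unfolding H_def[symmetric] by (simp add: power_mult_distrib)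
    have lam2: "lam \<le> c2\<^sup>2 * H\<^sup>2"
      using power_mono[OF l2, of 2] lam unfolding H_def[symmetric] by (simp add: power_mult_distrib)
    obtain c d where p: "\<And>x. x \<in> {a..b} \<Longrightarrow> \<bar>f x - trigsum N c d x\<bar> \<le> A * \<epsilon>" "sobolev_sq s N c d \<le> A * P\<^sup>2"
      using approx[OF f N] unfolding \<epsilon>_def P_def M_def by blast
    obtain \<alpha> where I: "regularized_interpolant (fourier_kernel s N) X lam f = trigsum N (kernel_cos s \<alpha> X) (kernel_sin s \<alpha> X)"
      and eq: "\<And>i. i < length X \<Longrightarrow> trigsum N (kernel_cos s \<alpha> X) (kernel_sin s \<alpha> X) (X ! i) + lam * \<alpha> i = f (X ! i)"
      by (rule regularized_interpolant_trigsum[OF lam, of s N X f]) blast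
    define c' where "c' k = c k - kernel_cos s \<alpha> X k" for k
    define d' where "d' k = d k - kernel_sin s \<alpha> X k" for k
    define u where "u = trigsum N c' d'"
    have u: "u x = trigsum N c d x - regularized_interpolant (fourier_kernel s N) X lam f x" for x
      unfolding I u_def trigsum_def c'_def d'_def by (simp add: sum_subtractf[symmetric] algebra_simps)
    define E where "E = sobolev_sq s N c' d'"
    define V where "V = (\<Sum>x\<in>set X. (u x)\<^sup>2)"
    have E: "E \<ge> 0" unfolding E_def by (rule sobolev_sq_nonneg)
    have V: "V \<ge> 0" unfolding V_def by (intro sum_nonneg) auto
    have sumX: "(\<Sum>i<length X. g (X ! i)) = (\<Sum>x\<in>set X. g x)" for g :: "real \<Rightarrow> real"
      by (rule sum.reindex_bij_betw[OF bij_betw_nth[OF dist]]) auto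
    \<comment> \<open>The energy of \<open>p\<close> plus its misfit to the data, with noise of size
      \<open>A * \<epsilon>\<close> at each of the \<open>n\<close> points.\<close>
    define Q where "Q = A * P\<^sup>2 + real n * (A * \<epsilon>)\<^sup>2 / lam"
    have EV: "E + V / lam \<le> Q"
    proof -
      have "E + V / lam \<le> sobolev_sq s N c d + (\<Sum>i<length X. (f (X ! i) - trigsum N c d (X ! i))\<^sup>2) / lam"
        using interpolant_energy[OF lam eq, of c d] sumX[of "\<lambda>x. (u x)\<^sup>2"]
        unfolding E_def V_def u_def c'_def[abs_def] d'_def[abs_def] by simp
      also have "\<dots> \<le> Q"
      proof -
        have "(\<Sum>i<length X. (f (X ! i) - trigsum N c d (X ! i))\<^sup>2) \<le> (\<Sum>i<length X. (A * \<epsilon>)\<^sup>2)"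
        proof (rule sum_mono)
          fix i assume "i \<in> {..<length X}"
          then have "X ! i \<in> {a<..<b}" using X nth_mem by blast
          then have "\<bar>f (X ! i) - trigsum N c d (X ! i)\<bar> \<le> A * \<epsilon>" by (intro p(1)) auto
          then show "(f (X ! i) - trigsum N c d (X ! i))\<^sup>2 \<le> (A * \<epsilon>)\<^sup>2"
            using power_mono[of "\<bar>f (X ! i) - trigsum N c d (X ! i)\<bar>" "A * \<epsilon>" 2] by simp
        qed
        then show ?thesis unfolding Q_def using p(2) lam
          by (intro add_mono divide_right_mono) (auto simp: n_def)
      qed
      finally show ?thesis .
    qed
    have Q: "Q \<ge> 0" using EV E V lam by (meson add_nonneg_nonneg divide_nonneg_pos order_trans)
    define B where "B = H * P + sqrt (real n) * \<epsilon>"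
    have B: "B \<ge> 0" using H0 P \<epsilon> by (simp add: B_def)
    have VE: "V + H\<^sup>2 * E \<le> T * B\<^sup>2"
    proof -
      have HQ: "H\<^sup>2 * Q \<le> (A + A\<^sup>2 / c1\<^sup>2) * B\<^sup>2"
      proof -
        have "H\<^sup>2 / lam \<le> 1 / c1\<^sup>2" using lam1 lam c12 by (simp add: divide_simps mult.commute)
        then have "(H\<^sup>2 / lam) * (real n * (A * \<epsilon>)\<^sup>2) \<le> (1 / c1\<^sup>2) * (real n * (A * \<epsilon>)\<^sup>2)"
          by (rule mult_right_mono) simp
        then have 1: "H\<^sup>2 * Q \<le> A * (H * P)\<^sup>2 + A\<^sup>2 / c1\<^sup>2 * (sqrt (real n) * \<epsilon>)\<^sup>2"
          unfolding Q_def by (simp add: distrib_left power_mult_distrib mult_ac)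
        have "(H * P)\<^sup>2 \<le> B\<^sup>2" "(sqrt (real n) * \<epsilon>)\<^sup>2 \<le> B\<^sup>2"
          unfolding B_def using H0 P \<epsilon> by (intro power_mono; simp)+
        then have "A * (H * P)\<^sup>2 + A\<^sup>2 / c1\<^sup>2 * (sqrt (real n) * \<epsilon>)\<^sup>2 \<le> A * B\<^sup>2 + A\<^sup>2 / c1\<^sup>2 * B\<^sup>2"
          using A by (intro add_mono mult_left_mono) auto
        with 1 show ?thesis by (simp add: distrib_right)
      qed
      \<comment> \<open>Both sides of the condition on \<open>lam\<close> meet here: the lower one
        was used for \<open>HQ\<close>, the upper one bounds \<open>V\<close>.\<close>
      have "V / lam \<le> Q" "E \<le> Q" using EV E V lam by (auto intro: order_trans[rotated])
      then have "V \<le> lam * Q" using lam by (simp add: pos_divide_le_eq mult.commute)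
      also have "\<dots> \<le> c2\<^sup>2 * H\<^sup>2 * Q" using lam2 Q by (rule mult_right_mono)
      finally have "V + H\<^sup>2 * E \<le> c2\<^sup>2 * H\<^sup>2 * Q + H\<^sup>2 * Q"
        using \<open>E \<le> Q\<close> by (intro add_mono mult_left_mono) auto
      also have "\<dots> = (1 + c2\<^sup>2) * (H\<^sup>2 * Q)" by (simp add: algebra_simps)
      also have "\<dots> \<le> (1 + c2\<^sup>2) * ((A + A\<^sup>2 / c1\<^sup>2) * B\<^sup>2)"
        by (rule mult_left_mono[OF HQ]) simp
      finally show ?thesis by (simp add: T_def mult.assoc)
    qed
    have us: "(u y)\<^sup>2 \<le> S * T * B\<^sup>2" if "y \<in> {a..b}" for y
    proof -
      have "(u y)\<^sup>2 \<le> S * (V + H\<^sup>2 * E)"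
        using samp[of "set X" h N c' d'] h0 cover that unfolding H2 V_def E_def u_def by blast
      also have "\<dots> \<le> S * (T * B\<^sup>2)" using VE S by (intro mult_left_mono) auto
      finally show ?thesis by (simp add: mult.assoc)
    qed
    have ui: "integral {a..b} (\<lambda>y. (u y)\<^sup>2) \<le> S * T * (h * B\<^sup>2)"
    proof -
      have "integral {a..b} (\<lambda>y. (u y)\<^sup>2) \<le> S * (h * (V + H\<^sup>2 * E))"
        using samp[of "set X" h N c' d'] h0 cover unfolding H2 V_def E_def u_def by blast
      also have "\<dots> \<le> S * (h * (T * B\<^sup>2))" using VE S h0 by (intro mult_left_mono) auto
      finally show ?thesis by (simp add: mult_ac)
    qed
    define r where "r x = f x - regularized_interpolant (fourier_kernel s N) X lam f x" for x
    have r: "r x = (f x - trigsum N c d x) + u x" for x by (simp add: r_def u)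
    have contu: "continuous_on U u" for U
      using continuous_on_trigderiv[of U N c' d' 0] by (simp add: trigderiv_0 u_def)
    have contp: "continuous_on U (trigsum N c d)" for U
      using continuous_on_trigderiv[of U N c d 0] by (simp add: trigderiv_0)
    have contf: "continuous_on {a..b} f" using f by (auto simp: Ck_space_def dest: spec[of _ 0])
    have contr: "continuous_on {a<..<b} r"
      unfolding r by (intro continuous_intros contu contp continuous_on_subset[OF contf]) auto
    have \<epsilon>n: "\<epsilon> \<le> sqrt (real n) * \<epsilon>" using n1 \<epsilon> mult_right_mono[of 1 "sqrt (real n)" \<epsilon>] by simp
    have sup: "\<bar>r x\<bar> \<le> C * B" if x: "x \<in> {a<..<b}" for x
    proof -
      have "\<bar>u x\<bar> \<le> sqrt (S * T) * B"
      proof -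
        have "(u x)\<^sup>2 \<le> (sqrt (S * T) * B)\<^sup>2" using us[of x] x S T by (simp add: power_mult_distrib)
        then show ?thesis by (rule power2_le_imp_le[of "\<bar>u x\<bar>", simplified]) (use B S T in simp)
      qed
      moreover have "\<bar>f x - trigsum N c d x\<bar> \<le> A * B"
      proof -
        have "\<bar>f x - trigsum N c d x\<bar> \<le> A * \<epsilon>" using p(1) x by simp
        also have "\<epsilon> \<le> B" unfolding B_def using \<epsilon>n H0 P by (simp add: add_increasing)
        finally show ?thesis using A by simp
      qed
      ultimately have "\<bar>r x\<bar> \<le> A * B + sqrt (S * T) * B" unfolding r by (meson abs_triangle_ineq add_mono order_trans)
      also have "\<dots> = (A + sqrt (S * T)) * B" by (simp add: distrib_right)
      also have "\<dots> \<le> C * B" using B by (intro mult_right_mono) (auto simp: C_def)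
      finally show ?thesis .
    qed
    define L where "L = sqrt h * B"
    have L: "L \<ge> 0" using B h0 by (simp add: L_def)
    have L2: "L\<^sup>2 = h * B\<^sup>2" using h0 by (simp add: L_def power_mult_distrib)
    \<comment> \<open>The norm of \<open>f - p\<close> over an interval of fixed length carries no
      factor \<open>sqrt h\<close>; the covering bound supplies it in exchange for
      \<open>sqrt n\<close>.\<close>
    have epsL: "\<epsilon>\<^sup>2 * (b - a) \<le> 2 * L\<^sup>2"
    proof -
      have "\<epsilon>\<^sup>2 * (b - a) \<le> \<epsilon>\<^sup>2 * (2 * h * real n)" using nh by (intro mult_left_mono) auto
      also have "\<dots> = 2 * (h * (sqrt (real n) * \<epsilon>)\<^sup>2)" by (simp add: power_mult_distrib)
      also have "\<dots> \<le> 2 * (h * B\<^sup>2)"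
        unfolding B_def using h0 H0 P \<epsilon> by (intro mult_left_mono power_mono) auto
      finally show ?thesis by (simp add: L2)
    qed
    have "L2_norm {a<..<b} r \<le> ennreal (C * L)"
    proof (rule L2_norm_le[where q = "\<lambda>x. 2 * (A * \<epsilon>)\<^sup>2 + 2 * (u x)\<^sup>2"])
      show "0 \<le> C * L" using L S T A by (simp add: C_def le_max_iff_disj)
      show "continuous_on {a..b} (\<lambda>x. 2 * (A * \<epsilon>)\<^sup>2 + 2 * (u x)\<^sup>2)" by (intro continuous_intros contu)
      show "(r x)\<^sup>2 \<le> 2 * (A * \<epsilon>)\<^sup>2 + 2 * (u x)\<^sup>2" if x: "x \<in> {a<..<b}" for x
      proof -
        have "(f x - trigsum N c d x)\<^sup>2 \<le> (A * \<epsilon>)\<^sup>2"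
          using p(1)[of x] x power_mono[of "\<bar>f x - trigsum N c d x\<bar>" "A * \<epsilon>" 2] by simp
        moreover
        have "(y + z)\<^sup>2 \<le> 2 * y\<^sup>2 + 2 * z\<^sup>2" for y z :: real
          using sum_squares_bound[of y z] by (simp add: power2_sum)
        from this[of "f x - trigsum N c d x" "u x"] calculation show ?thesis unfolding r by linarith
      qed
      have iu: "(\<lambda>x. (u x)\<^sup>2) integrable_on {a..b}" by (intro integrable_continuous_real continuous_intros contu)
      have "integral {a..b} (\<lambda>x. 2 * (A * \<epsilon>)\<^sup>2 + 2 * (u x)\<^sup>2) = 2 * (A * \<epsilon>)\<^sup>2 * (b - a) + 2 * integral {a..b} (\<lambda>x. (u x)\<^sup>2)"
        using iu ab by (subst integral_add) (auto intro: integrable_on_mult_right)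
      also have "\<dots> \<le> 2 * A\<^sup>2 * (2 * L\<^sup>2) + 2 * (S * T * L\<^sup>2)"
        using ui mult_left_mono[OF epsL, of "2 * A\<^sup>2"] unfolding L2 by (simp add: power_mult_distrib mult_ac)
      also have "\<dots> = (sqrt (4 * A\<^sup>2 + 2 * S * T) * L)\<^sup>2" using S T by (simp add: power_mult_distrib algebra_simps)
      also have "\<dots> \<le> (C * L)\<^sup>2"
        using L S T by (intro power_mono mult_right_mono) (auto simp: C_def)
      finally show "integral {a..b} (\<lambda>x. 2 * (A * \<epsilon>)\<^sup>2 + 2 * (u x)\<^sup>2) \<le> (C * L)\<^sup>2" .
    qed auto
    moreover have "C * L = C * (sqrt (real (length X)) * h powr (1 / 2) * real N powr (- real s0)
                 + h ^ s * real N powr max (real s - real s0) 0) * Ck_norm s0 {a..b} f"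
    proof -
      have "h powr (1/2) * H = h ^ s"
        unfolding H_def powr_add[symmetric] using h0 by (simp add: powr_realpow)
      then have "L = (sqrt (real n) * h powr (1/2)) * \<epsilon> + h ^ s * P"
        unfolding L_def B_def using h0 by (simp add: powr_half_sqrt distrib_left mult_ac)
      then show ?thesis by (simp add: \<epsilon>_def P_def M_def n_def algebra_simps)
    qed
    ultimately show "L2_norm {a<..<b} (\<lambda>x. f x - regularized_interpolant (fourier_kernel s N) X lam f x)
       \<le> ennreal (C * (sqrt (real (length X)) * h powr (1 / 2) * real N powr (- real s0)
                 + h ^ s * real N powr max (real s - real s0) 0) * Ck_norm s0 {a..b} f)"
      by (simp only: r_def[abs_def])
    have "Linf_norm {a<..<b} r \<le> ennreal (C * B)"
      by (rule Linf_norm_le[OF contr _ sup]) auto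
    moreover have "C * B = C * (sqrt (real (length X)) * real N powr (- real s0)
                 + h powr (real s - 1 / 2) * real N powr max (real s - real s0) 0) * Ck_norm s0 {a..b} f"
      by (simp add: B_def H_def \<epsilon>_def P_def M_def n_def algebra_simps)
    ultimately show "Linf_norm {a<..<b} (\<lambda>x. f x - regularized_interpolant (fourier_kernel s N) X lam f x)
       \<le> ennreal (C * (sqrt (real (length X)) * real N powr (- real s0)
                 + h powr (real s - 1 / 2) * real N powr max (real s - real s0) 0) * Ck_norm s0 {a..b} f)"
      by (simp only: r_def[abs_def])
  qed
qed

theorem theorem4p8:
  fixes a b :: real and s s0 :: nat
  assumes "0 < a" and "a < b" and "b < 1"
    and "1 / 2 < real s"
  shows
    "(\<exists>h0>0. \<forall>c1>0. \<forall>c2>0. \<exists>C>0.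
        \<forall>f\<in>Ck_space s0 {a..b}. \<forall>N n (X :: real list) h lam.
          1 \<le> N \<longrightarrow> 1 \<le> n \<longrightarrow> length X = n \<longrightarrow> distinct X \<longrightarrow> set X \<subseteq> {a<..<b} \<longrightarrow>
          h = fill_distance {a<..<b} (set X) \<longrightarrow>
          invertible_mat (kernel_matrix (fourier_kernel s N) X) \<longrightarrow>
          h \<le> h0 \<longrightarrow>
          0 \<le> lam \<longrightarrow>
          c1 * h powr (real s - 1 / 2) \<le> sqrt lam \<longrightarrow>
          sqrt lam \<le> c2 * h powr (real s - 1 / 2) \<longrightarrow>
          L2_norm {a<..<b} (\<lambda>x. f x - regularized_interpolant (fourier_kernel s N) X lam f x)
            \<le> ennreal (C * (sqrt (real n) * h powr (1 / 2) * ln (real N) * real N powr (- real s0)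
                            + h ^ s * real N powr max (real s - real s0) 0)
                         * Ck_norm s0 {a..b} f) \<and>
          Linf_norm {a<..<b} (\<lambda>x. f x - regularized_interpolant (fourier_kernel s N) X lam f x)
            \<le> ennreal (C * (sqrt (real n) * ln (real N) * real N powr (- real s0)
                            + h powr (real s - 1 / 2) * real N powr max (real s - real s0) 0)
                         * Ck_norm s0 {a..b} f))
     \<and>
     (\<forall>c1>0. \<forall>c2>0. \<forall>c3>0. \<exists>C>0.
        \<forall>f\<in>Ck_space s0 {a..b}. \<forall>N n (X :: real list) h lam.
          1 \<le> N \<longrightarrow> 2 * N + 1 = n \<longrightarrow> length X = n \<longrightarrow> distinct X \<longrightarrow> set X \<subseteq> {a<..<b} \<longrightarrow>
          h = fill_distance {a<..<b} (set X) \<longrightarrow>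
          h \<le> c3 / real n \<longrightarrow>
          0 \<le> lam \<longrightarrow>
          c1 * h powr (real s - 1 / 2) \<le> sqrt lam \<longrightarrow>
          sqrt lam \<le> c2 * h powr (real s - 1 / 2) \<longrightarrow>
          invertible_mat (kernel_matrix (fourier_kernel s N) X) \<and>
          L2_norm {a<..<b} (\<lambda>x. f x - regularized_interpolant (fourier_kernel s N) X lam f x)
            \<le> ennreal (C * ln (real n) * real n powr (- real (min s0 s)) * Ck_norm s0 {a..b} f) \<and>
          Linf_norm {a<..<b} (\<lambda>x. f x - regularized_interpolant (fourier_kernel s N) X lam f x)
            \<le> ennreal (C * ln (real n) * real n powr (- (real (min s0 s) - 1 / 2))
                         * Ck_norm s0 {a..b} f))"
proof -
  have s: "s \<ge> 1" using assms(4) by (cases s) auto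
  note ab = assms(1-3)
  have X01: "set X \<subseteq> {0<..<1}" if "set X \<subseteq> {a<..<b}" for X :: "real list"
    using that ab by fastforce
  show ?thesis
  proof (intro conjI)
    show "\<exists>h0>0. \<forall>c1>0. \<forall>c2>0. \<exists>C>0.
        \<forall>f\<in>Ck_space s0 {a..b}. \<forall>N n (X :: real list) h lam.
          1 \<le> N \<longrightarrow> 1 \<le> n \<longrightarrow> length X = n \<longrightarrow> distinct X \<longrightarrow> set X \<subseteq> {a<..<b} \<longrightarrow>
          h = fill_distance {a<..<b} (set X) \<longrightarrow>
          invertible_mat (kernel_matrix (fourier_kernel s N) X) \<longrightarrow>
          h \<le> h0 \<longrightarrow>
          0 \<le> lam \<longrightarrow>
          c1 * h powr (real s - 1 / 2) \<le> sqrt lam \<longrightarrow>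
          sqrt lam \<le> c2 * h powr (real s - 1 / 2) \<longrightarrow>
          L2_norm {a<..<b} (\<lambda>x. f x - regularized_interpolant (fourier_kernel s N) X lam f x)
            \<le> ennreal (C * (sqrt (real n) * h powr (1 / 2) * ln (real N) * real N powr (- real s0)
                            + h ^ s * real N powr max (real s - real s0) 0)
                         * Ck_norm s0 {a..b} f) \<and>
          Linf_norm {a<..<b} (\<lambda>x. f x - regularized_interpolant (fourier_kernel s N) X lam f x)
            \<le> ennreal (C * (sqrt (real n) * ln (real N) * real N powr (- real s0)
                            + h powr (real s - 1 / 2) * real N powr max (real s - real s0) 0)
                         * Ck_norm s0 {a..b} f)"
    \<comment> \<open>Together with \<open>b - a \<le> 2 * h * n\<close> this forces
      \<open>n \<ge> 6\<close>, more than the three dimensions available for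
      \<open>N = 1\<close>.\<close>
    proof (rule exI[of _ "(b - a) / 12"], intro conjI allI impI)
      show "0 < (b - a) / 12" using ab by simp
      fix c1 c2 :: real assume c12: "0 < c1" "0 < c2"
      obtain C where C: "C > 0" and main: "\<And>f N X h lam. f \<in> Ck_space s0 {a..b} \<Longrightarrow>
         1 \<le> N \<Longrightarrow> X \<noteq> [] \<Longrightarrow> distinct X \<Longrightarrow> set X \<subseteq> {a<..<b} \<Longrightarrow> h = fill_distance {a<..<b} (set X) \<Longrightarrow>
         c1 * h powr (real s - 1 / 2) \<le> sqrt lam \<Longrightarrow> sqrt lam \<le> c2 * h powr (real s - 1 / 2) \<Longrightarrow>
         L2_norm {a<..<b} (\<lambda>x. f x - regularized_interpolant (fourier_kernel s N) X lam f x)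
           \<le> ennreal (C * (sqrt (real (length X)) * h powr (1 / 2) * real N powr (- real s0)
                     + h ^ s * real N powr max (real s - real s0) 0) * Ck_norm s0 {a..b} f) \<and>
         Linf_norm {a<..<b} (\<lambda>x. f x - regularized_interpolant (fourier_kernel s N) X lam f x)
           \<le> ennreal (C * (sqrt (real (length X)) * real N powr (- real s0)
                     + h powr (real s - 1 / 2) * real N powr max (real s - real s0) 0) * Ck_norm s0 {a..b} f)"
        using interpolation_error[OF ab s c12, of s0] by blast
      \<comment> \<open>\<open>ln 2\<close> is a lower bound for \<open>ln N\<close> and at most 1,
        so dividing by it pays for the logarithm and still covers the second term.\<close>
      define C' where "C' = C / ln 2"
      have ln2: "0 < ln (2::real)" "ln (2::real) \<le> 1" using ln_le_minus_one[of 2] by simp_all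
      have bound: "C * (x * y + z) * M \<le> C' * (x * ln (real N) * y + z) * M"
        if "N \<ge> 2" "x \<ge> 0" "y \<ge> 0" "z \<ge> 0" "M \<ge> 0" for x y z M :: real and N :: nat
      proof -
        have "ln 2 \<le> ln (real N)" using that(1) by simp
        then have "ln 2 * (x * y) \<le> ln (real N) * (x * y)" using that by (intro mult_right_mono) auto
        moreover have "ln 2 * z \<le> 1 * z" using ln2 that by (intro mult_right_mono)
        ultimately have "ln 2 * (x * y + z) \<le> x * ln (real N) * y + z" by (simp add: distrib_left mult_ac)
        then have "C' * (ln 2 * (x * y + z)) \<le> C' * (x * ln (real N) * y + z)"
          using C ln2 by (intro mult_left_mono) (auto simp: C'_def)
        moreover have "C' * (ln 2 * (x * y + z)) = C * (x * y + z)" using ln2 by (simp add: C'_def)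
        ultimately show ?thesis using that by (intro mult_right_mono) auto
      qed
      show "\<exists>C>0. \<forall>f\<in>Ck_space s0 {a..b}. \<forall>N n (X :: real list) h lam.
          1 \<le> N \<longrightarrow> 1 \<le> n \<longrightarrow> length X = n \<longrightarrow> distinct X \<longrightarrow> set X \<subseteq> {a<..<b} \<longrightarrow>
          h = fill_distance {a<..<b} (set X) \<longrightarrow>
          invertible_mat (kernel_matrix (fourier_kernel s N) X) \<longrightarrow>
          h \<le> (b - a) / 12 \<longrightarrow>
          0 \<le> lam \<longrightarrow>
          c1 * h powr (real s - 1 / 2) \<le> sqrt lam \<longrightarrow>
          sqrt lam \<le> c2 * h powr (real s - 1 / 2) \<longrightarrow>
          L2_norm {a<..<b} (\<lambda>x. f x - regularized_interpolant (fourier_kernel s N) X lam f x)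
            \<le> ennreal (C * (sqrt (real n) * h powr (1 / 2) * ln (real N) * real N powr (- real s0)
                            + h ^ s * real N powr max (real s - real s0) 0)
                         * Ck_norm s0 {a..b} f) \<and>
          Linf_norm {a<..<b} (\<lambda>x. f x - regularized_interpolant (fourier_kernel s N) X lam f x)
            \<le> ennreal (C * (sqrt (real n) * ln (real N) * real N powr (- real s0)
                            + h powr (real s - 1 / 2) * real N powr max (real s - real s0) 0)
                         * Ck_norm s0 {a..b} f)"
      proof (rule exI[of _ C'], intro conjI ballI allI impI)
        show "0 < C'" using C ln2 by (simp add: C'_def)
        fix f N n X h lam
        assume f: "f \<in> Ck_space s0 {a..b}" and N: "1 \<le> (N::nat)" and n: "1 \<le> (n::nat)" "length X = n"
          and X: "distinct X" "set X \<subseteq> {a<..<b}" and h: "h = fill_distance {a<..<b} (set X)"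
          and inv: "invertible_mat (kernel_matrix (fourier_kernel s N) X)" and hh: "h \<le> (b - a) / 12"
          and lam: "c1 * h powr (real s - 1 / 2) \<le> sqrt lam" "sqrt lam \<le> c2 * h powr (real s - 1 / 2)"
        have Xne: "X \<noteq> []" using n by auto
        note fd = fill_distance_facts[OF ab(2), of "set X", folded h]
        have h0: "h > 0" and nh: "b - a \<le> 2 * h * real n"
          using fd X Xne n distinct_card[OF X(1)] by auto
        have "N \<noteq> 1"
        proof
          assume "N = 1"
          have "12 * h \<le> b - a" using hh by simp
          then have "12 * h * real n \<le> (b - a) * real n" by (rule mult_right_mono) simp
          then have "(b - a) * 6 \<le> (b - a) * real n" using nh by (simp add: algebra_simps)
          then have "6 \<le> real n" by (rule mult_left_le_imp_le) (use ab in simp)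
          then have "4 \<le> length X" using n by simp
          from singular_kernel_matrix[OF this X(1) X01[OF X(2)]] inv \<open>N = 1\<close> show False by simp
        qed
        then have N2: "N \<ge> 2" using N by simp
        note m = main[OF f N Xne X h lam, unfolded n(2)]
        have M: "0 \<le> Ck_norm s0 {a..b} f" by (rule Ck_spaceD(4)[OF f ab(2)])
        show "L2_norm {a<..<b} (\<lambda>x. f x - regularized_interpolant (fourier_kernel s N) X lam f x)
            \<le> ennreal (C' * (sqrt (real n) * h powr (1 / 2) * ln (real N) * real N powr (- real s0)
                            + h ^ s * real N powr max (real s - real s0) 0)
                         * Ck_norm s0 {a..b} f)"
          by (rule order_trans[OF conjunct1[OF m] ennreal_leI], rule bound[OF N2]) (use M h0 in auto)
        show "Linf_norm {a<..<b} (\<lambda>x. f x - regularized_interpolant (fourier_kernel s N) X lam f x)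
            \<le> ennreal (C' * (sqrt (real n) * ln (real N) * real N powr (- real s0)
                            + h powr (real s - 1 / 2) * real N powr max (real s - real s0) 0)
                         * Ck_norm s0 {a..b} f)"
          by (rule order_trans[OF conjunct2[OF m] ennreal_leI], rule bound[OF N2]) (use M h0 in auto)
      qed
    qed
    show "\<forall>c1>0. \<forall>c2>0. \<forall>c3>0. \<exists>C>0.
        \<forall>f\<in>Ck_space s0 {a..b}. \<forall>N n (X :: real list) h lam.
          1 \<le> N \<longrightarrow> 2 * N + 1 = n \<longrightarrow> length X = n \<longrightarrow> distinct X \<longrightarrow> set X \<subseteq> {a<..<b} \<longrightarrow>
          h = fill_distance {a<..<b} (set X) \<longrightarrow>
          h \<le> c3 / real n \<longrightarrow>
          0 \<le> lam \<longrightarrow>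
          c1 * h powr (real s - 1 / 2) \<le> sqrt lam \<longrightarrow>
          sqrt lam \<le> c2 * h powr (real s - 1 / 2) \<longrightarrow>
          invertible_mat (kernel_matrix (fourier_kernel s N) X) \<and>
          L2_norm {a<..<b} (\<lambda>x. f x - regularized_interpolant (fourier_kernel s N) X lam f x)
            \<le> ennreal (C * ln (real n) * real n powr (- real (min s0 s)) * Ck_norm s0 {a..b} f) \<and>
          Linf_norm {a<..<b} (\<lambda>x. f x - regularized_interpolant (fourier_kernel s N) X lam f x)
            \<le> ennreal (C * ln (real n) * real n powr (- (real (min s0 s) - 1 / 2))
                         * Ck_norm s0 {a..b} f)"
    proof (intro allI impI)
      fix c1 c2 c3 :: real assume c: "0 < c1" "0 < c2" "0 < c3"
      \<comment> \<open>The estimate without logarithm is used again, not the first half, whose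
        \<open>ln N\<close> vanishes at \<open>N = 1\<close> and which demands a small
        \<open>h\<close>.\<close>
      obtain C where C: "C > 0" and main: "\<And>f N X h lam. f \<in> Ck_space s0 {a..b} \<Longrightarrow>
         1 \<le> N \<Longrightarrow> X \<noteq> [] \<Longrightarrow> distinct X \<Longrightarrow> set X \<subseteq> {a<..<b} \<Longrightarrow> h = fill_distance {a<..<b} (set X) \<Longrightarrow>
         c1 * h powr (real s - 1 / 2) \<le> sqrt lam \<Longrightarrow> sqrt lam \<le> c2 * h powr (real s - 1 / 2) \<Longrightarrow>
         L2_norm {a<..<b} (\<lambda>x. f x - regularized_interpolant (fourier_kernel s N) X lam f x)
           \<le> ennreal (C * (sqrt (real (length X)) * h powr (1 / 2) * real N powr (- real s0)
                     + h ^ s * real N powr max (real s - real s0) 0) * Ck_norm s0 {a..b} f) \<and>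
         Linf_norm {a<..<b} (\<lambda>x. f x - regularized_interpolant (fourier_kernel s N) X lam f x)
           \<le> ennreal (C * (sqrt (real (length X)) * real N powr (- real s0)
                     + h powr (real s - 1 / 2) * real N powr max (real s - real s0) 0) * Ck_norm s0 {a..b} f)"
        using interpolation_error[OF ab s c(1,2), of s0] by blast
      \<comment> \<open>\<open>3 ^ s0\<close> comes from \<open>n \<le> 3 * N\<close> and the powers
        of \<open>c3\<close> from \<open>h \<le> c3 / n\<close>; the constants of the two norms are
        added so that one \<open>D\<close> serves both.\<close>
      define D where "D = (c3 powr (1/2) + 1) * 3 ^ s0 + (c3 powr real s + c3 powr (real s - 1/2))"
      define \<mu> where "\<mu> = max (real s - real s0) 0"
      have D: "D > 0" unfolding D_def using c by (intro add_pos_nonneg mult_pos_pos) auto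
      show "\<exists>C>0. \<forall>f\<in>Ck_space s0 {a..b}. \<forall>N n (X :: real list) h lam.
          1 \<le> N \<longrightarrow> 2 * N + 1 = n \<longrightarrow> length X = n \<longrightarrow> distinct X \<longrightarrow> set X \<subseteq> {a<..<b} \<longrightarrow>
          h = fill_distance {a<..<b} (set X) \<longrightarrow>
          h \<le> c3 / real n \<longrightarrow>
          0 \<le> lam \<longrightarrow>
          c1 * h powr (real s - 1 / 2) \<le> sqrt lam \<longrightarrow>
          sqrt lam \<le> c2 * h powr (real s - 1 / 2) \<longrightarrow>
          invertible_mat (kernel_matrix (fourier_kernel s N) X) \<and>
          L2_norm {a<..<b} (\<lambda>x. f x - regularized_interpolant (fourier_kernel s N) X lam f x)
            \<le> ennreal (C * ln (real n) * real n powr (- real (min s0 s)) * Ck_norm s0 {a..b} f) \<and>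
          Linf_norm {a<..<b} (\<lambda>x. f x - regularized_interpolant (fourier_kernel s N) X lam f x)
            \<le> ennreal (C * ln (real n) * real n powr (- (real (min s0 s) - 1 / 2))
                         * Ck_norm s0 {a..b} f)"
      proof (rule exI[of _ "C * D"], intro conjI ballI allI impI)
        show "0 < C * D" using C D by simp
        fix f N n X h lam
        assume f: "f \<in> Ck_space s0 {a..b}" and N: "1 \<le> (N::nat)" and n: "2 * N + 1 = n" "length X = n"
          and X: "distinct X" "set X \<subseteq> {a<..<b}" and h: "h = fill_distance {a<..<b} (set X)"
          and hh: "h \<le> c3 / real n"
          and lam: "c1 * h powr (real s - 1 / 2) \<le> sqrt lam" "sqrt lam \<le> c2 * h powr (real s - 1 / 2)"
        show "invertible_mat (kernel_matrix (fourier_kernel s N) X)"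
          by (rule invertible_kernel_matrix[OF _ X(1) X01[OF X(2)]]) (use n in simp)
        have Xne: "X \<noteq> []" using n by auto
        have h0: "h > 0"
          using fill_distance_facts(1)[OF ab(2), of "set X", folded h] X Xne by auto
        note m = main[OF f N Xne X h lam, unfolded n(2), folded \<mu>_def]
        define M where "M = Ck_norm s0 {a..b} f"
        have M: "0 \<le> M" unfolding M_def by (rule Ck_spaceD(4)[OF f ab(2)])
        have n3: "real n \<ge> 3" "real n \<le> 3 * real N" "real N \<le> real n" using n N by auto
        \<comment> \<open>Since \<open>n = 2 * N + 1 \<ge> 3 \<ge> exp 1\<close>, the factor
          \<open>ln n\<close> can only enlarge the bound, even for \<open>N = 1\<close>.\<close>
        have ln_n: "ln (real n) \<ge> 1"
        proof -
          have "exp 1 \<le> (3::real)" by (rule exp_le)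
          then have "ln (exp 1) \<le> ln (real n)" using n3 by (subst ln_le_cancel_iff) auto
          then show ?thesis by simp
        qed
        define \<beta> where "\<beta> = real (min s0 s)"
        have Ns: "real N powr (- real s0) \<le> 3 ^ s0 * real n powr (- \<beta>)"
        proof -
          have "real N powr (- real s0) \<le> (real n / 3) powr (- real s0)"
            using n3 N by (intro powr_mono2') auto
          also have "\<dots> = 3 ^ s0 * real n powr (- real s0)"
            using n3 by (simp add: powr_divide powr_minus powr_realpow field_simps)
          also have "\<dots> \<le> 3 ^ s0 * real n powr (- \<beta>)"
            using n3 by (intro mult_left_mono powr_mono) (auto simp: \<beta>_def)
          finally show ?thesis .
        qed
        \<comment> \<open>By this identity \<open>h ^ s * N powr \<mu>\<close> is of order
          \<open>n powr (- s + \<mu>) = n powr (- \<beta>)\<close>, the claimed rate.\<close>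
        have \<mu>\<beta>: "\<mu> = real s - \<beta>" by (auto simp: \<mu>_def \<beta>_def min_def max_def)
        have hpow: "h powr t * real N powr \<mu> \<le> c3 powr t * real n powr (- t + \<mu>)" if t: "t \<ge> 0" for t
        proof -
          have "h powr t \<le> (c3 / real n) powr t" using hh h0 t by (intro powr_mono2) auto
          also have "\<dots> = c3 powr t * real n powr (- t)"
            using c n3 by (simp add: powr_divide powr_minus field_simps)
          finally have "h powr t \<le> c3 powr t * real n powr (- t)" .
          moreover have "real N powr \<mu> \<le> real n powr \<mu>" using n3 by (intro powr_mono2) (auto simp: \<mu>_def)
          ultimately have "h powr t * real N powr \<mu> \<le> c3 powr t * real n powr (- t) * real n powr \<mu>"
            by (intro mult_mono) auto
          then show ?thesis by (simp only: powr_add mult.assoc)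
        qed
        have sqn: "sqrt (real n) = real n powr (1/2)" using n3 by (simp add: powr_half_sqrt)
        have final: "C * Z * M \<le> C * D * ln (real n) * W * M" if "Z \<le> D * W" "W \<ge> 0" for Z W :: real
        proof -
          have "1 * (D * W) \<le> ln (real n) * (D * W)" using ln_n D that by (intro mult_right_mono) auto
          then have "Z \<le> D * ln (real n) * W" using that by (simp add: mult_ac)
          then have "C * Z * M \<le> C * (D * ln (real n) * W) * M"
            using C M by (intro mult_right_mono mult_left_mono) auto
          then show ?thesis by (simp add: mult_ac)
        qed
        have D1: "c3 powr (1/2) * 3 ^ s0 + c3 powr real s \<le> D"
          "3 ^ s0 + c3 powr (real s - 1/2) \<le> D"
          unfolding D_def using c by (simp_all add: algebra_simps add_increasing)
        have Z1: "sqrt (real n) * h powr (1 / 2) * real N powr (- real s0) + h ^ s * real N powr \<mu> \<le> D * real n powr (- \<beta>)"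
        proof -
          have "sqrt (real n) * h powr (1/2) \<le> c3 powr (1/2)"
          proof -
            have "(real n * h) powr (1/2) \<le> c3 powr (1/2)"
              using hh n3 h0 by (intro powr_mono2) (auto simp: field_simps)
            then show ?thesis using h0 n3 by (simp add: sqn powr_mult)
          qed
          then have 1: "sqrt (real n) * h powr (1/2) * real N powr (- real s0) \<le> c3 powr (1/2) * (3 ^ s0 * real n powr (- \<beta>))"
            using Ns by (intro mult_mono) auto
          have "h ^ s * real N powr \<mu> \<le> c3 powr real s * real n powr (- \<beta>)"
            using hpow[of "real s"] h0 by (simp add: \<mu>\<beta> powr_realpow)
          with 1 have "sqrt (real n) * h powr (1 / 2) * real N powr (- real s0) + h ^ s * real N powr \<mu>
            \<le> (c3 powr (1/2) * 3 ^ s0 + c3 powr real s) * real n powr (- \<beta>)" by (simp add: algebra_simps)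
          also have "\<dots> \<le> D * real n powr (- \<beta>)" using D1(1) by (intro mult_right_mono) auto
          finally show ?thesis .
        qed
        have Z2: "sqrt (real n) * real N powr (- real s0) + h powr (real s - 1 / 2) * real N powr \<mu> \<le> D * real n powr (- (\<beta> - 1/2))"
        proof -
          have "sqrt (real n) * real N powr (- real s0) \<le> real n powr (1/2) * (3 ^ s0 * real n powr (- \<beta>))"
            unfolding sqn using Ns by (intro mult_left_mono) auto
          also have "\<dots> = 3 ^ s0 * (real n powr (1/2) * real n powr (- \<beta>))" by simp
          also have "real n powr (1/2) * real n powr (- \<beta>) = real n powr (- (\<beta> - 1/2))"
            unfolding powr_add[symmetric] by (simp add: algebra_simps)
          finally have 1: "sqrt (real n) * real N powr (- real s0) \<le> 3 ^ s0 * real n powr (- (\<beta> - 1/2))" .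
          have e: "- (real s - 1/2) + \<mu> = - (\<beta> - 1/2)" by (simp add: \<mu>\<beta>)
          have "h powr (real s - 1/2) * real N powr \<mu> \<le> c3 powr (real s - 1/2) * real n powr (- (\<beta> - 1/2))"
            using hpow[of "real s - 1/2"] assms(4) unfolding e by simp
          with 1 have "sqrt (real n) * real N powr (- real s0) + h powr (real s - 1 / 2) * real N powr \<mu>
            \<le> (3 ^ s0 + c3 powr (real s - 1/2)) * real n powr (- (\<beta> - 1/2))" by (simp add: distrib_right)
          also have "\<dots> \<le> D * real n powr (- (\<beta> - 1/2))" using D1(2) by (intro mult_right_mono) auto
          finally show ?thesis .
        qed
        show "L2_norm {a<..<b} (\<lambda>x. f x - regularized_interpolant (fourier_kernel s N) X lam f x)
            \<le> ennreal (C * D * ln (real n) * real n powr (- real (min s0 s)) * Ck_norm s0 {a..b} f)"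
          unfolding M_def[symmetric] \<beta>_def[symmetric]
          by (rule order_trans[OF conjunct1[OF m, folded M_def] ennreal_leI[OF final[OF Z1]]]) simp
        show "Linf_norm {a<..<b} (\<lambda>x. f x - regularized_interpolant (fourier_kernel s N) X lam f x)
            \<le> ennreal (C * D * ln (real n) * real n powr (- (real (min s0 s) - 1 / 2)) * Ck_norm s0 {a..b} f)"
          unfolding M_def[symmetric] \<beta>_def[symmetric]
          by (rule order_trans[OF conjunct2[OF m, folded M_def] ennreal_leI[OF final[OF Z2]]]) simp
      qed
    qed
  qed
qed

end
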